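(* Let $\Pi_0$ be the law of the random density $\theta$ sampled by a Pólya tree $PT(\mathcal B,\mathcal A)$ on a compact set $\mathcal X\subset\mathbb R^d$ ($d\ge 1$) such that (1) $\alpha_\epsilon=a_{l(\epsilon)}$ depends only on the length of $\epsilon$; (2) $\sum_{l\ge1} l/a_l<\infty$; (3) $\lambda(B_\epsilon)=2^{-l(\epsilon)}$ for all $\epsilon\in E$. Let $f_0$ be a probability density on $\mathcal X$ for which there exists $\epsilon>0$ with $\Pi_0(\theta: K(f_0,\theta)\le\epsilon)>0$. Then, $\Pi_0$-almost surely, $$K(f_0,\theta)=-H(f_0)-\sum_{\epsilon\in E}\Big(P_X(B_{\epsilon0})\log(2Y_{\epsilon0})+P_X(B_{\epsilon1})\log\big(2(1-Y_{\epsilon0})\big)\Big).$$ Furthermore, if $X_1,X_2,\dots$ are i.i.d. with density $f_0$, then $\big(\mathbb E[K(f_0,\theta)\mid X_1,\dots,X_n]\big)_{n\in\mathbb N}$ is a supermartingale with respect to the filtration $\{\sigma(X_1,\dots,X_n)\}_{n\in\mathbb N}$.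
   Context: $E$ is the set of all finite binary sequences, including the empty sequence $\emptyset$; $l(\epsilon)$ is the length of $\epsilon$; $\lambda$ is Lebesgue measure. $\mathcal B=\{B_\epsilon:\epsilon\in E\}$ is a family of Borel subsets of $\mathcal X$ with $B_\emptyset=\mathcal X$, $\{B_{\epsilon0},B_{\epsilon1}\}$ a partition of $B_\epsilon$ for every $\epsilon\in E$, and $\mathcal B$ generating the Borel $\sigma$-algebra of $\mathcal X$. $\mathcal A=\{\alpha_\epsilon:\epsilon\in E\}$ is a family of positive reals. A Pólya tree $PT(\mathcal B,\mathcal A)$ is the law of a random probability measure $\mathcal P$ on $\mathcal X$ such that the variables $Y_{\epsilon0}:=\mathcal P(B_{\epsilon0}\mid B_\epsilon)$, $\epsilon\in E$, are independent with $Y_{\epsilon0}\sim\mathrm{Beta}(\alpha_{\epsilon0},\alpha_{\epsilon1})$. Under (1)–(3), $\mathcal P$ is a.s. absolutely continuous with respect to $\lambda$, and $\theta$ denotes its density. $P_X(B)=\int_B f_0\,d\lambda$; $H(f_0)=-\int_{\mathcal X} f_0\log f_0\,d\lambda$; $K(f,\theta)=\int_{\mathcal X} f\log(f/\theta)\,d\lambda$ is the Kullback–Leibler divergence. The sum over $E$ is understood as summed over successive tree levels (over all $\epsilon$ of length $0$, then $1$, then $2$, and so on). Given $\mathbf X_n=(X_1,\dots,X_n)$, the posterior is the Pólya tree $PT(\mathcal B,\{\alpha_\epsilon+N_\epsilon:\epsilon\in E\})$ with $N_\epsilon=\sum_{i=1}^n I_{B_\epsilon}(X_i)$; $\mathbb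 E[\cdot\mid X_1,\dots,X_n]$ applied to functions of $\theta$ denotes expectation over $\theta$ under this posterior. *)

theory Defs
  imports "HOL-Probability.Probability"
begin

text \<open>Binary sequences are \<^typ>\<open>bool list\<close>, \<^const>\<open>False\<close> standing for the digit 0 and
  \<^const>\<open>True\<close> for 1; a sequence is extended on the right, as in \<open>\<epsilon> @ [False]\<close>.\<close>

definition partition_tree :: "'a::euclidean_space set \<Rightarrow> (bool list \<Rightarrow> 'a set) \<Rightarrow> bool" where
  "partition_tree \<X> B \<longleftrightarrow>
     (\<forall>\<epsilon>. B \<epsilon> \<in> sets (restrict_space borel \<X>)) \<and>
     B [] = \<X> \<and>
     (\<forall>\<epsilon>. B (\<epsilon> @ [False]) \<union> B (\<epsilon> @ [True]) = B \<epsilon> \<and> B (\<epsilon> @ [False]) \<inter> B (\<epsilon> @ [True]) = {}) \<and>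
     sigma_sets \<X> (range B) = sets (restrict_space borel \<X>)"

definition beta_density :: "real \<Rightarrow> real \<Rightarrow> real \<Rightarrow> real" where
  "beta_density a b y =
     (if 0 < y \<and> y < 1 then y powr (a - 1) * (1 - y) powr (b - 1) / Beta a b else 0)"

text \<open>The conditional probability of \<open>B (\<epsilon> @ [False])\<close> given \<open>B \<epsilon>\<close> under \<open>Q\<close>. It is 0 by
  convention if \<open>B \<epsilon>\<close> is a null set, which for a Polya tree has probability 0.\<close>

definition split_prob :: "(bool list \<Rightarrow> 'a set) \<Rightarrow> bool list \<Rightarrow> 'a measure \<Rightarrow> real" where
  "split_prob B \<epsilon> Q = measure Q (B (\<epsilon> @ [False])) / measure Q (B \<epsilon>)"

text \<open>\<open>polya_tree \<X> B \<alpha> PT\<close>: the probability measure \<open>PT\<close> on the space of Borel probability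
  measures on \<open>\<X>\<close> is the Polya tree law with parameters \<open>B\<close> and \<open>\<alpha>\<close>.\<close>

definition polya_tree ::
    "'a::euclidean_space set \<Rightarrow> (bool list \<Rightarrow> 'a set) \<Rightarrow> (bool list \<Rightarrow> real) \<Rightarrow> 'a measure measure \<Rightarrow> bool" where
  "polya_tree \<X> B \<alpha> PT \<longleftrightarrow>
     prob_space PT \<and>
     sets PT = sets (prob_algebra (restrict_space borel \<X>)) \<and>
     prob_space.indep_vars PT (\<lambda>_. borel) (split_prob B) UNIV \<and>
     (\<forall>\<epsilon>. distributed PT lborel (split_prob B \<epsilon>)
            (\<lambda>y. ennreal (beta_density (\<alpha> (\<epsilon> @ [False])) (\<alpha> (\<epsilon> @ [True])) y)))"

text \<open>Parameters of the posterior Polya tree given the first \<open>n\<close> terms of \<open>x\<close>.\<close>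

definition posterior_param ::
    "(bool list \<Rightarrow> 'a set) \<Rightarrow> (bool list \<Rightarrow> real) \<Rightarrow> nat \<Rightarrow> (nat \<Rightarrow> 'a) \<Rightarrow> bool list \<Rightarrow> real" where
  "posterior_param B \<alpha> n x \<epsilon> = \<alpha> \<epsilon> + (\<Sum>i<n. indicator (B \<epsilon>) (x i))"

text \<open>The density of \<open>Q\<close> with respect to Lebesgue measure on \<open>\<X>\<close>; if \<open>Q\<close> is not absolutely
  continuous it is the zero function.\<close>

definition random_density :: "'a::euclidean_space set \<Rightarrow> 'a measure \<Rightarrow> 'a \<Rightarrow> real" where
  "random_density \<X> Q x = enn2real (RN_deriv (restrict_space lborel \<X>) Q x)"

definition prob_density_on :: "'a::euclidean_space set \<Rightarrow> ('a \<Rightarrow> real) \<Rightarrow> bool" where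
  "prob_density_on \<X> f \<longleftrightarrow>
     f \<in> borel_measurable (restrict_space lborel \<X>) \<and>
     (\<forall>x\<in>\<X>. 0 \<le> f x) \<and>
     (\<integral>\<^sup>+x. ennreal (f x) \<partial>restrict_space lborel \<X>) = 1"

text \<open>Lebesgue integral of an extended-real function, as the integral of the positive part minus
  that of the negative part. Unlike the Bochner integral it does not send a divergent integral to
  0. Wherever it is used below at least one part is finite.\<close>

definition ereal_integral :: "'b measure \<Rightarrow> ('b \<Rightarrow> ereal) \<Rightarrow> ereal" where
  "ereal_integral M g =
     enn2ereal (\<integral>\<^sup>+x. e2ennreal (g x) \<partial>M) - enn2ereal (\<integral>\<^sup>+x. e2ennreal (- g x) \<partial>M)"

definition diff_entropy :: "'a::euclidean_space set \<Rightarrow> ('a \<Rightarrow> real) \<Rightarrow> ereal" where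
  "diff_entropy \<X> f = - ereal_integral (restrict_space lborel \<X>) (\<lambda>x. ereal (f x * ln (f x)))"

text \<open>Conventions: \<open>0 log (0/t) = 0\<close>, and \<open>s log (s/0) = \<infinity>\<close> for \<open>s > 0\<close>.\<close>

definition kl_div :: "'a::euclidean_space set \<Rightarrow> ('a \<Rightarrow> real) \<Rightarrow> ('a \<Rightarrow> real) \<Rightarrow> ereal" where
  "kl_div \<X> f \<theta> = ereal_integral (restrict_space lborel \<X>)
     (\<lambda>x. if f x = 0 then 0 else if \<theta> x = 0 then \<infinity> else ereal (f x * ln (f x / \<theta> x)))"

definition density_measure :: "'a::euclidean_space set \<Rightarrow> ('a \<Rightarrow> real) \<Rightarrow> 'a measure" where
  "density_measure \<X> f = density (restrict_space lborel \<X>) (\<lambda>x. ennreal (f x))"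

text \<open>The \<open>n\<close>-th \<open>\<sigma>\<close>-algebra is generated by the first \<open>n\<close> variables \<open>X 0, \<dots>, X (n - 1)\<close>.\<close>

definition natural_filtration ::
    "'w measure \<Rightarrow> (nat \<Rightarrow> 'w \<Rightarrow> 'a::topological_space) \<Rightarrow> nat \<Rightarrow> 'w measure" where
  "natural_filtration M X n =
     vimage_algebra (space M) (\<lambda>\<omega>. \<lambda>i\<in>{..<n}. X i \<omega>) (\<Pi>\<^sub>M i\<in>{..<n}. borel)"

definition supermartingale :: "'w measure \<Rightarrow> (nat \<Rightarrow> 'w measure) \<Rightarrow> (nat \<Rightarrow> 'w \<Rightarrow> real) \<Rightarrow> bool" where
  "supermartingale M F Z \<longleftrightarrow>
     filtration (space M) F \<and>
     (\<forall>n. subalgebra M (F n)) \<and>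
     (\<forall>n. Z n \<in> borel_measurable (F n)) \<and>
     (\<forall>n. integrable M (Z n)) \<and>
     (\<forall>n. AE \<omega> in M. real_cond_exp M (F n) (Z (Suc n)) \<omega> \<le> Z n \<omega>)"

end

theory Submission
  imports Defs
begin

text \<open>Along the path of a point through the tree, \<open>log \<theta>\<close> is the sum of the logarithms of the doubled
  branch probabilities. These are independent with first and second moments of order \<open>1 / a\<^sub>l\<close> at level
  \<open>l\<close>, so the ratios \<open>2\<^sup>l Q(B\<^sub>\<epsilon>)\<close> converge in \<open>L\<^sup>1(\<lambda>)\<close>, and their logarithms in \<open>L\<^sup>1(P\<^sub>X)\<close>, along the
  levels \<open>4\<^sup>k\<close>, almost surely in \<open>Q\<close>; this identifies the density and the integral of \<open>f\<^sub>0 log \<theta>\<close>. The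
  positive probability of a finite divergence then forces \<open>f\<^sub>0 log f\<^sub>0\<close> to be integrable, hence
  \<open>P\<^sub>X(B\<^sub>\<epsilon>) = O(1 / l(\<epsilon>))\<close>. With this bound the variance of the level \<open>l\<close> term of the series is
  \<open>O(1 / (l a\<^sub>l))\<close>, and summability of \<open>l / a\<^sub>l\<close> gives absolute convergence of the whole series.

  All estimates hold uniformly for parameters between \<open>a\<^sub>l\<close> and \<open>a\<^sub>l + n\<close>, so they cover the posterior,
  whose expected divergence is an explicit function of the counts \<open>N\<^sub>\<epsilon>\<close>. Since \<open>\<psi>(x + 1) = \<psi>(x) + 1 / x\<close>,
  the expected decrease caused by one more observation is, node by node,
  \<open>p\<^sup>2 / \<alpha> + q\<^sup>2 / \<beta> - (p + q)\<^sup>2 / (\<alpha> + \<beta>) \<ge> 0\<close>.\<close>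

subsection \<open>Moments of the beta distribution\<close>

text \<open>Why levels 4^k, and why the entropy: an increment between levels m and n is controlled
  through its second moment, of the order of the sum of 1 / a_l over the block, so its mean absolute
  value is only of the order of a square root. Summability of l / a_l does not make these roots
  summable level by level (a_l = l^2 (ln l)^2 for large l), but it makes the tail from m on O(1 /
  m), and blocks from 4^k to 4^(k + 1) then cost 2^(-k). Convergence of the series over all levels
  has to come from elsewhere, namely from averaging over the many independent nodes of one level,
  which works only if no node carries too much P_X-mass.

  The order of the two arguments is forced: the first one needs no entropy bound, so it can be used
  to extract one from the divergence hypothesis, and the second one then relies on that bound.

  The posterior is given as one law per outcome, with no measurability in the outcome. Dependence on
  the outcome is therefore studied only on a closed formula in the counts.\<close>

lemma beta_density_nonneg:
  assumes "0 < a" "0 < b"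
  shows "0 \<le> beta_density a b y"
  using assms by (auto simp: beta_density_def Beta_def Gamma_real_pos less_imp_le)

lemma beta_density_measurable [measurable]: "beta_density a b \<in> borel_measurable borel"
  unfolding beta_density_def by measurable

lemma Beta_pos:
  fixes a b :: real
  assumes "0 < a" "0 < b"
  shows "0 < Beta a b"
  using assms by (simp add: Beta_def)

lemma has_bochner_integral_beta_density:
  assumes "0 < a" "0 < b"
  shows "has_bochner_integral lborel (beta_density a b) 1"
proof (rule has_bochner_integral_nn_integral)
  have "((\<lambda>y. y powr (a - 1) * (1 - y) powr (b - 1) / Beta a b) has_integral (Beta a b / Beta a b)) {0<..<1}"
    using has_integral_Beta_real[OF assms]
    by (intro has_integral_divide) (simp add: has_integral_Icc_iff_Ioo)
  then have "((\<lambda>y. if y \<in> {0<..<1} then y powr (a - 1) * (1 - y) powr (b - 1) / Beta a b else 0)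
      has_integral 1) UNIV"
    using Beta_pos[OF assms] by (subst has_integral_restrict_UNIV) simp
  then have "(beta_density a b has_integral 1) UNIV"
    by (simp add: beta_density_def[abs_def])
  then show "(\<integral>\<^sup>+x. ennreal (beta_density a b x) \<partial>lborel) = ennreal 1"
    by (intro nn_integral_has_integral_lborel) (auto intro: beta_density_nonneg assms)
qed (auto intro: beta_density_nonneg assms)

text \<open>Multiplication by y only raises the exponent of y, so up to a ratio of normalising
  constants it turns one beta density into another. Polynomial moments, and the inverse moment by
  reading the identity backwards, then follow from total mass 1.\<close>

lemma beta_density_times_id:
  assumes "0 < a" "0 < b"
  shows "beta_density a b y * y = a / (a + b) * beta_density (a + 1) b y"
proof -
  have "a \<notin> \<int>\<^sub>\<le>\<^sub>0" using assms by (auto elim!: nonpos_Ints_cases)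
  from Beta_plus1_left[OF this, of b]
  have "Beta (a + 1) b = a / (a + b) * Beta a b" using assms by (simp add: field_simps)
  moreover have "y powr a = y powr (a - 1) * y" if "0 < y"
    using that by (metis add.commute diff_add_cancel powr_add powr_one less_imp_le)
  ultimately show ?thesis using Beta_pos[OF assms] assms
    by (cases "0 < y \<and> y < 1") (simp_all add: beta_density_def)
qed

lemma beta_density_flip: "beta_density a b (1 - y) = beta_density b a y"
  by (auto simp: beta_density_def Beta_commute mult.commute)

lemma beta_density_times_flip:
  assumes "0 < a" "0 < b"
  shows "beta_density a b y * (1 - y) = b / (a + b) * beta_density a (b + 1) y"
  using beta_density_times_id[OF assms(2,1), of "1 - y"]
  by (simp add: beta_density_flip add.commute)

text \<open>Writing 1 = y + (1 - y) exhibits the law as the mixture of its two updates after one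
  observation, weighted by the predictive probabilities.\<close>

lemma beta_density_split:
  assumes "0 < a" "0 < b"
  shows "beta_density a b y = a / (a + b) * beta_density (a + 1) b y + b / (a + b) * beta_density a (b + 1) y"
  unfolding beta_density_times_id[OF assms, symmetric] beta_density_times_flip[OF assms, symmetric]
  by (simp add: algebra_simps)

lemma has_bochner_integral_beta_id:
  assumes "0 < a" "0 < b"
  shows "has_bochner_integral lborel (\<lambda>y. beta_density a b y * y) (a / (a + b))"
  unfolding beta_density_times_id[OF assms]
  using has_bochner_integral_mult_right[OF has_bochner_integral_beta_density[of "a + 1" b], of "a / (a + b)"] assms
  by simp

lemma has_bochner_integral_beta_square:
  assumes "0 < a" "0 < b"
  shows "has_bochner_integral lborel (\<lambda>y. beta_density a b y * y\<^sup>2) (a * (a + 1) / ((a + b) * (a + b + 1)))"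
proof -
  have "beta_density a b y * y\<^sup>2 = a / (a + b) * (beta_density (a + 1) b y * y)" for y
    unfolding power2_eq_square mult.assoc[symmetric] beta_density_times_id[OF assms] ..
  then show ?thesis
    using has_bochner_integral_mult_right[OF has_bochner_integral_beta_id[of "a + 1" b], of "a / (a + b)"] assms
    by (simp add: add_ac)
qed

text \<open>Needed because the bound in \<open>ln_sq_le\<close> contains 1 / z. The condition 1 < a
  is the origin of the threshold 2 in \<open>beta_dev_bound\<close>.\<close>

lemma has_bochner_integral_beta_inverse:
  assumes "1 < a" "0 < b"
  shows "has_bochner_integral lborel (\<lambda>y. beta_density a b y / y) ((a + b - 1) / (a - 1))"
proof -
  have "beta_density a b y / y = (a + b - 1) / (a - 1) * beta_density (a - 1) b y" for y
  proof (cases "y = 0")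
    case False
    then show ?thesis
      using beta_density_times_id[of "a - 1" b y] assms by (simp add: field_simps)
  qed (simp add: beta_density_def)
  then show ?thesis
    using has_bochner_integral_mult_right[OF has_bochner_integral_beta_density[of "a - 1" b], of "(a + b - 1) / (a - 1)"] assms
    by simp
qed

text \<open>\<open>ln_bound\<close> applied to y to the power - c / 2, then squared: a logarithm
  costs only an arbitrarily small power of y.\<close>

lemma ln_sq_le_powr:
  fixes y c :: real
  assumes "0 < y" "y < 1" "0 < c"
  shows "(ln y)\<^sup>2 \<le> 4 / c\<^sup>2 * y powr (- c)"
proof -
  have "ln (y powr (- (c / 2))) \<le> y powr (- (c / 2))"
    using assms by (intro ln_bound) auto
  then have "c / 2 * - ln y \<le> y powr (- (c / 2))" using assms by (simp add: ln_powr)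
  then have "(c / 2 * - ln y)\<^sup>2 \<le> (y powr (- (c / 2)))\<^sup>2"
    using assms by (intro power_mono) (auto intro!: mult_nonneg_nonneg simp: mult_le_0_iff)
  also have "(y powr (- (c / 2)))\<^sup>2 = y powr (- c)"
    using assms by (simp add: power2_eq_square powr_add[symmetric])
  finally show ?thesis using assms by (simp add: field_simps)
qed

lemma integrable_beta_ln_sq:
  assumes "0 < a" "0 < b"
  shows "integrable lborel (\<lambda>y. beta_density a b y * (ln y)\<^sup>2)"
proof (rule Bochner_Integration.integrable_bound)
  \<comment> \<open>With c = a / 2 in \<open>ln_sq_le_powr\<close> the exponent a - 1 drops to a / 2
    - 1, still above -1, so the dominating function is a multiple of the density with parameters a /
    2 and b; 16 / a^2 is 4 / c^2.\<close>
  show "integrable lborel (\<lambda>y. (Beta (a / 2) b / Beta a b) * (16 / a\<^sup>2) * beta_density (a / 2) b y)"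
    using has_bochner_integral_beta_density[of "a / 2" b] assms
    by (intro integrable_mult_right) (auto simp: has_bochner_integral_iff)
  show "AE y in lborel. norm (beta_density a b y * (ln y)\<^sup>2)
      \<le> norm ((Beta (a / 2) b / Beta a b) * (16 / a\<^sup>2) * beta_density (a / 2) b y)"
  proof (intro AE_I2)
    fix y :: real
    show "norm (beta_density a b y * (ln y)\<^sup>2)
      \<le> norm ((Beta (a / 2) b / Beta a b) * (16 / a\<^sup>2) * beta_density (a / 2) b y)"
    proof (cases "0 < y \<and> y < 1")
      case True
      define k where "k = (1 - y) powr (b - 1) / Beta a b"
      have k: "0 \<le> k" using Beta_pos[OF assms] by (simp add: k_def)
      have P: "0 < Beta (a / 2) b" using Beta_pos[of "a/2" b] assms by simp
      have "y powr (a - 1) * (ln y)\<^sup>2 \<le> y powr (a - 1) * (4 / (a / 2)\<^sup>2 * y powr (- (a / 2)))"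
        using ln_sq_le_powr[of y "a / 2"] True assms by (intro mult_left_mono) auto
      also have "\<dots> = 16 / a\<^sup>2 * (y powr (a - 1) * y powr (- (a / 2)))"
        by (simp add: power2_eq_square)
      also have "y powr (a - 1) * y powr (- (a / 2)) = y powr (a / 2 - 1)"
        by (simp add: powr_add[symmetric])
      finally have "k * (y powr (a - 1) * (ln y)\<^sup>2) \<le> k * (16 / a\<^sup>2 * y powr (a / 2 - 1))"
        using k by (intro mult_left_mono)
      moreover have "0 \<le> beta_density a b y * (ln y)\<^sup>2"
        using beta_density_nonneg[OF assms] by simp
      ultimately show ?thesis
        using True P Beta_pos[OF assms]
        by (simp add: beta_density_def k_def mult_ac)
    qed (auto simp: beta_density_def)
  qed
qed measurable

lemma integrable_beta_ln:
  assumes "0 < a" "0 < b"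
  shows "integrable lborel (\<lambda>y. beta_density a b y * ln y)"
proof (rule Bochner_Integration.integrable_bound)
  show "integrable lborel (\<lambda>y. beta_density a b y * (ln y)\<^sup>2 + beta_density a b y)"
    using has_bochner_integral_beta_density[OF assms] integrable_beta_ln_sq[OF assms]
    by (auto simp: has_bochner_integral_iff)
  show "AE y in lborel. norm (beta_density a b y * ln y)
      \<le> norm (beta_density a b y * (ln y)\<^sup>2 + beta_density a b y)"
  proof (intro AE_I2)
    fix y :: real
    have "\<bar>ln y\<bar> \<le> (ln y)\<^sup>2 + 1"
      using sum_power2_ge_zero[of "\<bar>ln y\<bar> - 1/2" 0] by (auto simp: power2_eq_square algebra_simps)
    then have "beta_density a b y * \<bar>ln y\<bar> \<le> beta_density a b y * ((ln y)\<^sup>2 + 1)"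
      by (intro mult_left_mono beta_density_nonneg assms)
    then show "norm (beta_density a b y * ln y)
      \<le> norm (beta_density a b y * (ln y)\<^sup>2 + beta_density a b y)"
      using beta_density_nonneg[OF assms, of y] by (auto simp: abs_mult algebra_simps)
  qed
qed measurable

text \<open>In terms of the digamma function this is \<psi>(a) - \<psi>(a + b). Two recurrences, one
  per parameter, are all that the one-step analysis of the posterior uses.\<close>

definition beta_ln_mean :: "real \<Rightarrow> real \<Rightarrow> real" where
  "beta_ln_mean a b = (\<integral>y. beta_density a b y * ln y \<partial>lborel)"

lemma beta_ln_mean_split:
  assumes "0 < a" "0 < b"
  shows "beta_ln_mean a b = a / (a + b) * beta_ln_mean (a + 1) b + b / (a + b) * beta_ln_mean a (b + 1)"
proof -
  have "beta_ln_mean a b = (\<integral>y. a / (a + b) * (beta_density (a + 1) b y * ln y)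
      + b / (a + b) * (beta_density a (b + 1) y * ln y) \<partial>lborel)"
    unfolding beta_ln_mean_def
    by (intro Bochner_Integration.integral_cong refl, subst beta_density_split[OF assms]) (simp add: algebra_simps)
  also have "\<dots> = a / (a + b) * beta_ln_mean (a + 1) b + b / (a + b) * beta_ln_mean a (b + 1)"
    using integrable_beta_ln[of "a + 1" b] integrable_beta_ln[of a "b + 1"] assms
    unfolding beta_ln_mean_def by (subst Bochner_Integration.integral_add) auto
  finally show ?thesis .
qed

lemma tendsto_powr_ln_0:
  fixes a :: real
  assumes "0 < a"
  shows "((\<lambda>y. y powr a * ln y) \<longlongrightarrow> 0) (at_right 0)"
proof (rule Lim_null_comparison)
  show "eventually (\<lambda>y. norm (y powr a * ln y) \<le> 2 / a * y powr (a / 2)) (at_right 0)"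
    unfolding eventually_at_right_field
  proof (intro exI[of _ 1] conjI allI impI)
    fix y :: real assume y: "0 < y" "y < 1"
    have "ln (y powr (- (a / 2))) \<le> y powr (- (a / 2))"
      using y assms by (intro ln_bound) auto
    then have "\<bar>ln y\<bar> \<le> 2 / a * y powr (- (a / 2))" using assms y by (simp add: ln_powr field_simps)
    then have "y powr a * \<bar>ln y\<bar> \<le> y powr a * (2 / a * y powr (- (a / 2)))"
      by (intro mult_left_mono) auto
    also have "\<dots> = 2 / a * (y powr a * y powr (- (a / 2)))" by simp
    also have "y powr a * y powr (- (a / 2)) = y powr (a / 2)"
      by (simp add: powr_add[symmetric])
    finally show "norm (y powr a * ln y) \<le> 2 / a * y powr (a / 2)" by (simp add: abs_mult)
  qed simp
  have "((\<lambda>y. 2 / a * y powr (a / 2)) \<longlongrightarrow> 2 / a * 0 powr (a / 2)) (at_right 0)"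
    using assms by (intro tendsto_intros) (auto simp: eventually_at_right_field intro: exI[of _ 1])
  then show "((\<lambda>y. 2 / a * y powr (a / 2)) \<longlongrightarrow> 0) (at_right 0)" by simp
qed

text \<open>Integration of the derivative of \<open>y powr a * (1 - y) powr b * ln y\<close> over the unit
  interval, where that function vanishes at both ends.\<close>

lemma beta_ln_mean_diff:
  assumes "0 < a" "0 < b"
  shows "beta_ln_mean (a + 1) b - beta_ln_mean a (b + 1) = 1 / a"
proof -
  define F where "F y = y powr a * (1 - y) powr b * ln y" for y :: real
  define F' where "F' y = a * (y powr (a - 1) * (1 - y) powr b * ln y)
      - b * (y powr a * (1 - y) powr (b - 1) * ln y) + y powr (a - 1) * (1 - y) powr b" for y :: real
  have der: "(F has_vector_derivative F' y) (at y)" if "0 < y" "y < 1" for y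
  proof -
    have "(F has_real_derivative F' y) (at y)"
      unfolding F_def F'_def using that
      by (auto intro!: derivative_eq_intros simp: powr_diff field_simps)
    then show ?thesis by (simp add: has_real_derivative_iff_has_vector_derivative)
  qed
  have cont: "continuous_on {0..1} F"
    unfolding continuous_on_def
  proof
    fix x :: real assume x: "x \<in> {0..1}"
    show "(F \<longlongrightarrow> F x) (at x within {0..1})"
    proof (cases "x = 0")
      case True
      have "((\<lambda>y. (1 - y) powr b * (y powr a * ln y)) \<longlongrightarrow> (1 - 0) powr b * 0) (at_right 0)"
        using assms by (intro tendsto_intros tendsto_powr_ln_0) auto
      then have "(F \<longlongrightarrow> 0) (at_right 0)" by (simp add: F_def[abs_def] mult_ac)
      moreover have "at (0::real) within {0..1} = at_right 0" by (rule at_within_Icc_at_right) simp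
      ultimately show ?thesis using True by (simp add: F_def)
    next
      case False
      then have "continuous (at x within {0..1}) F"
        unfolding F_def using x assms
        by (intro continuous_intros) (auto simp: eventually_at_filter intro!: always_eventually)
      then show ?thesis by (simp add: continuous_within)
    qed
  qed
  have "(F' has_integral (F 1 - F 0)) {0..1}"
    using der by (intro fundamental_theorem_of_calculus_interior cont) auto
  then have "(F' has_integral 0) {0<..<1}" by (simp add: F_def has_integral_Icc_iff_Ioo)
  then have hk: "((\<lambda>y. if y \<in> {0<..<1} then F' y else 0) has_integral 0) UNIV"
    by (subst has_integral_restrict_UNIV)
  \<comment> \<open>\<open>F'\<close> in terms of beta densities: each product of powers is a
    density times its own \<open>Beta\<close> constant, so the vanishing integral becomes a relation
    between the two shifted means.\<close>
  define G where "G y = a * Beta a (b + 1) * (beta_density a (b + 1) y * ln y)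
      - b * Beta (a + 1) b * (beta_density (a + 1) b y * ln y) + Beta a (b + 1) * beta_density a (b + 1) y" for y
  have "(\<lambda>y. if y \<in> {0<..<1} then F' y else 0) = G"
    using Beta_pos[of a "b + 1"] Beta_pos[of "a + 1" b] assms
    by (auto simp: F'_def G_def beta_density_def)
  with hk have hk: "(G has_integral 0) UNIV" by simp
  have I: "has_bochner_integral lborel G (a * Beta a (b + 1) * beta_ln_mean a (b + 1)
      - b * Beta (a + 1) b * beta_ln_mean (a + 1) b + Beta a (b + 1) * 1)"
    unfolding G_def using integrable_beta_ln[of "a + 1" b] integrable_beta_ln[of a "b + 1"] assms
      has_bochner_integral_beta_density[of a "b + 1"]
    by (intro has_bochner_integral_add has_bochner_integral_diff has_bochner_integral_mult_right)
       (auto simp: has_bochner_integral_iff beta_ln_mean_def)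
  then have "integral\<^sup>L lborel G = 0"
    using has_integral_integral_lborel[of G] hk has_integral_unique
    by (auto simp: has_bochner_integral_iff)
  with I have "a * Beta a (b + 1) * beta_ln_mean a (b + 1)
      - b * Beta (a + 1) b * beta_ln_mean (a + 1) b + Beta a (b + 1) = 0"
    by (simp add: has_bochner_integral_iff)
  \<comment> \<open>Both sides are a b / (a + b) times \<open>Beta a b\<close>; with equal
    coefficients the constant can be cancelled.\<close>
  moreover have "a * Beta a (b + 1) = b * Beta (a + 1) b"
  proof -
    have "a \<notin> \<int>\<^sub>\<le>\<^sub>0" "b \<notin> \<int>\<^sub>\<le>\<^sub>0" using assms by (auto elim!: nonpos_Ints_cases)
    then have "(a + b) * Beta (a + 1) b = a * Beta a b" "(a + b) * Beta a (b + 1) = b * Beta a b"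
      by (simp_all add: Beta_plus1_left Beta_plus1_right)
    then have "(a + b) * (a * Beta a (b + 1)) = (a + b) * (b * Beta (a + 1) b)"
      by (simp add: mult.left_commute)
    then show ?thesis using assms by simp
  qed
  ultimately have "Beta a (b + 1) * (a * (beta_ln_mean (a + 1) b - beta_ln_mean a (b + 1)) - 1) = 0"
    by (simp add: algebra_simps)
  then have "a * (beta_ln_mean (a + 1) b - beta_ln_mean a (b + 1)) = 1"
    using Beta_pos[of a "b + 1"] assms by simp
  then show ?thesis using assms by (metis nonzero_eq_divide_eq mult.commute less_irrefl)
qed

text \<open>\<open>beta_ln_mean_split\<close> and \<open>beta_ln_mean_diff\<close> are two linear
  equations for the two shifted means; solving them gives both recurrences.\<close>

lemma beta_ln_mean_Suc_left:
  assumes "0 < a" "0 < b"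
  shows "beta_ln_mean (a + 1) b = beta_ln_mean a b + 1 / a - 1 / (a + b)"
proof -
  have "beta_ln_mean a b = (a / (a + b) + b / (a + b)) * beta_ln_mean (a + 1) b
      - b / (a + b) * (beta_ln_mean (a + 1) b - beta_ln_mean a (b + 1))"
    unfolding beta_ln_mean_split[OF assms] by (simp add: algebra_simps)
  also have "a / (a + b) + b / (a + b) = 1"
    using assms by (simp add: add_divide_distrib[symmetric])
  finally have "beta_ln_mean a b = beta_ln_mean (a + 1) b - b / (a + b) * (1 / a)"
    unfolding beta_ln_mean_diff[OF assms] by simp
  moreover have "b / (a + b) * (1 / a) = 1 / a - 1 / (a + b)"
    using assms by (simp add: field_simps)
  ultimately show ?thesis by simp
qed

lemma beta_ln_mean_Suc_right:
  assumes "0 < a" "0 < b"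
  shows "beta_ln_mean a (b + 1) = beta_ln_mean a b - 1 / (a + b)"
  using beta_ln_mean_Suc_left[OF assms] beta_ln_mean_diff[OF assms] by simp

text \<open>For z = exp u the right-hand side is 4 sinh(u / 2)^2, so the claim is s \<le> sinh s for
  s = u / 2 \<ge> 0, extended by the symmetry between z and 1 / z. The bound vanishes to second
  order at z = 1 and has an explicit mean when z is twice a beta variable.\<close>

lemma ln_sq_le:
  fixes z :: real
  assumes "0 < z"
  shows "(ln z)\<^sup>2 \<le> z - 2 + 1 / z"
proof -
  have *: "ln w \<le> (w - 1 / w) / 2" if "1 \<le> w" for w :: real
  proof -
    have "(\<lambda>w. (w - 1 / w) / 2 - ln w) 1 \<le> (\<lambda>w. (w - 1 / w) / 2 - ln w) w"
    proof (rule DERIV_nonneg_imp_nondecreasing[OF that])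
      fix x :: real assume "1 \<le> x" "x \<le> w"
      then have "((\<lambda>w. (w - 1 / w) / 2 - ln w) has_real_derivative (1 + 1 / x\<^sup>2) / 2 - 1 / x) (at x)"
        by (auto intro!: derivative_eq_intros simp: power2_eq_square)
      moreover have "(1 + 1 / x\<^sup>2) / 2 - 1 / x = (1 - 1 / x)\<^sup>2 / 2"
        by (simp add: power2_eq_square algebra_simps diff_divide_distrib add_divide_distrib)
      ultimately show "\<exists>y. ((\<lambda>w. (w - 1 / w) / 2 - ln w) has_real_derivative y) (at x) \<and> 0 \<le> y"
        by force
    qed
    then show ?thesis by simp
  qed
  have **: "(ln z)\<^sup>2 \<le> z - 2 + 1 / z" if "1 \<le> z" for z :: real
  proof -
    have "ln (sqrt z) \<le> (sqrt z - 1 / sqrt z) / 2" using that by (intro *) auto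
    then have "ln z \<le> sqrt z - 1 / sqrt z" using that by (simp add: ln_sqrt)
    then have "(ln z)\<^sup>2 \<le> (sqrt z - 1 / sqrt z)\<^sup>2" using that by (intro power_mono) auto
    also have "\<dots> = z - 2 + 1 / z"
      using that by (simp add: power2_eq_square field_simps)
    finally show ?thesis .
  qed
  show ?thesis
  proof (cases "1 \<le> z")
    case False
    then show ?thesis using **[of "1 / z"] assms by (simp add: ln_div)
  qed (rule **)
qed

text \<open>Four departures of 2 Y from the constant 1 for a beta variable Y: second moment and mean
  of ln (2 Y), first and second moment of 2 Y. All are of order 1 / c in
  \<open>beta_dev_bound\<close>, so one number per level can control them together.\<close>

definition beta_dev :: "real \<Rightarrow> real \<Rightarrow> real" where
  "beta_dev a b = (\<integral>y. beta_density a b y * (ln (2 * y))\<^sup>2 \<partial>lborel) + \<bar>ln 2 + beta_ln_mean a b\<bar>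
     + \<bar>2 * (a / (a + b)) - 1\<bar> + \<bar>4 * (a * (a + 1) / ((a + b) * (a + b + 1))) - 1\<bar>"

lemma integrable_beta_ln_double:
  assumes "0 < a" "0 < b"
  shows "has_bochner_integral lborel (\<lambda>y. beta_density a b y * ln (2 * y)) (ln 2 + beta_ln_mean a b)"
    and "integrable lborel (\<lambda>y. beta_density a b y * (ln (2 * y))\<^sup>2)"
proof -
  have *: "beta_density a b y * ln (2 * y) = beta_density a b y * ln 2 + beta_density a b y * ln y" for y
    by (auto simp: beta_density_def ln_mult algebra_simps add_divide_distrib[symmetric])
  have **: "beta_density a b y * (ln (2 * y))\<^sup>2
      = (ln 2)\<^sup>2 * beta_density a b y + (2 * ln 2) * (beta_density a b y * ln y) + beta_density a b y * (ln y)\<^sup>2" for y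
  proof (cases "0 < y \<and> y < 1")
    case True
    then have "ln (2 * y) = ln 2 + ln y" by (simp add: ln_mult)
    then show ?thesis by (simp add: power2_eq_square algebra_simps)
  qed (auto simp: beta_density_def)
  show "has_bochner_integral lborel (\<lambda>y. beta_density a b y * ln (2 * y)) (ln 2 + beta_ln_mean a b)"
    unfolding * using integrable_beta_ln[OF assms] has_bochner_integral_mult_left[OF has_bochner_integral_beta_density[OF assms], of "ln 2"]
    by (intro has_bochner_integral_add) (auto simp: has_bochner_integral_iff beta_ln_mean_def)
  show "integrable lborel (\<lambda>y. beta_density a b y * (ln (2 * y))\<^sup>2)"
    unfolding ** using integrable_beta_ln[OF assms] integrable_beta_ln_sq[OF assms] has_bochner_integral_beta_density[OF assms]
    by (intro Bochner_Integration.integrable_add integrable_mult_right) (auto simp: has_bochner_integral_iff)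
qed

lemma beta_dev_nonneg:
  assumes "0 < a" "0 < b"
  shows "0 \<le> beta_dev a b"
  unfolding beta_dev_def using assms
  by (intro add_nonneg_nonneg integral_nonneg_AE) (auto intro!: AE_I2 mult_nonneg_nonneg beta_density_nonneg)

text \<open>For parameters in [c, c + n], both 2 E Y - 1 = (a - b) / (a + b) and E (1 / (2 Y)) - 1 =
  (b - a + 1) / (2 (a - 1)) are O((n + 1) / c). They bound the logarithmic moments through 1 - 1 / z
  \<le> ln z \<le> z - 1 and \<open>ln_sq_le\<close>. The condition 2 \<le> c gives 2 (a - 1) \<ge>
  c.\<close>

lemma beta_dev_bound:
  assumes c: "2 \<le> c" and ab: "c \<le> a" "a \<le> c + n" "c \<le> b" "b \<le> c + n" and n: "0 \<le> n"
  shows "beta_dev a b \<le> 6 * (n + 1) / c"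
proof -
  have pos: "0 < a" "0 < b" "1 < a" using assms by auto
  have d: "\<bar>a - b\<bar> \<le> n" using ab by auto
  have inv: "has_bochner_integral lborel (\<lambda>y. beta_density a b y / y) ((a + b - 1) / (a - 1))"
    using has_bochner_integral_beta_inverse pos by blast
  have q: "\<bar>(a - b) / (a + b)\<bar> \<le> n / (2 * c)"
    using d ab c n by (auto simp: abs_divide intro!: frac_le)
  have h: "(b - a + 1) / (2 * (a - 1)) \<le> (n + 1) / c"
  proof -
    have "(b - a + 1) / (2 * (a - 1)) \<le> (n + 1) / (2 * (a - 1))"
      using d pos by (intro divide_right_mono) auto
    also have "\<dots> \<le> (n + 1) / c" using ab c n by (intro frac_le) auto
    finally show ?thesis .
  qed
  have s: "(a + b - 1) / (a - 1) / 2 = (b - a + 1) / (2 * (a - 1)) + 1"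
    using pos by (simp add: field_simps)
  have i2: "2 * (a / (a + b)) - 1 = (a - b) / (a + b)" using pos by (simp add: field_simps)
  have "(\<integral>y. beta_density a b y * (ln (2 * y))\<^sup>2 \<partial>lborel)
      \<le> (\<integral>y. 2 * (beta_density a b y * y) - 2 * beta_density a b y + 1 / 2 * (beta_density a b y / y) \<partial>lborel)"
  proof (intro integral_mono integrable_beta_ln_double pos)
    fix y :: real
    show "beta_density a b y * (ln (2 * y))\<^sup>2
        \<le> 2 * (beta_density a b y * y) - 2 * beta_density a b y + 1 / 2 * (beta_density a b y / y)"
    proof (cases "0 < y \<and> y < 1")
      case True
      then have "beta_density a b y * (ln (2 * y))\<^sup>2 \<le> beta_density a b y * (2 * y - 2 + 1 / (2 * y))"
        by (intro mult_left_mono ln_sq_le beta_density_nonneg pos) auto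
      then show ?thesis by (simp add: algebra_simps)
    qed (auto simp: beta_density_def)
  qed (use inv has_bochner_integral_beta_id[OF pos(1,2)] has_bochner_integral_beta_density[OF pos(1,2)]
        in \<open>intro Bochner_Integration.integrable_add Bochner_Integration.integrable_diff integrable_mult_right;
            simp add: has_bochner_integral_iff\<close>)
  also have "\<dots> = 2 * (a / (a + b)) - 2 * 1 + 1 / 2 * ((a + b - 1) / (a - 1))"
    using inv has_bochner_integral_beta_id[OF pos(1,2)] has_bochner_integral_beta_density[OF pos(1,2)]
    by (intro has_bochner_integral_integral_eq has_bochner_integral_add has_bochner_integral_diff has_bochner_integral_mult_right) auto
  also have "1 / 2 * ((a + b - 1) / (a - 1)) = (b - a + 1) / (2 * (a - 1)) + 1"
    using s by (simp add: mult.commute)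
  also have "2 * (a / (a + b)) - 2 * 1 + ((b - a + 1) / (2 * (a - 1)) + 1)
      = (2 * (a / (a + b)) - 1) + (b - a + 1) / (2 * (a - 1))" by simp
  also have "\<dots> = (a - b) / (a + b) + (b - a + 1) / (2 * (a - 1))" unfolding i2 ..
  also have "\<dots> \<le> n / (2 * c) + (n + 1) / c" using q h by linarith
  finally have 1: "(\<integral>y. beta_density a b y * (ln (2 * y))\<^sup>2 \<partial>lborel) \<le> n / (2 * c) + (n + 1) / c" .

  have "ln 2 + beta_ln_mean a b = (\<integral>y. beta_density a b y * ln (2 * y) \<partial>lborel)"
    using integrable_beta_ln_double(1)[OF pos(1,2)] by (simp add: has_bochner_integral_iff)
  also have "\<dots> \<le> (\<integral>y. 2 * (beta_density a b y * y) - beta_density a b y \<partial>lborel)"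
  proof (intro integral_mono)
    show "integrable lborel (\<lambda>y. beta_density a b y * ln (2 * y))"
      using integrable_beta_ln_double(1)[OF pos(1,2)] by (simp add: has_bochner_integral_iff)
    fix y :: real
    show "beta_density a b y * ln (2 * y) \<le> 2 * (beta_density a b y * y) - beta_density a b y"
    proof (cases "0 < y \<and> y < 1")
      case True
      then have "beta_density a b y * ln (2 * y) \<le> beta_density a b y * (2 * y - 1)"
        by (intro mult_left_mono ln_le_minus_one beta_density_nonneg pos) auto
      then show ?thesis by (simp add: algebra_simps)
    qed (auto simp: beta_density_def)
  qed (use has_bochner_integral_beta_id[OF pos(1,2)] has_bochner_integral_beta_density[OF pos(1,2)]
        in \<open>auto simp: has_bochner_integral_iff\<close>)
  also have "\<dots> = 2 * (a / (a + b)) - 1"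
    using has_bochner_integral_beta_id[OF pos(1,2)] has_bochner_integral_beta_density[OF pos(1,2)]
    by (intro has_bochner_integral_integral_eq has_bochner_integral_add has_bochner_integral_diff has_bochner_integral_mult_right) auto
  finally have 2: "ln 2 + beta_ln_mean a b \<le> n / (2 * c)" using i2 q by linarith

  have "1 - 1 / 2 * ((a + b - 1) / (a - 1)) = (\<integral>y. beta_density a b y - 1 / 2 * (beta_density a b y / y) \<partial>lborel)"
    using inv has_bochner_integral_beta_density[OF pos(1,2)]
    by (intro has_bochner_integral_integral_eq[symmetric] has_bochner_integral_add has_bochner_integral_diff has_bochner_integral_mult_right) auto
  also have "\<dots> \<le> (\<integral>y. beta_density a b y * ln (2 * y) \<partial>lborel)"
  proof (intro integral_mono)
    show "integrable lborel (\<lambda>y. beta_density a b y * ln (2 * y))"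
      using integrable_beta_ln_double(1)[OF pos(1,2)] by (simp add: has_bochner_integral_iff)
    fix y :: real
    show "beta_density a b y - 1 / 2 * (beta_density a b y / y) \<le> beta_density a b y * ln (2 * y)"
    proof (cases "0 < y \<and> y < 1")
      case True
      then have "ln (1 / (2 * y)) \<le> 1 / (2 * y) - 1" by (intro ln_le_minus_one) auto
      then have "1 - 1 / (2 * y) \<le> ln (2 * y)" using True by (simp add: ln_div)
      then have "beta_density a b y * (1 - 1 / (2 * y)) \<le> beta_density a b y * ln (2 * y)"
        by (intro mult_left_mono beta_density_nonneg pos)
      then show ?thesis by (simp add: algebra_simps)
    qed (auto simp: beta_density_def)
  qed (use inv has_bochner_integral_beta_density[OF pos(1,2)]
        in \<open>intro Bochner_Integration.integrable_diff integrable_mult_right; simp add: has_bochner_integral_iff\<close>)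
  also have "\<dots> = ln 2 + beta_ln_mean a b"
    using integrable_beta_ln_double(1)[OF pos(1,2)] by (simp add: has_bochner_integral_iff)
  finally have "1 - (a + b - 1) / (a - 1) / 2 \<le> ln 2 + beta_ln_mean a b" by (simp add: mult.commute)
  then have 3: "- ((n + 1) / c) \<le> ln 2 + beta_ln_mean a b" using h unfolding s by linarith

  \<comment> \<open>Once |a - b| \<le> n, both pieces of the numerator are at most linear in a + b,
    so a factor a + b of the denominator cancels.\<close>
  have "4 * (a * (a + 1) / ((a + b) * (a + b + 1))) - 1 = ((a - b) * (3 * a + b) + (3 * a - b)) / ((a + b) * (a + b + 1))"
  proof -
    define s where "s = (a + b) * (a + b + 1)"
    have "0 < s" using pos by (simp add: s_def)
    then have "4 * (a * (a + 1) / s) - 1 = (4 * (a * (a + 1)) - s) / s" by (simp add: field_simps)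
    also have "4 * (a * (a + 1)) - s = (a - b) * (3 * a + b) + (3 * a - b)" by (simp add: s_def algebra_simps)
    finally show ?thesis unfolding s_def .
  qed
  also have "\<bar>\<dots>\<bar> = \<bar>(a - b) * (3 * a + b) + (3 * a - b)\<bar> / ((a + b) * (a + b + 1))"
    using pos by (simp add: abs_divide)
  also have "\<dots> \<le> (n * (3 * (a + b)) + 3 * (a + b)) / ((a + b) * (a + b + 1))"
  proof (intro divide_right_mono)
    have "\<bar>a - b\<bar> * (3 * a + b) \<le> n * (3 * (a + b))" using d pos by (intro mult_mono) auto
    then have "\<bar>(a - b) * (3 * a + b)\<bar> \<le> n * (3 * (a + b))" using pos by (simp add: abs_mult)
    then show "\<bar>(a - b) * (3 * a + b) + (3 * a - b)\<bar> \<le> n * (3 * (a + b)) + 3 * (a + b)"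
      using pos by (intro order_trans[OF abs_triangle_ineq add_mono]) auto
  qed (use pos in auto)
  also have "\<dots> = ((3 * n + 3) * (a + b)) / ((a + b + 1) * (a + b))"
    by (simp add: algebra_simps)
  also have "\<dots> = (3 * n + 3) / (a + b + 1)"
    using pos by simp
  also have "\<dots> \<le> (3 * n + 3) / (2 * c)" using ab n c by (intro frac_le) auto
  finally have 4: "\<bar>4 * (a * (a + 1) / ((a + b) * (a + b + 1))) - 1\<bar> \<le> (3 * n + 3) / (2 * c)" .

  have 5: "\<bar>ln 2 + beta_ln_mean a b\<bar> \<le> n / (2 * c) + (n + 1) / c"
  proof -
    have "0 \<le> n / (2 * c)" "0 \<le> (n + 1) / c" using n c by auto
    with 2 3 show ?thesis by linarith
  qed
  \<comment> \<open>The four parts add up to (10 n + 7) / (2 c), which 6 (n + 1) / c rounds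
    up.\<close>
  have "beta_dev a b \<le> (n / (2 * c) + (n + 1) / c) + (n / (2 * c) + (n + 1) / c) + n / (2 * c) + (3 * n + 3) / (2 * c)"
    unfolding beta_dev_def using 1 5 q 4 i2 by (intro add_mono) auto
  also have "\<dots> = (10 * n + 7) / (2 * c)" using c by (simp add: field_simps)
  also have "\<dots> \<le> 6 * (n + 1) / c" using c n by (simp add: field_simps)
  finally show ?thesis .
qed

text \<open>An upper bound for \<^const>\<open>beta_dev\<close> valid for every posterior after \<open>n\<close> observations
  if both prior parameters are \<open>c\<close>.\<close>

definition level_dev :: "nat \<Rightarrow> real \<Rightarrow> real" where
  "level_dev n c = (\<Sum>i\<le>n. \<Sum>j\<le>n. beta_dev (c + real i) (c + real j))"

lemma level_dev_ge:
  assumes "0 < c" "i \<le> n" "j \<le> n"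
  shows "beta_dev (c + real i) (c + real j) \<le> level_dev n c"
proof -
  have nn: "0 \<le> beta_dev (c + real i) (c + real j)" for i j
    using assms by (intro beta_dev_nonneg) auto
  have "beta_dev (c + real i) (c + real j) \<le> (\<Sum>j\<le>n. beta_dev (c + real i) (c + real j))"
    using assms nn by (intro member_le_sum) auto
  also have "\<dots> \<le> level_dev n c"
    unfolding level_dev_def using assms nn
    by (intro member_le_sum[of i "{..n}" "\<lambda>i. \<Sum>j\<le>n. beta_dev (c + real i) (c + real j)"]) (auto intro!: sum_nonneg)
  finally show ?thesis .
qed

lemma level_dev_nonneg: "0 < c \<Longrightarrow> 0 \<le> level_dev n c"
  unfolding level_dev_def by (intro sum_nonneg beta_dev_nonneg) auto

lemma level_dev_bound:
  assumes "2 \<le> c"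
  shows "level_dev n c \<le> 6 * (real n + 1) ^ 3 / c"
proof -
  have "level_dev n c \<le> (\<Sum>i\<le>n. \<Sum>j\<le>n. 6 * (real n + 1) / c)"
    unfolding level_dev_def using assms by (intro sum_mono beta_dev_bound) auto
  also have "\<dots> = 6 * (real n + 1) ^ 3 / c" by (simp add: power3_eq_cube algebra_simps)
  finally show ?thesis .
qed

text \<open>Convergence of the series forces l / a_l below 1 / 2, hence a_l \<ge> 2, from some level
  on, and \<open>level_dev_bound\<close> applies there. On the finitely many earlier levels a_l may
  be small, but \<open>level_dev\<close> is a finite number for every positive parameter; this is
  why the level bound is a sum of actual deviations and not the quotient 6 (n + 1)^3 / c.\<close>

lemma summable_level_dev:
  assumes pos: "\<And>l. 0 < a l" and sm: "summable (\<lambda>l. real l / a l)"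
  shows "summable (\<lambda>l. real (Suc l) * level_dev n (a (Suc l)))"
proof (rule summable_comparison_test_ev)
  have sm': "summable (\<lambda>l. real (Suc l) / a (Suc l))"
    using sm by (subst summable_Suc_iff)
  then show "summable (\<lambda>l. 6 * (real n + 1) ^ 3 * (real (Suc l) / a (Suc l)))"
    by (intro summable_mult)
  have "eventually (\<lambda>l. real (Suc l) / a (Suc l) < 1 / 2) sequentially"
    using summable_LIMSEQ_zero[OF sm'] by (rule order_tendstoD) simp
  then show "eventually (\<lambda>l. norm (real (Suc l) * level_dev n (a (Suc l)))
      \<le> 6 * (real n + 1) ^ 3 * (real (Suc l) / a (Suc l))) sequentially"
  proof eventually_elim
    case (elim l)
    then have "2 \<le> a (Suc l)" using pos[of "Suc l"] by (simp add: divide_less_eq)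
    then have "real (Suc l) * level_dev n (a (Suc l)) \<le> real (Suc l) * (6 * (real n + 1) ^ 3 / a (Suc l))"
      by (intro mult_left_mono level_dev_bound) auto
    then show ?case using level_dev_nonneg[OF pos[of "Suc l"], of n] by (simp add: mult_ac abs_mult)
  qed
qed

section \<open>Beta-distributed random variables and second-moment tools\<close>

lemma (in prob_space)
  assumes ab: "0 < a" "0 < b" and D: "distributed M lborel Y (\<lambda>y. ennreal (beta_density a b y))"
  shows beta_distributed_flip: "distributed M lborel (\<lambda>x. 1 - Y x) (\<lambda>y. ennreal (beta_density b a y))"
    and beta_distributed_AE: "AE x in M. 0 < Y x \<and> Y x < 1"
    and beta_distributed_integrable_id: "integrable M Y"
    and beta_distributed_integrable_sq: "integrable M (\<lambda>x. (Y x)\<^sup>2)"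
    and beta_distributed_integrable_ln: "integrable M (\<lambda>x. ln (2 * Y x))"
    and beta_distributed_integrable_ln_sq: "integrable M (\<lambda>x. (ln (2 * Y x))\<^sup>2)"
    and beta_distributed_mean: "(\<integral>x. Y x \<partial>M) = a / (a + b)"
    and beta_distributed_mean_sq: "(\<integral>x. (Y x)\<^sup>2 \<partial>M) = a * (a + 1) / ((a + b) * (a + b + 1))"
    and beta_distributed_mean_ln: "(\<integral>x. ln (2 * Y x) \<partial>M) = ln 2 + beta_ln_mean a b"
    and beta_distributed_mean_ln_sq: "(\<integral>x. (ln (2 * Y x))\<^sup>2 \<partial>M) = (\<integral>y. beta_density a b y * (ln (2 * y))\<^sup>2 \<partial>lborel)"
proof -
  have "distributed M lborel (\<lambda>x. 1 - Y x) (\<lambda>x. ennreal (beta_density a b (1 - x)) / 1)"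
    using distributed_affine[OF D, of "-1" 1] by simp
  moreover have "ennreal (beta_density a b (1 - x)) / 1 = ennreal (beta_density b a x)" for x
    using divide_ennreal[of "beta_density a b (1 - x)" 1] beta_density_nonneg[OF ab(2,1)]
    by (simp add: beta_density_flip)
  ultimately show "distributed M lborel (\<lambda>x. 1 - Y x) (\<lambda>y. ennreal (beta_density b a y))"
    by simp
  have pos: "0 \<le> beta_density a b y" for y by (rule beta_density_nonneg[OF ab])
  note I = distributed_integrable[OF D _ pos] and J = distributed_integral[OF D _ pos, symmetric]
  have "AE y in density lborel (\<lambda>y. ennreal (beta_density a b y)). 0 < y \<and> y < 1"
    by (subst AE_density) (auto simp: beta_density_def intro!: AE_I2)
  then have "AE y in distr M lborel Y. 0 < y \<and> y < 1"
    by (subst distributed_distr_eq_density[OF D])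
  then show "AE x in M. 0 < Y x \<and> Y x < 1"
    using distributed_measurable[OF D] by (subst (asm) AE_distr_iff) auto
  show "integrable M Y"
    using I[of "\<lambda>y. y"] has_bochner_integral_beta_id[OF ab] by (simp add: has_bochner_integral_iff)
  show "integrable M (\<lambda>x. (Y x)\<^sup>2)"
    using I[of "\<lambda>y. y\<^sup>2"] has_bochner_integral_beta_square[OF ab] by (simp add: has_bochner_integral_iff)
  show "integrable M (\<lambda>x. ln (2 * Y x))"
    using I[of "\<lambda>y. ln (2 * y)"] integrable_beta_ln_double[OF ab] by (simp add: has_bochner_integral_iff)
  show "integrable M (\<lambda>x. (ln (2 * Y x))\<^sup>2)"
    using I[of "\<lambda>y. (ln (2 * y))\<^sup>2"] integrable_beta_ln_double[OF ab] by simp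
  show "(\<integral>x. Y x \<partial>M) = a / (a + b)"
    using J[of "\<lambda>y. y"] has_bochner_integral_beta_id[OF ab] by (simp add: has_bochner_integral_iff)
  show "(\<integral>x. (Y x)\<^sup>2 \<partial>M) = a * (a + 1) / ((a + b) * (a + b + 1))"
    using J[of "\<lambda>y. y\<^sup>2"] has_bochner_integral_beta_square[OF ab] by (simp add: has_bochner_integral_iff)
  show "(\<integral>x. ln (2 * Y x) \<partial>M) = ln 2 + beta_ln_mean a b"
    using J[of "\<lambda>y. ln (2 * y)"] integrable_beta_ln_double[OF ab] by (simp add: has_bochner_integral_iff)
  show "(\<integral>x. (ln (2 * Y x))\<^sup>2 \<partial>M) = (\<integral>y. beta_density a b y * (ln (2 * y))\<^sup>2 \<partial>lborel)"
    using J[of "\<lambda>y. (ln (2 * y))\<^sup>2"] by simp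
qed

lemma abs_le_add_sq:
  fixes t z :: real
  assumes "0 < t"
  shows "\<bar>z\<bar> \<le> t + z\<^sup>2 / t"
proof -
  have "\<bar>z\<bar> * t \<le> t * t + z\<^sup>2"
  proof -
    have "0 \<le> (\<bar>z\<bar> - t / 2)\<^sup>2 + 3 / 4 * (t * t)" by simp
    also have "\<dots> = t * t + z\<^sup>2 - \<bar>z\<bar> * t" by (simp add: power2_eq_square algebra_simps)
    finally show ?thesis by simp
  qed
  then show ?thesis using assms by (simp add: field_simps power2_eq_square)
qed

text \<open>A linear form of the Cauchy-Schwarz bound with a free parameter: t of the order of the
  square root of s would be optimal up to a constant. The uses instead fix t as a summable sequence
  for which s / t is summable as well.\<close>

lemma integral_abs_le_sq:
  fixes Z :: "'b \<Rightarrow> real"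
  assumes "prob_space M" "integrable M Z" "integrable M (\<lambda>x. (Z x)\<^sup>2)" "0 < t" "(\<integral>x. (Z x)\<^sup>2 \<partial>M) \<le> s"
  shows "(\<integral>x. \<bar>Z x\<bar> \<partial>M) \<le> t + s / t"
proof -
  interpret prob_space M by fact
  have "(\<integral>x. \<bar>Z x\<bar> \<partial>M) \<le> (\<integral>x. t + (Z x)\<^sup>2 / t \<partial>M)"
    using assms by (intro integral_mono abs_le_add_sq) auto
  also have "\<dots> = t + (\<integral>x. (Z x)\<^sup>2 \<partial>M) / t"
    using assms by (subst Bochner_Integration.integral_add) (auto simp: prob_space)
  also have "\<dots> \<le> t + s / t" using assms by (intro add_left_mono divide_right_mono) auto
  finally show ?thesis .
qed

lemma (in prob_space) integrable_if_square_integrable: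
  fixes Z :: "'a \<Rightarrow> real"
  assumes "Z \<in> borel_measurable M" "integrable M (\<lambda>x. (Z x)\<^sup>2)"
  shows "integrable M Z"
proof (rule Bochner_Integration.integrable_bound)
  show "integrable M (\<lambda>x. 1 + (Z x)\<^sup>2)" using assms by auto
  show "AE x in M. norm (Z x) \<le> norm (1 + (Z x)\<^sup>2)"
    using abs_le_add_sq[of 1] by (intro AE_I2) simp
qed fact

text \<open>Additivity of the variance for independent summands. Integrability of the square belongs
  to the claim because the induction step needs it for the partial sum.\<close>

lemma (in prob_space) indep_vars_sum_square:
  fixes Z :: "'i \<Rightarrow> 'a \<Rightarrow> real"
  assumes "finite I" "indep_vars (\<lambda>_. borel) Z I" "\<And>i. i \<in> I \<Longrightarrow> integrable M (\<lambda>x. (Z i x)\<^sup>2)"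
  shows "integrable M (\<lambda>x. (\<Sum>i\<in>I. Z i x)\<^sup>2)
    \<and> (\<integral>x. (\<Sum>i\<in>I. Z i x)\<^sup>2 \<partial>M) - (\<integral>x. (\<Sum>i\<in>I. Z i x) \<partial>M)\<^sup>2
       = (\<Sum>i\<in>I. (\<integral>x. (Z i x)\<^sup>2 \<partial>M) - (\<integral>x. Z i x \<partial>M)\<^sup>2)"
  using assms
proof (induction I rule: finite_induct)
  case (insert i I)
  let ?S = "\<lambda>x. \<Sum>i\<in>I. Z i x"
  have rv: "Z j \<in> borel_measurable M" if "j \<in> insert i I" for j
    using insert.prems that by (auto simp: indep_vars_def)
  have intZ: "integrable M (Z j)" if "j \<in> insert i I" for j
    using integrable_if_square_integrable[OF rv insert.prems(2)] that by blast
  have intS: "integrable M ?S" using intZ by (intro Bochner_Integration.integrable_sum) auto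
  have I: "indep_vars (\<lambda>_. borel) Z I" using insert.prems(1) by (rule indep_vars_subset) auto
  have IH: "integrable M (\<lambda>x. (?S x)\<^sup>2)"
    "(\<integral>x. (?S x)\<^sup>2 \<partial>M) - (\<integral>x. ?S x \<partial>M)\<^sup>2 = (\<Sum>i\<in>I. (\<integral>x. (Z i x)\<^sup>2 \<partial>M) - (\<integral>x. Z i x \<partial>M)\<^sup>2)"
    using insert.IH[OF I insert.prems(2)] by auto
  have ind: "indep_var borel (Z i) borel ?S"
    using insert by (intro indep_vars_sum) auto
  have pint: "integrable M (\<lambda>x. Z i x * ?S x)"
    using indep_var_integrable[OF ind intZ intS] by simp
  have peq: "(\<integral>x. Z i x * ?S x \<partial>M) = (\<integral>x. Z i x \<partial>M) * (\<integral>x. ?S x \<partial>M)"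
    using indep_var_lebesgue_integral[OF ind intZ intS] by simp
  have eq: "(\<Sum>i\<in>insert i I. Z i x)\<^sup>2 = (Z i x)\<^sup>2 + 2 * (Z i x * ?S x) + (?S x)\<^sup>2" for x
    using insert by (simp add: power2_sum)
  have sqi: "integrable M (\<lambda>x. (Z i x)\<^sup>2)" using insert.prems by auto
  have "integrable M (\<lambda>x. (\<Sum>i\<in>insert i I. Z i x)\<^sup>2)"
    unfolding eq using sqi IH(1) pint insert.prems by (intro Bochner_Integration.integrable_add integrable_mult_right) auto
  moreover have "(\<integral>x. (\<Sum>i\<in>insert i I. Z i x)\<^sup>2 \<partial>M)
      = (\<integral>x. (Z i x)\<^sup>2 \<partial>M) + 2 * ((\<integral>x. Z i x \<partial>M) * (\<integral>x. ?S x \<partial>M)) + (\<integral>x. (?S x)\<^sup>2 \<partial>M)"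
    unfolding eq using sqi pint IH(1) insert.prems peq by simp
  moreover have "(\<integral>x. (\<Sum>i\<in>insert i I. Z i x) \<partial>M) = (\<integral>x. Z i x \<partial>M) + (\<integral>x. ?S x \<partial>M)"
    using insert.hyps intZ intS by simp
  ultimately show ?case
    using IH(2) insert.hyps by (simp add: power2_eq_square algebra_simps)
qed simp_all

lemma AE_summable_if_summable_integral_norm:
  fixes f :: "nat \<Rightarrow> 'b \<Rightarrow> real"
  assumes "\<And>i. integrable M (f i)" "summable (\<lambda>i. \<integral>x. \<bar>f i x\<bar> \<partial>M)"
  shows "AE x in M. summable (\<lambda>i. \<bar>f i x\<bar>)"
proof -
  have [measurable]: "f i \<in> borel_measurable M" for i using assms(1) by auto
  have "(\<integral>\<^sup>+x. (\<Sum>i. ennreal \<bar>f i x\<bar>) \<partial>M) = (\<Sum>i. \<integral>\<^sup>+x. ennreal \<bar>f i x\<bar> \<partial>M)"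
    by (intro nn_integral_suminf) auto
  also have "\<dots> = (\<Sum>i. ennreal (\<integral>x. \<bar>f i x\<bar> \<partial>M))"
    using assms(1) by (intro arg_cong[where f=suminf] ext nn_integral_eq_integral) auto
  also have "\<dots> \<noteq> \<infinity>" using assms(2) by (simp add: ennreal_suminf_neq_top)
  finally have "AE x in M. (\<Sum>i. ennreal \<bar>f i x\<bar>) \<noteq> \<infinity>"
    by (intro nn_integral_PInf_AE) auto
  then show ?thesis
  proof eventually_elim
    case (elim x)
    then show ?case by (intro summable_suminf_not_top) auto
  qed
qed

subsection \<open>Densities along the tree\<close>

text \<open>Completeness of L1 for increments summable in norm. The limit is a telescoping series,
  so the whole sequence converges almost everywhere, without a further subsequence; convergence of
  the integrals over every set serves to recognise the limit as a density.\<close>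

lemma L1_limit:
  fixes g :: "nat \<Rightarrow> 'b \<Rightarrow> real"
  assumes g: "\<And>k. integrable M (g k)" and sm: "summable (\<lambda>k. \<integral>x. \<bar>g (Suc k) x - g k x\<bar> \<partial>M)"
  obtains G where "integrable M G" "AE x in M. (\<lambda>k. g k x) \<longlonglongrightarrow> G x"
    "\<And>A. A \<in> sets M \<Longrightarrow> (\<lambda>k. \<integral>x. indicator A x * g k x \<partial>M) \<longlonglongrightarrow> (\<integral>x. indicator A x * G x \<partial>M)"
proof
  define f where "f k x = g (Suc k) x - g k x" for k x
  define G where "G x = g 0 x + (\<Sum>k. f k x)" for x
  have f: "integrable M (f k)" for k unfolding f_def using g by auto
  have sm': "summable (\<lambda>k. \<integral>x. norm (f k x) \<partial>M)" using sm by (simp add: f_def)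
  have ae: "AE x in M. summable (\<lambda>k. norm (f k x))"
    using AE_summable_if_summable_integral_norm[OF f] sm' by simp
  have tele: "(\<Sum>i<k. f i x) = g k x - g 0 x" for k x
    unfolding f_def by (rule sum_lessThan_telescope)
  show "integrable M G"
    unfolding G_def by (rule Bochner_Integration.integrable_add[OF g integrable_suminf[OF f ae sm']])
  show "AE x in M. (\<lambda>k. g k x) \<longlonglongrightarrow> G x"
    using ae
  proof eventually_elim
    case (elim x)
    then have "(\<lambda>k. f k x) sums (\<Sum>k. f k x)" by (rule summable_sums[OF summable_norm_cancel])
    then have "(\<lambda>k. g 0 x + (\<Sum>i<k. f i x)) \<longlonglongrightarrow> G x"
      unfolding G_def sums_def by (rule tendsto_add[OF tendsto_const])
    then show ?case by (simp add: tele)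
  qed
  fix A assume A: "A \<in> sets M"
  have fA: "integrable M (\<lambda>x. indicator A x * f k x)" for k
    using integrable_mult_indicator[OF A f] by simp
  have gA: "integrable M (\<lambda>x. indicator A x * g k x)" for k
    using integrable_mult_indicator[OF A g] by simp
  have aeA: "AE x in M. summable (\<lambda>k. norm (indicator A x * f k x))"
    using ae by eventually_elim (auto simp: indicator_def intro: summable_mult)
  have smA: "summable (\<lambda>k. \<integral>x. norm (indicator A x * f k x) \<partial>M)"
  proof (rule summable_comparison_test'[OF sm'])
    fix k
    have "(\<integral>x. norm (indicator A x * f k x) \<partial>M) \<le> (\<integral>x. norm (f k x) \<partial>M)"
      using fA f by (intro integral_mono integrable_norm) (auto simp: indicator_def)
    then show "norm (\<integral>x. norm (indicator A x * f k x) \<partial>M) \<le> (\<integral>x. norm (f k x) \<partial>M)" by simp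
  qed
  have "(\<lambda>k. \<integral>x. indicator A x * f k x \<partial>M) sums (\<integral>x. (\<Sum>k. indicator A x * f k x) \<partial>M)"
    using fA aeA smA by (rule sums_integral)
  then have "(\<lambda>k. (\<integral>x. indicator A x * g 0 x \<partial>M) + (\<Sum>i<k. \<integral>x. indicator A x * f i x \<partial>M))
      \<longlonglongrightarrow> (\<integral>x. indicator A x * g 0 x \<partial>M) + (\<integral>x. (\<Sum>k. indicator A x * f k x) \<partial>M)"
    unfolding sums_def by (rule tendsto_add[OF tendsto_const])
  moreover have "(\<integral>x. indicator A x * g 0 x \<partial>M) + (\<Sum>i<k. \<integral>x. indicator A x * f i x \<partial>M)
      = (\<integral>x. indicator A x * g k x \<partial>M)" for k
  proof -
    have "(\<Sum>i<k. \<integral>x. indicator A x * f i x \<partial>M) = (\<integral>x. indicator A x * g k x - indicator A x * g 0 x \<partial>M)"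
      using fA by (subst Bochner_Integration.integral_sum[symmetric])
        (auto simp: sum_distrib_left[symmetric] tele right_diff_distrib)
    then show ?thesis using gA by simp
  qed
  moreover have "(\<integral>x. indicator A x * g 0 x \<partial>M) + (\<integral>x. (\<Sum>k. indicator A x * f k x) \<partial>M)
      = (\<integral>x. indicator A x * G x \<partial>M)"
  proof -
    have "integrable M (\<lambda>x. \<Sum>k. indicator A x * f k x)" using fA aeA smA by (rule integrable_suminf)
    then have "(\<integral>x. indicator A x * g 0 x \<partial>M) + (\<integral>x. (\<Sum>k. indicator A x * f k x) \<partial>M)
        = (\<integral>x. indicator A x * g 0 x + (\<Sum>k. indicator A x * f k x) \<partial>M)"
      using gA by simp
    also have "\<dots> = (\<integral>x. indicator A x * G x \<partial>M)"
      by (intro Bochner_Integration.integral_cong) (auto simp: G_def indicator_def)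
    finally show ?thesis .
  qed
  ultimately show "(\<lambda>k. \<integral>x. indicator A x * g k x \<partial>M) \<longlonglongrightarrow> (\<integral>x. indicator A x * G x \<partial>M)" by simp
qed

lemma ereal_integral_cong_AE:
  assumes "AE x in M. g x = h x"
  shows "ereal_integral M g = ereal_integral M h"
proof -
  have "(\<integral>\<^sup>+x. e2ennreal (g x) \<partial>M) = (\<integral>\<^sup>+x. e2ennreal (h x) \<partial>M)"
    using assms by (intro nn_integral_cong_AE) auto
  moreover have "(\<integral>\<^sup>+x. e2ennreal (- g x) \<partial>M) = (\<integral>\<^sup>+x. e2ennreal (- h x) \<partial>M)"
    using assms by (intro nn_integral_cong_AE) auto
  ultimately show ?thesis by (simp add: ereal_integral_def)
qed

lemma ereal_integral_ereal:
  assumes "integrable M h"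
  shows "ereal_integral M (\<lambda>x. ereal (h x)) = ereal (integral\<^sup>L M h)"
proof -
  have 1: "(\<integral>\<^sup>+x. ennreal (h x) \<partial>M) \<noteq> \<infinity>" "(\<integral>\<^sup>+x. ennreal (- h x) \<partial>M) \<noteq> \<infinity>"
    using assms by (auto simp: real_integrable_def)
  then obtain p q where pq: "(\<integral>\<^sup>+x. ennreal (h x) \<partial>M) = ennreal p" "0 \<le> p"
      "(\<integral>\<^sup>+x. ennreal (- h x) \<partial>M) = ennreal q" "0 \<le> q"
    by (metis ennreal_cases infinity_ennreal_def)
  then have "integral\<^sup>L M h = p - q"
    using real_lebesgue_integral_def[OF assms] by simp
  then show ?thesis using pq by (simp add: ereal_integral_def e2ennreal_ereal)
qed

text \<open>For a partition tree, the address of the node of level n that contains x. Testing the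
  right child suffices because the children partition their parent. A point outside \<X> gets an
  address of \<open>False\<close> only, although it lies in no node, so \<open>mem_cell\<close> and
  \<open>mem_B_iff\<close> require x in \<X>.\<close>

primrec cell :: "(bool list \<Rightarrow> 'a set) \<Rightarrow> nat \<Rightarrow> 'a \<Rightarrow> bool list" where
  "cell B 0 x = []"
| "cell B (Suc n) x = cell B n x @ [x \<in> B (cell B n x @ [True])]"

lemma length_cell [simp]: "length (cell B n x) = n"
  by (induction n) auto

lemma take_cell: "m \<le> n \<Longrightarrow> take m (cell B n x) = cell B m x"
  by (induction n) (auto simp: le_Suc_eq)

lemma finite_length_eq [simp]: "finite {\<epsilon> :: bool list. length \<epsilon> = n}"
  using finite_lists_length_eq[of "UNIV :: bool set" n] by simp

section \<open>A fixed measure on the tree: addresses, node ratios and their limits\<close>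

locale dyadic_tree =
  fixes \<X> :: "'a::euclidean_space set" and B :: "bool list \<Rightarrow> 'a set"
  assumes tree: "partition_tree \<X> B"
    and borel_\<X>: "\<X> \<in> sets borel"
    and emeasure_B: "\<And>\<epsilon>. emeasure lborel (B \<epsilon>) = ennreal ((1 / 2) ^ length \<epsilon>)"
begin

abbreviation "BX \<equiv> restrict_space borel \<X>"
abbreviation "LX \<equiv> restrict_space lborel \<X>"

lemma sets_LX: "sets LX = sets BX"
  by (rule sets_restrict_space_cong) simp

lemma space_LX: "space LX = \<X>" "space BX = \<X>"
  by (simp_all add: space_restrict_space)

lemma B_sets: "B \<epsilon> \<in> sets BX" and B_Nil: "B [] = \<X>"
  and B_Un: "B (\<epsilon> @ [False]) \<union> B (\<epsilon> @ [True]) = B \<epsilon>"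
  and B_Int: "B (\<epsilon> @ [False]) \<inter> B (\<epsilon> @ [True]) = {}"
  and B_gen: "sigma_sets \<X> (range B) = sets BX"
  using tree by (auto simp: partition_tree_def)

lemma B_subset: "B \<epsilon> \<subseteq> \<X>"
  using sets.sets_into_space[OF B_sets] by (simp add: space_LX)

lemma B_borel: "B \<epsilon> \<in> sets borel"
  using B_sets borel_\<X> by (simp add: sets_restrict_space_iff)

lemma measure_LX_B: "measure LX (B \<epsilon>) = (1 / 2) ^ length \<epsilon>"
  using emeasure_B borel_\<X> B_subset by (simp add: measure_def emeasure_restrict_space)

lemma prob_space_LX: "prob_space LX"
  using emeasure_B[of "[]"] borel_\<X>
  by (intro prob_spaceI) (simp add: emeasure_restrict_space space_LX B_Nil)

lemma B_child: "B (\<epsilon> @ [b]) \<subseteq> B \<epsilon>"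
  using B_Un[of \<epsilon>] by (cases b) auto

lemma mem_cell: "x \<in> \<X> \<Longrightarrow> x \<in> B (cell B n x)"
proof (induction n)
  case (Suc n)
  then show ?case using B_Un[of "cell B n x"] by (cases "x \<in> B (cell B n x @ [True])") auto
qed (simp add: B_Nil)

lemma mem_B_imp_cell: "x \<in> B \<epsilon> \<Longrightarrow> cell B (length \<epsilon>) x = \<epsilon>"
proof (induction \<epsilon> rule: rev_induct)
  case (snoc b \<epsilon>)
  then have "cell B (length \<epsilon>) x = \<epsilon>" using B_child by blast
  then show ?case using snoc.prems B_Int[of \<epsilon>] by (cases b) auto
qed simp

lemma mem_B_iff: "x \<in> \<X> \<Longrightarrow> x \<in> B \<epsilon> \<longleftrightarrow> cell B (length \<epsilon>) x = \<epsilon>"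
  using mem_cell mem_B_imp_cell by metis

lemma cell_sum:
  fixes \<phi> :: "bool list \<Rightarrow> real"
  assumes "x \<in> \<X>"
  shows "\<phi> (cell B n x) = (\<Sum>\<epsilon> | length \<epsilon> = n. \<phi> \<epsilon> * indicator (B \<epsilon>) x)"
proof -
  have "(\<Sum>\<epsilon> | length \<epsilon> = n. \<phi> \<epsilon> * indicator (B \<epsilon>) x)
      = (\<Sum>\<epsilon> | length \<epsilon> = n. if cell B n x = \<epsilon> then \<phi> \<epsilon> else 0)"
    using assms by (intro sum.cong) (auto simp: indicator_def mem_B_iff)
  then show ?thesis by simp
qed

text \<open>A function of the address at level n is a finite combination of node indicators. This is
  the passage between integrals and sums over one level, used for \<lambda>, for Q and for P_X
  alike.\<close>

lemma has_bochner_integral_cell: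
  fixes \<phi> :: "bool list \<Rightarrow> real"
  assumes "finite_measure \<mu>" and s: "sets \<mu> = sets BX"
  shows "has_bochner_integral \<mu> (\<lambda>x. \<phi> (cell B n x)) (\<Sum>\<epsilon> | length \<epsilon> = n. \<phi> \<epsilon> * measure \<mu> (B \<epsilon>))"
proof -
  interpret finite_measure \<mu> by fact
  have sp: "space \<mu> = \<X>" using sets_eq_imp_space_eq[OF s] by (simp add: space_LX)
  have "has_bochner_integral \<mu> (\<lambda>x. \<Sum>\<epsilon> | length \<epsilon> = n. \<phi> \<epsilon> * indicator (B \<epsilon>) x)
      (\<Sum>\<epsilon> | length \<epsilon> = n. \<phi> \<epsilon> * measure \<mu> (B \<epsilon>))"
    using B_sets s
    by (intro has_bochner_integral_sum has_bochner_integral_mult_right has_bochner_integral_real_indicator)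
       (auto simp: less_top[symmetric])
  then show ?thesis
    by (subst has_bochner_integral_cong[OF refl _ refl, where g="\<lambda>x. \<Sum>\<epsilon> | length \<epsilon> = n. \<phi> \<epsilon> * indicator (B \<epsilon>) x"])
       (simp_all only: sp cell_sum)
qed

lemma integral_cell:
  fixes \<phi> :: "bool list \<Rightarrow> real"
  assumes "finite_measure \<mu>" "sets \<mu> = sets BX"
  shows "integrable \<mu> (\<lambda>x. \<phi> (cell B n x))"
    and "(\<integral>x. \<phi> (cell B n x) \<partial>\<mu>) = (\<Sum>\<epsilon> | length \<epsilon> = n. \<phi> \<epsilon> * measure \<mu> (B \<epsilon>))"
  using has_bochner_integral_cell[OF assms, of \<phi> n] by (simp_all add: has_bochner_integral_iff)

lemma measure_B_split:
  assumes "finite_measure \<mu>" "sets \<mu> = sets BX"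
  shows "measure \<mu> (B \<epsilon>) = measure \<mu> (B (\<epsilon> @ [False])) + measure \<mu> (B (\<epsilon> @ [True]))"
proof -
  interpret finite_measure \<mu> by fact
  show ?thesis
    using finite_measure_Union[of "B (\<epsilon> @ [False])" "B (\<epsilon> @ [True])"] B_sets B_Int B_Un assms(2) by simp
qed

text \<open>Of two nodes that meet, the shorter address is a prefix of the longer one, so one node
  contains the other. The empty set is added to account for disjoint nodes.\<close>

lemma Int_stable_B: "Int_stable (insert {} (range B))"
proof (rule Int_stableI)
  have *: "B \<epsilon> \<inter> B \<eta> \<in> {{}, B \<eta>}" if "length \<epsilon> \<le> length \<eta>" for \<epsilon> \<eta>
  proof (cases "B \<epsilon> \<inter> B \<eta> = {}")
    case False
    then obtain x where x: "x \<in> B \<epsilon>" "x \<in> B \<eta>" by blast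
    then have "take (length \<epsilon>) \<eta> = \<epsilon>"
      using that take_cell[OF that, of B x] by (simp add: mem_B_imp_cell)
    have "B \<eta> \<subseteq> B \<epsilon>"
    proof
      fix y assume y: "y \<in> B \<eta>"
      then have "cell B (length \<epsilon>) y = \<epsilon>"
        using take_cell[OF that, of B y] \<open>take (length \<epsilon>) \<eta> = \<epsilon>\<close> by (simp add: mem_B_imp_cell)
      then show "y \<in> B \<epsilon>" using y B_subset[of \<eta>] by (subst mem_B_iff) auto
    qed
    then show ?thesis by auto
  qed auto
  fix U V assume "U \<in> insert {} (range B)" "V \<in> insert {} (range B)"
  then consider "U = {} \<or> V = {}" | \<epsilon> \<eta> where "U = B \<epsilon>" "V = B \<eta>" by auto
  then show "U \<inter> V \<in> insert {} (range B)"
  proof cases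
    case 2
    show ?thesis
      using *[of \<epsilon> \<eta>] *[of \<eta> \<epsilon>] linear[of "length \<epsilon>" "length \<eta>"] unfolding 2 by (auto simp: Int_commute)
  qed auto
qed

lemma measure_eqI_B:
  assumes "finite_measure \<mu>" "finite_measure \<nu>" "sets \<mu> = sets BX" "sets \<nu> = sets BX"
    and "\<And>\<epsilon>. measure \<mu> (B \<epsilon>) = measure \<nu> (B \<epsilon>)"
  shows "\<mu> = \<nu>"
proof (rule measure_eqI_generator_eq[where E="insert {} (range B)" and \<Omega>=\<X> and A="\<lambda>_. \<X>"])
  interpret m: finite_measure \<mu> by fact
  interpret n: finite_measure \<nu> by fact
  have "sigma_sets \<X> (insert {} (range B)) = sigma_sets \<X> (range B)"
    by (intro sigma_sets_eqI) (auto intro: sigma_sets.Empty)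
  then show "sets \<mu> = sigma_sets \<X> (insert {} (range B))" "sets \<nu> = sigma_sets \<X> (insert {} (range B))"
    using assms B_gen by auto
  show "emeasure \<mu> U = emeasure \<nu> U" if "U \<in> insert {} (range B)" for U
    using that assms(5) by (auto simp: m.emeasure_eq_measure n.emeasure_eq_measure)
  show "emeasure \<mu> \<X> \<noteq> \<infinity>" by simp
  show "range (\<lambda>_. \<X>) \<subseteq> insert {} (range B)" using B_Nil by auto
qed (use Int_stable_B B_subset in auto)

text \<open>This is Q(B \<epsilon>) / \<lambda>(B \<epsilon>), the value on the node of the density
  of Q restricted to the sets of its level.\<close>

definition ratio :: "'a measure \<Rightarrow> bool list \<Rightarrow> real" where
  "ratio Q \<epsilon> = 2 ^ length \<epsilon> * measure Q (B \<epsilon>)"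

text \<open>The integral of a level ratio over a node is the Q-mass of the node as soon as the level
  is at least the length of the node. So the measure whose density is the L1 limit agrees with Q on
  all nodes, hence everywhere; absolute continuity of Q comes out of the argument.\<close>

lemma random_density_limit:
  assumes Q: "prob_space Q" "sets Q = sets BX"
    and n: "mono n" "filterlim n at_top sequentially"
    and sm: "summable (\<lambda>k. \<Sum>\<epsilon> | length \<epsilon> = n (Suc k). \<bar>ratio Q \<epsilon> - ratio Q (take (n k) \<epsilon>)\<bar> * (1 / 2) ^ length \<epsilon>)"
  shows "AE x in LX. (\<lambda>k. ratio Q (cell B (n k) x)) \<longlonglongrightarrow> random_density \<X> Q x"
proof -
  interpret Q: prob_space Q by fact
  interpret L: prob_space LX by (rule prob_space_LX)
  have fm: "finite_measure LX" "finite_measure Q" by unfold_locales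
  define g where "g k x = ratio Q (cell B (n k) x)" for k x
  have gi: "integrable LX (g k)" for k
    unfolding g_def by (rule integral_cell[OF fm(1) sets_LX])
  have le: "n k \<le> n (Suc k)" for k using n(1) by (auto simp: mono_def)
  have "(\<integral>x. \<bar>g (Suc k) x - g k x\<bar> \<partial>LX)
      = (\<Sum>\<epsilon> | length \<epsilon> = n (Suc k). \<bar>ratio Q \<epsilon> - ratio Q (take (n k) \<epsilon>)\<bar> * (1 / 2) ^ length \<epsilon>)" for k
    using integral_cell(2)[OF fm(1) sets_LX, of "\<lambda>\<epsilon>. \<bar>ratio Q \<epsilon> - ratio Q (take (n k) \<epsilon>)\<bar>" "n (Suc k)"]
    by (simp add: g_def take_cell[OF le] measure_LX_B)
  with sm have "summable (\<lambda>k. \<integral>x. \<bar>g (Suc k) x - g k x\<bar> \<partial>LX)" by simp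
  from L1_limit[OF gi this] obtain G where G: "integrable LX G"
    "AE x in LX. (\<lambda>k. g k x) \<longlonglongrightarrow> G x"
    "\<And>A. A \<in> sets LX \<Longrightarrow> (\<lambda>k. \<integral>x. indicator A x * g k x \<partial>LX) \<longlonglongrightarrow> (\<integral>x. indicator A x * G x \<partial>LX)"
    by blast
  have [measurable]: "G \<in> borel_measurable LX" using G(1) by auto
  have gpos: "0 \<le> g k x" for k x by (simp add: g_def ratio_def)
  have Gpos: "AE x in LX. 0 \<le> G x"
    using G(2) by eventually_elim (auto intro: LIMSEQ_le_const gpos)
  have dens: "finite_measure (density LX (\<lambda>x. ennreal (G x)))"
  proof (rule finite_measureI)
    have "emeasure (density LX (\<lambda>x. ennreal (G x))) (space LX) = (\<integral>\<^sup>+x. ennreal (G x) \<partial>LX)"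
      by (subst emeasure_density) (auto intro!: nn_integral_cong simp: indicator_def)
    then show "emeasure (density LX (\<lambda>x. ennreal (G x))) (space (density LX (\<lambda>x. ennreal (G x)))) \<noteq> \<infinity>"
      using G(1) by (simp add: real_integrable_def)
  qed
  have "density LX (\<lambda>x. ennreal (G x)) = Q"
  proof (rule measure_eqI_B[OF dens fm(2)])
    fix \<epsilon>
    have Bs: "B \<epsilon> \<in> sets LX" using B_sets sets_LX by simp
    have "measure (density LX (\<lambda>x. ennreal (G x))) (B \<epsilon>) = (\<integral>x. indicator (B \<epsilon>) x * G x \<partial>LX)"
    proof -
      have "(\<integral>\<^sup>+x. ennreal (G x) * indicator (B \<epsilon>) x \<partial>LX) = (\<integral>\<^sup>+x. ennreal (indicator (B \<epsilon>) x * G x) \<partial>LX)"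
        by (intro nn_integral_cong) (auto simp: indicator_def)
      also have "\<dots> = ennreal (\<integral>x. indicator (B \<epsilon>) x * G x \<partial>LX)"
        using Gpos integrable_mult_indicator[OF Bs G(1)]
        by (intro nn_integral_eq_integral) (auto elim!: eventually_mono)
      finally have "emeasure (density LX (\<lambda>x. ennreal (G x))) (B \<epsilon>) = ennreal (\<integral>x. indicator (B \<epsilon>) x * G x \<partial>LX)"
        using Bs by (simp add: emeasure_density)
      moreover have "0 \<le> (\<integral>x. indicator (B \<epsilon>) x * G x \<partial>LX)"
        using Gpos by (intro integral_nonneg_AE) (auto elim!: eventually_mono)
      ultimately show ?thesis by (simp add: measure_def)
    qed
    moreover have "(\<lambda>k. \<integral>x. indicator (B \<epsilon>) x * g k x \<partial>LX) \<longlonglongrightarrow> measure Q (B \<epsilon>)"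
    proof (rule tendsto_eventually)
      have "eventually (\<lambda>k. length \<epsilon> \<le> n k) sequentially" using n(2) by (simp add: filterlim_at_top)
      then show "eventually (\<lambda>k. (\<integral>x. indicator (B \<epsilon>) x * g k x \<partial>LX) = measure Q (B \<epsilon>)) sequentially"
      proof eventually_elim
        case (elim k)
        \<comment> \<open>\<open>\<phi>\<close> reads membership in \<open>B \<epsilon>\<close> off
          a longer address.\<close>
        define \<phi> :: "bool list \<Rightarrow> real" where "\<phi> \<eta> = of_bool (take (length \<epsilon>) \<eta> = \<epsilon>)" for \<eta>
        have ind: "indicator (B \<epsilon>) x = \<phi> (cell B (n k) x)" if "x \<in> \<X>" for x
          using that elim by (simp add: \<phi>_def take_cell mem_B_iff indicator_def)
        have spQ: "space Q = \<X>" using sets_eq_imp_space_eq[OF Q(2)] by (simp add: space_LX)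
        have "(\<integral>x. indicator (B \<epsilon>) x * g k x \<partial>LX) = (\<integral>x. (\<lambda>\<eta>. \<phi> \<eta> * ratio Q \<eta>) (cell B (n k) x) \<partial>LX)"
          by (intro Bochner_Integration.integral_cong) (auto simp: space_LX ind g_def)
        also have "\<dots> = (\<Sum>\<eta> | length \<eta> = n k. \<phi> \<eta> * measure Q (B \<eta>))"
          by (subst integral_cell(2)[OF fm(1) sets_LX, of "\<lambda>\<eta>. \<phi> \<eta> * ratio Q \<eta>"])
             (auto intro!: sum.cong simp: measure_LX_B ratio_def power_one_over)
        also have "\<dots> = (\<integral>x. \<phi> (cell B (n k) x) \<partial>Q)"
          using integral_cell(2)[OF fm(2) Q(2)] by simp
        also have "\<dots> = (\<integral>x. indicator (B \<epsilon>) x \<partial>Q)"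
          by (intro Bochner_Integration.integral_cong) (auto simp: spQ ind)
        also have "\<dots> = measure Q (B \<epsilon>)" using B_sets Q(2) by simp
        finally show ?case .
      qed
    qed
    ultimately show "measure (density LX (\<lambda>x. ennreal (G x))) (B \<epsilon>) = measure Q (B \<epsilon>)"
      using G(3)[OF Bs] LIMSEQ_unique by metis
  qed (simp_all add: sets_LX Q)
  then have "AE x in LX. ennreal (G x) = RN_deriv LX Q x"
    by (intro L.RN_deriv_unique) auto
  with G(2) Gpos show ?thesis
    by eventually_elim (simp add: random_density_def g_def, metis enn2real_ennreal)
qed

lemma density_measure:
  assumes "prob_density_on \<X> f"
  shows "prob_space (density_measure \<X> f)" "sets (density_measure \<X> f) = sets BX"
proof -
  have [measurable]: "f \<in> borel_measurable LX" using assms by (simp add: prob_density_on_def)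
  have "emeasure (density LX (\<lambda>x. ennreal (f x))) (space LX) = (\<integral>\<^sup>+x. ennreal (f x) \<partial>LX)"
    by (subst emeasure_density) (auto intro!: nn_integral_cong simp: indicator_def)
  then show "prob_space (density_measure \<X> f)"
    using assms by (intro prob_spaceI) (simp add: density_measure_def prob_density_on_def)
  show "sets (density_measure \<X> f) = sets BX" by (simp add: density_measure_def sets_LX)
qed

text \<open>The ratios converge \<lambda>-almost everywhere and their logarithms P_X-almost
  everywhere, P_X having density f. Where f is nonzero the limits must match, so the random density
  is the exponential of a finite t there; it is positive, and the integrand of \<open>kl_div\<close>
  is finite almost everywhere.\<close>

lemma log_density_limit:
  assumes f: "prob_density_on \<X> f"
    and Q: "prob_space Q" "sets Q = sets BX" "\<And>\<epsilon>. 0 < measure Q (B \<epsilon>)"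
    and n: "mono n" "filterlim n at_top sequentially"
    and sm: "summable (\<lambda>k. \<Sum>\<epsilon> | length \<epsilon> = n (Suc k). \<bar>ratio Q \<epsilon> - ratio Q (take (n k) \<epsilon>)\<bar> * (1 / 2) ^ length \<epsilon>)"
    and sm_ln: "summable (\<lambda>k. \<Sum>\<epsilon> | length \<epsilon> = n (Suc k).
        \<bar>ln (ratio Q \<epsilon>) - ln (ratio Q (take (n k) \<epsilon>))\<bar> * measure (density_measure \<X> f) (B \<epsilon>))"
  obtains t where "integrable LX (\<lambda>x. f x * t x)"
    "(\<lambda>k. \<Sum>\<epsilon> | length \<epsilon> = n k. ln (ratio Q \<epsilon>) * measure (density_measure \<X> f) (B \<epsilon>))
       \<longlonglongrightarrow> (\<integral>x. f x * t x \<partial>LX)"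
    "AE x in LX. f x \<noteq> 0 \<longrightarrow> random_density \<X> Q x = exp (t x)"
proof -
  define P where "P = density_measure \<X> f"
  have Pd: "P = density LX (\<lambda>x. ennreal (f x))" by (simp add: P_def density_measure_def)
  interpret P: prob_space P unfolding P_def by (rule density_measure[OF f])
  have fm: "finite_measure P" by unfold_locales
  have sP: "sets P = sets BX" unfolding P_def by (rule density_measure[OF f])
  have spP: "space P = \<X>" using sets_eq_imp_space_eq[OF sP] by (simp add: space_LX)
  have [measurable]: "f \<in> borel_measurable LX" using f by (simp add: prob_density_on_def)
  have f0: "AE x in LX. 0 \<le> f x" using f by (intro AE_I2) (simp add: prob_density_on_def space_LX)
  define g where "g k x = ln (ratio Q (cell B (n k) x))" for k x
  have gi: "integrable P (g k)" for k
    unfolding g_def using integral_cell(1)[OF fm sP, of "\<lambda>\<epsilon>. ln (ratio Q \<epsilon>)"] .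
  have le: "n k \<le> n (Suc k)" for k using n(1) by (auto simp: mono_def)
  have "(\<integral>x. \<bar>g (Suc k) x - g k x\<bar> \<partial>P)
      = (\<Sum>\<epsilon> | length \<epsilon> = n (Suc k). \<bar>ln (ratio Q \<epsilon>) - ln (ratio Q (take (n k) \<epsilon>))\<bar> * measure P (B \<epsilon>))" for k
    using integral_cell(2)[OF fm sP, of "\<lambda>\<epsilon>. \<bar>ln (ratio Q \<epsilon>) - ln (ratio Q (take (n k) \<epsilon>))\<bar>" "n (Suc k)"]
    by (simp add: g_def take_cell[OF le])
  with sm_ln have "summable (\<lambda>k. \<integral>x. \<bar>g (Suc k) x - g k x\<bar> \<partial>P)" by (simp add: P_def)
  from L1_limit[OF gi this] obtain t where t: "integrable P t" "AE x in P. (\<lambda>k. g k x) \<longlonglongrightarrow> t x"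
    "\<And>A. A \<in> sets P \<Longrightarrow> (\<lambda>k. \<integral>x. indicator A x * g k x \<partial>P) \<longlonglongrightarrow> (\<integral>x. indicator A x * t x \<partial>P)"
    by blast
  have [measurable]: "t \<in> borel_measurable LX" using t(1) by (auto simp: Pd dest!: borel_measurable_integrable)
  have "integrable LX (\<lambda>x. f x * t x)" using t(1) f0 by (simp add: Pd integrable_real_density)
  moreover have "(\<lambda>k. \<Sum>\<epsilon> | length \<epsilon> = n k. ln (ratio Q \<epsilon>) * measure P (B \<epsilon>)) \<longlonglongrightarrow> (\<integral>x. f x * t x \<partial>LX)"
  proof -
    have "(\<integral>x. indicator (space P) x * h x \<partial>P) = (\<integral>x. h x \<partial>P)" for h :: "'a \<Rightarrow> real"
      by (intro Bochner_Integration.integral_cong) auto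
    then have "(\<lambda>k. \<integral>x. g k x \<partial>P) \<longlonglongrightarrow> (\<integral>x. t x \<partial>P)" using t(3)[of "space P"] by simp
    moreover have "(\<integral>x. g k x \<partial>P) = (\<Sum>\<epsilon> | length \<epsilon> = n k. ln (ratio Q \<epsilon>) * measure P (B \<epsilon>))" for k
      unfolding g_def using integral_cell(2)[OF fm sP, of "\<lambda>\<epsilon>. ln (ratio Q \<epsilon>)"] .
    moreover have "(\<integral>x. t x \<partial>P) = (\<integral>x. f x * t x \<partial>LX)" using f0 by (simp add: Pd integral_real_density)
    ultimately show ?thesis by simp
  qed
  moreover have "AE x in LX. f x \<noteq> 0 \<longrightarrow> random_density \<X> Q x = exp (t x)"
  proof -
    have "AE x in LX. 0 < ennreal (f x) \<longrightarrow> (\<lambda>k. g k x) \<longlonglongrightarrow> t x"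
      using t(2) unfolding Pd by (subst (asm) AE_density) auto
    with f0 random_density_limit[OF Q(1,2) n sm] show ?thesis
    proof eventually_elim
      case (elim x)
      have "ratio Q (cell B (n k) x) = exp (g k x)" for k
        using Q(3) by (simp add: g_def ratio_def)
      with elim have "(\<lambda>k. exp (g k x)) \<longlonglongrightarrow> random_density \<X> Q x" by simp
      moreover have "(\<lambda>k. exp (g k x)) \<longlonglongrightarrow> exp (t x)" if "f x \<noteq> 0"
        using elim that by (intro tendsto_exp) (simp add: less_le)
      ultimately show ?case by (auto intro: LIMSEQ_unique)
    qed
  qed
  ultimately show ?thesis using that unfolding P_def by blast
qed

lemma kl_div_eq:
  assumes f: "prob_density_on \<X> f" and t: "AE x in LX. f x \<noteq> 0 \<longrightarrow> \<theta> x = exp (t x)"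
  shows "kl_div \<X> f \<theta> = ereal_integral LX (\<lambda>x. ereal (f x * ln (f x) - f x * t x))"
  unfolding kl_div_def
proof (rule ereal_integral_cong_AE)
  have "AE x in LX. 0 \<le> f x" using f by (intro AE_I2) (simp add: prob_density_on_def space_LX)
  with t show "AE x in LX. (if f x = 0 then 0 else if \<theta> x = 0 then \<infinity> else ereal (f x * ln (f x / \<theta> x)))
      = ereal (f x * ln (f x) - f x * t x)"
    by eventually_elim (auto simp: ln_div algebra_simps)
qed

text \<open>Since y ln y \<ge> -1 and \<lambda>(\<X>) = 1, the negative part of f ln f - f t is
  dominated by 1 + |f t|. The finite divergence controls the positive part, and adding f t back
  leaves f ln f.\<close>

lemma kl_div_finite_imp_integrable:
  assumes f: "prob_density_on \<X> f" and t: "AE x in LX. f x \<noteq> 0 \<longrightarrow> \<theta> x = exp (t x)"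
    and ft: "integrable LX (\<lambda>x. f x * t x)" and fin: "kl_div \<X> f \<theta> \<le> ereal \<delta>"
  shows "integrable LX (\<lambda>x. f x * ln (f x))"
proof -
  interpret L: prob_space LX by (rule prob_space_LX)
  have [measurable]: "f \<in> borel_measurable LX" using f by (simp add: prob_density_on_def)
  have [measurable]: "(\<lambda>x. f x * t x) \<in> borel_measurable LX" using ft by auto
  define h where "h x = f x * ln (f x) - f x * t x" for x
  have hm[measurable]: "h \<in> borel_measurable LX" unfolding h_def by measurable
  have "enn2ereal (\<integral>\<^sup>+x. ennreal (h x) \<partial>LX) - enn2ereal (\<integral>\<^sup>+x. ennreal (- h x) \<partial>LX) \<le> ereal \<delta>"
    using fin unfolding kl_div_eq[OF f t] ereal_integral_def by (simp add: h_def)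
  \<comment> \<open>In \<open>ereal\<close> the value of \<infinity> - \<infinity> is \<infinity>,
    so a difference bounded by a real excludes an infinite positive part before anything is known of
    the negative part.\<close>
  then have 1: "(\<integral>\<^sup>+x. ennreal (h x) \<partial>LX) \<noteq> \<infinity>" by (auto simp: minus_ereal_def)
  have "(\<integral>\<^sup>+x. ennreal (- h x) \<partial>LX) \<le> (\<integral>\<^sup>+x. ennreal (1 + \<bar>f x * t x\<bar>) \<partial>LX)"
  proof (intro nn_integral_mono ennreal_leI)
    fix x assume x: "x \<in> space LX"
    have "- 1 \<le> f x * ln (f x)"
    proof (cases "f x = 0")
      case False
      then have pos: "0 < f x" using f x by (auto simp: prob_density_on_def space_LX less_le)
      have "ln (1 / f x) \<le> 1 / f x - 1" using pos by (intro ln_le_minus_one) auto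
      then have "f x * (1 - 1 / f x) \<le> f x * ln (f x)" using pos by (intro mult_left_mono) (auto simp: ln_div)
      then show ?thesis using pos by (simp add: right_diff_distrib)
    qed simp
    then show "- h x \<le> 1 + \<bar>f x * t x\<bar>" by (simp add: h_def)
  qed
  also have "\<dots> < \<infinity>"
    using ft by (subst nn_integral_eq_integral) auto
  finally have "integrable LX h" using 1 hm by (simp add: real_integrable_def less_top[symmetric])
  then have "integrable LX (\<lambda>x. h x + f x * t x)" using ft by (rule Bochner_Integration.integrable_add)
  then show ?thesis by (simp add: h_def)
qed

text \<open>Cut f at K = exp (l / 4). The part below contributes at most K 2^(-l), exponentially
  small because exp (1 / 4) < 2; above the cut ln f > l / 4, so f is at most 4 / l times f ln
  f.\<close>

lemma measure_B_le:
  assumes f: "prob_density_on \<X> f" and int: "integrable LX (\<lambda>x. f x * ln (f x))"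
  obtains C where "0 \<le> C" "\<And>\<epsilon>. measure (density_measure \<X> f) (B \<epsilon>) \<le> C / real (Suc (length \<epsilon>))"
proof
  interpret L: prob_space LX by (rule prob_space_LX)
  interpret P: prob_space "density_measure \<X> f" by (rule density_measure[OF f])
  have [measurable]: "f \<in> borel_measurable LX" using f by (simp add: prob_density_on_def)
  define J where "J = (\<integral>x. \<bar>f x * ln (f x)\<bar> \<partial>LX)"
  have J: "0 \<le> J" by (simp add: J_def)
  have fi: "integrable LX f"
    using f by (intro integrableI_nonneg) (auto simp: prob_density_on_def space_LX intro!: AE_I2)
  \<comment> \<open>The 4 bounds (l + 1) K 2^(-l), using 2^(-l) \<le> exp (- l / 2); the 8 comes
    from 4 / l \<le> 8 / (l + 1) for l \<ge> 1. For l = 0 a probability is below 4 + 8 J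
    anyway.\<close>
  show "0 \<le> 4 + 8 * J" using J by simp
  fix \<epsilon> :: "bool list"
  define l where "l = length \<epsilon>"
  define K where "K = exp (real l / 4)"
  have Bs[measurable]: "B \<epsilon> \<in> sets LX" using B_sets sets_LX by simp
  have Bi: "integrable LX (indicat_real (B \<epsilon>))"
    using Bs by (intro integrable_real_indicator) (auto simp: less_top[symmetric])
  have "emeasure (density_measure \<X> f) (B \<epsilon>) = (\<integral>\<^sup>+x. ennreal (indicator (B \<epsilon>) x * f x) \<partial>LX)"
    unfolding density_measure_def using Bs
    by (subst emeasure_density) (auto intro!: nn_integral_cong simp: indicator_def)
  also have "\<dots> = ennreal (\<integral>x. indicator (B \<epsilon>) x * f x \<partial>LX)"
    using integrable_mult_indicator[OF Bs fi] f
    by (intro nn_integral_eq_integral) (auto simp: prob_density_on_def space_LX intro!: AE_I2)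
  finally have P: "measure (density_measure \<X> f) (B \<epsilon>) = (\<integral>x. indicator (B \<epsilon>) x * f x \<partial>LX)"
    using f by (auto simp: measure_def prob_density_on_def space_LX intro!: enn2real_ennreal integral_nonneg_AE AE_I2)
  show "measure (density_measure \<X> f) (B \<epsilon>) \<le> (4 + 8 * J) / real (Suc (length \<epsilon>))"
  proof (cases "l = 0")
    case True
    then show ?thesis using order_trans[OF P.prob_le_1[of "B \<epsilon>"], of "4 + 8 * J"] J by (simp add: l_def)
  next
    case False
    have "(\<integral>x. indicator (B \<epsilon>) x * f x \<partial>LX)
        \<le> (\<integral>x. K * indicator (B \<epsilon>) x + 4 / real l * \<bar>f x * ln (f x)\<bar> \<partial>LX)"
    proof (rule integral_mono)
      show "integrable LX (\<lambda>x. indicator (B \<epsilon>) x * f x)" using integrable_mult_indicator[OF Bs fi] by simp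
      show "integrable LX (\<lambda>x. K * indicator (B \<epsilon>) x + 4 / real l * \<bar>f x * ln (f x)\<bar>)"
        using Bi int by auto
      fix x assume x: "x \<in> space LX"
      then have f0: "0 \<le> f x" using f by (simp add: prob_density_on_def space_LX)
      have K0: "0 < K" by (simp add: K_def)
      show "indicator (B \<epsilon>) x * f x \<le> K * indicator (B \<epsilon>) x + 4 / real l * \<bar>f x * ln (f x)\<bar>"
      proof (cases "f x \<le> K")
        case True
        then show ?thesis by (auto simp: indicator_def intro!: add_increasing2)
      next
        case fK: False
        then have "ln K \<le> ln (f x)" using K0 by (intro ln_mono) auto
        then have "1 \<le> 4 / real l * ln (f x)" using False by (simp add: K_def field_simps)
        then have "f x * 1 \<le> f x * (4 / real l * ln (f x))" using f0 by (intro mult_left_mono)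
        also have "\<dots> \<le> 4 / real l * \<bar>f x * ln (f x)\<bar>"
          using f0 by (simp add: abs_mult mult.left_commute divide_right_mono mult_left_mono)
        finally show ?thesis using K0 f0 by (auto simp: indicator_def)
      qed
    qed
    also have "\<dots> = K * (1 / 2) ^ l + 4 / real l * J"
      using Bi Bs int measure_LX_B[of \<epsilon>] unfolding J_def l_def
      by (subst Bochner_Integration.integral_add) auto
    also have "K * (1 / 2) ^ l \<le> 4 / real (Suc l)"
    proof -
      have "K * (1 / 2) ^ l \<le> K * exp (- real l / 2)"
      proof -
        have "(1 / 2 :: real) \<le> exp (- 1 / 2)" using exp_ge_add_one_self[of "- 1 / 2 :: real"] by simp
        then have "(1 / 2 :: real) ^ l \<le> exp (- 1 / 2) ^ l" by (intro power_mono) auto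
        also have "\<dots> = exp (- real l / 2)" by (simp add: exp_of_nat_mult[symmetric])
        finally show ?thesis by (simp add: K_def)
      qed
      also have "\<dots> = exp (- (real l / 4))" unfolding K_def exp_add[symmetric] by simp
      also have "\<dots> = 1 / exp (real l / 4)" by (simp add: exp_minus inverse_eq_divide)
      also have "\<dots> \<le> 1 / (1 + real l / 4)" using exp_ge_add_one_self[of "real l / 4"] by (intro divide_left_mono) auto
      also have "\<dots> \<le> 4 / real (Suc l)" by (simp add: field_simps)
      finally show ?thesis .
    qed
    also have "4 / real l * J \<le> 8 / real (Suc l) * J"
      using False J by (intro mult_right_mono) (auto simp: field_simps)
    finally show ?thesis unfolding P l_def by (simp add: add_divide_distrib)
  qed
qed

end

subsection \<open>Random branch probabilities\<close>

lemma sum_length_Suc: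
  fixes \<phi> :: "bool list \<Rightarrow> real"
  shows "(\<Sum>\<epsilon> | length \<epsilon> = Suc n. \<phi> \<epsilon>) = (\<Sum>\<epsilon> | length \<epsilon> = n. \<phi> (\<epsilon> @ [False]) + \<phi> (\<epsilon> @ [True]))"
proof -
  have "{\<epsilon> :: bool list. length \<epsilon> = Suc n} = (\<lambda>(\<epsilon>, b). \<epsilon> @ [b]) ` ({\<epsilon>. length \<epsilon> = n} \<times> UNIV)"
    by (auto simp: image_iff length_Suc_conv_rev)
  moreover have "inj_on (\<lambda>(\<epsilon>, b). \<epsilon> @ [b]) ({\<epsilon> :: bool list. length \<epsilon> = n} \<times> UNIV)"
    by (auto simp: inj_on_def)
  ultimately have "(\<Sum>\<epsilon> | length \<epsilon> = Suc n. \<phi> \<epsilon>) = (\<Sum>(\<epsilon>, b) \<in> {\<epsilon>. length \<epsilon> = n} \<times> UNIV. \<phi> (\<epsilon> @ [b]))"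
    by (simp add: sum.reindex split_def)
  also have "\<dots> = (\<Sum>\<epsilon> | length \<epsilon> = n. \<Sum>b\<in>UNIV. \<phi> (\<epsilon> @ [b]))"
    by (rule sum.cartesian_product[symmetric])
  finally show ?thesis by (simp add: UNIV_bool add.commute)
qed

lemma prod_le_exp_sum:
  fixes q v :: "'i \<Rightarrow> real"
  assumes "\<And>i. i \<in> A \<Longrightarrow> 0 \<le> q i" "\<And>i. i \<in> A \<Longrightarrow> q i \<le> 1 + v i"
  shows "prod q A \<le> exp (sum v A)"
proof (cases "finite A")
  case True
  have "prod q A \<le> (\<Prod>i\<in>A. exp (v i))"
    using assms by (intro prod_mono) (auto intro: order_trans[OF _ exp_ge_add_one_self])
  then show ?thesis using True by (simp add: exp_sum)
qed auto

text \<open>The Weierstrass inequality covers the case that all v i are at most 1. If some v i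
  exceeds 1, the left side is negative and the product is nonnegative.\<close>

lemma prod_ge_one_minus_sum:
  fixes r v :: "'i \<Rightarrow> real"
  assumes "finite A" "\<And>i. i \<in> A \<Longrightarrow> 0 \<le> r i" "\<And>i. i \<in> A \<Longrightarrow> 1 - v i \<le> r i" "\<And>i. i \<in> A \<Longrightarrow> 0 \<le> v i"
  shows "1 - sum v A \<le> prod r A"
proof (cases "\<forall>i\<in>A. v i \<le> 1")
  case True
  have "1 - sum v A \<le> (\<Prod>i\<in>A. 1 - v i)"
    using True assms by (intro Weierstrass_prod_ineq) auto
  also have "\<dots> \<le> prod r A" using True assms by (intro prod_mono) auto
  finally show ?thesis .
next
  case False
  then obtain i where i: "i \<in> A" "1 < v i" by auto
  have "v i \<le> sum v A" using assms i by (intro member_le_sum) auto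
  then show ?thesis using i assms by (intro order_trans[OF _ prod_nonneg]) auto
qed

text \<open>The interface shared by the prior and all posteriors: one bound v on the deviations of
  each level. The branches at a node of length l have parameters of length l + 1, so the instances
  take v l from \<open>a (Suc l)\<close>, and the summability condition carries the matching weight
  \<open>Suc l\<close>.\<close>

locale bounded_polya_tree = dyadic_tree \<X> B
  for \<X> :: "'a::euclidean_space set" and B :: "bool list \<Rightarrow> 'a set" +
  fixes PT :: "'a measure measure" and \<alpha> :: "bool list \<Rightarrow> real" and v :: "nat \<Rightarrow> real"
  assumes pt: "polya_tree \<X> B \<alpha> PT"
    and \<alpha>_pos: "\<And>\<epsilon>. 0 < \<alpha> \<epsilon>"
    and dev: "\<And>\<epsilon> b. beta_dev (\<alpha> (\<epsilon> @ [b])) (\<alpha> (\<epsilon> @ [\<not> b])) \<le> v (length \<epsilon>)"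
    and v_summable: "summable (\<lambda>l. real (Suc l) * v l)"
begin

sublocale prob_space PT
  using pt by (simp add: polya_tree_def)

text \<open>Puts both children of a node into one family, so that each moment estimate is stated
  once: the beta parameters of branch b are those of child b and of its sibling, in this
  order.\<close>

definition branch :: "bool \<Rightarrow> bool list \<Rightarrow> 'a measure \<Rightarrow> real" where
  "branch b \<epsilon> Q = (if b then 1 - split_prob B \<epsilon> Q else split_prob B \<epsilon> Q)"

lemma v_nonneg: "0 \<le> v l"
  using dev[of "replicate l True" True] beta_dev_nonneg[OF \<alpha>_pos \<alpha>_pos] order_trans
  by (metis length_replicate)

lemma v_le: "v l \<le> real (Suc l) * v l"
  using v_nonneg[of l] by (simp add: algebra_simps)

lemma summable_v: "summable v"
  using v_summable by (rule summable_comparison_test') (use v_le v_nonneg in auto)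

lemma split_prob_measurable [measurable]: "split_prob B \<epsilon> \<in> borel_measurable PT"
  using pt distributed_measurable[of PT lborel "split_prob B \<epsilon>"] by (auto simp: polya_tree_def)

lemma branch_measurable [measurable]: "branch b \<epsilon> \<in> borel_measurable PT"
  unfolding branch_def by measurable

lemma branch_distributed:
  "distributed PT lborel (branch b \<epsilon>) (\<lambda>y. ennreal (beta_density (\<alpha> (\<epsilon> @ [b])) (\<alpha> (\<epsilon> @ [\<not> b])) y))"
proof -
  have "distributed PT lborel (split_prob B \<epsilon>) (\<lambda>y. ennreal (beta_density (\<alpha> (\<epsilon> @ [False])) (\<alpha> (\<epsilon> @ [True])) y))"
    using pt by (simp add: polya_tree_def)
  from this beta_distributed_flip[OF \<alpha>_pos \<alpha>_pos this] show ?thesis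
    by (cases b) (simp_all add: branch_def[abs_def])
qed

lemmas branch_facts =
  beta_distributed_integrable_id[OF \<alpha>_pos \<alpha>_pos branch_distributed]
  beta_distributed_integrable_sq[OF \<alpha>_pos \<alpha>_pos branch_distributed]
  beta_distributed_integrable_ln[OF \<alpha>_pos \<alpha>_pos branch_distributed]
  beta_distributed_integrable_ln_sq[OF \<alpha>_pos \<alpha>_pos branch_distributed]

lemmas branch_mean_ln = beta_distributed_mean_ln[OF \<alpha>_pos \<alpha>_pos branch_distributed]

lemma branch_dev:
  shows "\<bar>2 * expectation (branch b \<epsilon>) - 1\<bar> \<le> v (length \<epsilon>)"
    and "\<bar>4 * expectation (\<lambda>Q. (branch b \<epsilon> Q)\<^sup>2) - 1\<bar> \<le> v (length \<epsilon>)"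
    and "\<bar>expectation (\<lambda>Q. ln (2 * branch b \<epsilon> Q))\<bar> \<le> v (length \<epsilon>)"
    and "expectation (\<lambda>Q. (ln (2 * branch b \<epsilon> Q))\<^sup>2) \<le> v (length \<epsilon>)"
proof -
  let ?a = "\<alpha> (\<epsilon> @ [b])" and ?b = "\<alpha> (\<epsilon> @ [\<not> b])"
  have sq: "0 \<le> (\<integral>y. beta_density ?a ?b y * (ln (2 * y))\<^sup>2 \<partial>lborel)"
    by (intro integral_nonneg_AE AE_I2 mult_nonneg_nonneg beta_density_nonneg \<alpha>_pos) auto
  note d = dev[of \<epsilon> b, unfolded beta_dev_def]
  show "\<bar>2 * expectation (branch b \<epsilon>) - 1\<bar> \<le> v (length \<epsilon>)"
    unfolding beta_distributed_mean[OF \<alpha>_pos \<alpha>_pos branch_distributed] using d sq by linarith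
  show "\<bar>4 * expectation (\<lambda>Q. (branch b \<epsilon> Q)\<^sup>2) - 1\<bar> \<le> v (length \<epsilon>)"
    unfolding beta_distributed_mean_sq[OF \<alpha>_pos \<alpha>_pos branch_distributed] using d sq by linarith
  show "\<bar>expectation (\<lambda>Q. ln (2 * branch b \<epsilon> Q))\<bar> \<le> v (length \<epsilon>)"
    unfolding branch_mean_ln using d sq by linarith
  show "expectation (\<lambda>Q. (ln (2 * branch b \<epsilon> Q))\<^sup>2) \<le> v (length \<epsilon>)"
    unfolding beta_distributed_mean_ln_sq[OF \<alpha>_pos \<alpha>_pos branch_distributed] using d sq by linarith
qed

lemma space_PT: "space PT = {Q. sets Q = sets BX \<and> prob_space Q}"
  using pt sets_eq_imp_space_eq[of PT "prob_algebra BX"] by (auto simp: polya_tree_def space_prob_algebra)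

text \<open>The beta laws give no mass to 0 and 1, and there are countably many nodes. Off one null
  set every node has positive mass, so \<open>split_prob\<close> never divides by 0 and all
  logarithms are taken of positive numbers.\<close>

lemma AE_regular:
  "AE Q in PT. prob_space Q \<and> sets Q = sets BX \<and> (\<forall>\<epsilon>. 0 < measure Q (B \<epsilon>)) \<and> (\<forall>b \<epsilon>. 0 < branch b \<epsilon> Q)"
proof -
  have "AE Q in PT. 0 < branch b \<epsilon> Q \<and> branch b \<epsilon> Q < 1" for b \<epsilon>
    by (rule beta_distributed_AE[OF \<alpha>_pos \<alpha>_pos branch_distributed])
  then have "AE Q in PT. \<forall>b \<epsilon>. 0 < branch b \<epsilon> Q \<and> branch b \<epsilon> Q < 1"
    by (simp add: AE_all_countable)
  moreover have "AE Q in PT. prob_space Q \<and> sets Q = sets BX"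
    by (rule AE_I2) (simp add: space_PT)
  ultimately show ?thesis
  proof eventually_elim
    case (elim Q)
    interpret Q: prob_space Q using elim by simp
    have sp: "space Q = \<X>" using elim sets_eq_imp_space_eq[of Q BX] by (simp add: space_LX)
    have "0 < measure Q (B \<epsilon>)" for \<epsilon>
    proof (induction \<epsilon> rule: rev_induct)
      case Nil
      then show ?case using Q.prob_space by (simp add: B_Nil sp)
    next
      case (snoc b \<epsilon>)
      have "measure Q (B \<epsilon>) = measure Q (B (\<epsilon> @ [False])) + measure Q (B (\<epsilon> @ [True]))"
        using elim by (intro measure_B_split) (auto intro: Q.finite_measure_axioms)
      moreover have "0 < split_prob B \<epsilon> Q" "split_prob B \<epsilon> Q < 1"
        using elim(1)[rule_format, of False \<epsilon>] by (simp_all add: branch_def)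
      ultimately show ?case using snoc
        by (cases b) (auto simp: split_prob_def zero_less_divide_iff divide_less_eq)
    qed
    then show ?case using elim by auto
  qed
qed

lemma ratio_Nil:
  assumes "prob_space Q" "sets Q = sets BX"
  shows "ratio Q [] = 1"
  using prob_space.prob_space[OF assms(1)] sets_eq_imp_space_eq[OF assms(2)]
  by (simp add: ratio_def B_Nil space_LX)

lemma ratio_snoc:
  assumes "prob_space Q" "sets Q = sets BX" "\<forall>\<epsilon>. 0 < measure Q (B \<epsilon>)"
  shows "ratio Q (\<epsilon> @ [b]) = ratio Q \<epsilon> * (2 * branch b \<epsilon> Q)"
proof -
  have "measure Q (B \<epsilon>) = measure Q (B (\<epsilon> @ [False])) + measure Q (B (\<epsilon> @ [True]))"
    using assms by (intro measure_B_split) (auto simp: prob_space.axioms(1))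
  moreover have "0 < measure Q (B \<epsilon>)" using assms by simp
  ultimately have "branch b \<epsilon> Q * measure Q (B \<epsilon>) = measure Q (B (\<epsilon> @ [b]))"
    by (cases b) (simp_all add: branch_def split_prob_def left_diff_distrib)
  from this[symmetric] show ?thesis unfolding ratio_def by simp
qed

lemma ratio_take:
  assumes "prob_space Q" "sets Q = sets BX" "\<forall>\<epsilon>. 0 < measure Q (B \<epsilon>)" "m \<le> length \<epsilon>"
  shows "ratio Q \<epsilon> = ratio Q (take m \<epsilon>) * (\<Prod>i\<in>{m..<length \<epsilon>}. 2 * branch (\<epsilon> ! i) (take i \<epsilon>) Q)"
  using assms(4)
proof (induction \<epsilon> rule: rev_induct)
  case (snoc b \<epsilon>)
  show ?case
  proof (cases "m = Suc (length \<epsilon>)")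
    case False
    then have m: "m \<le> length \<epsilon>" using snoc.prems by simp
    have "(\<Prod>i\<in>{m..<length \<epsilon>}. 2 * branch ((\<epsilon> @ [b]) ! i) (take i (\<epsilon> @ [b])) Q)
        = (\<Prod>i\<in>{m..<length \<epsilon>}. 2 * branch (\<epsilon> ! i) (take i \<epsilon>) Q)"
      by (intro prod.cong) (auto simp: nth_append)
    then show ?thesis
      using snoc.IH[OF m] m by (simp add: ratio_snoc[OF assms(1-3)] atLeastLessThanSuc)
  qed simp
qed simp

lemma ratio_pos: "\<forall>\<epsilon>. 0 < measure Q (B \<epsilon>) \<Longrightarrow> 0 < ratio Q \<epsilon>"
  by (simp add: ratio_def)

lemma ratio_measurable [measurable]: "(\<lambda>Q. ratio Q \<epsilon>) \<in> borel_measurable PT"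
proof -
  have "(\<lambda>Q. measure Q (B \<epsilon>)) \<in> borel_measurable (prob_algebra BX)"
    using B_sets by (rule measurable_measure_prob_algebra)
  moreover have "sets PT = sets (prob_algebra BX)" using pt by (simp add: polya_tree_def)
  ultimately have "(\<lambda>Q. measure Q (B \<epsilon>)) \<in> borel_measurable PT" by (simp cong: measurable_cong_sets)
  then show ?thesis unfolding ratio_def by measurable
qed

lemma indep_nodes:
  assumes "\<And>\<epsilon>. W \<epsilon> \<in> borel_measurable borel"
  shows "indep_vars (\<lambda>_. borel) (\<lambda>\<epsilon> Q. W \<epsilon> (split_prob B \<epsilon> Q) :: real) I"
proof -
  have "indep_vars (\<lambda>_. borel) (split_prob B) I"
    using pt indep_vars_subset[of _ _ UNIV I] by (auto simp: polya_tree_def)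
  then show ?thesis using assms by (intro indep_vars_compose2[where Y=W])
qed

text \<open>Independence is given for \<open>split_prob\<close>; this exhibits a branch as a
  measurable function of that variable.\<close>

definition branch_val :: "bool \<Rightarrow> real \<Rightarrow> real" where
  "branch_val b y = (if b then 1 - y else y)"

lemma branch_val: "branch b \<epsilon> Q = branch_val b (split_prob B \<epsilon> Q)"
  by (simp add: branch_def branch_val_def)

lemma branch_val_measurable [measurable]: "branch_val b \<in> borel_measurable borel"
  unfolding branch_val_def by measurable

text \<open>From m on, the sum of v is at most V / m. For m = 4^k, taking t = 2^(-k) in
  \<open>integral_abs_le_sq\<close> bounds the mean increment by (1 + C V) 2^(-k), and the weights
  merely average over nodes. Used with h the ratio and w the \<lambda>-masses, and with h its
  logarithm and w the P_X-masses.\<close>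

lemma AE_summable_increments:
  fixes h :: "'a measure \<Rightarrow> bool list \<Rightarrow> real" and w :: "bool list \<Rightarrow> real"
  assumes [measurable]: "\<And>\<epsilon>. (\<lambda>Q. h Q \<epsilon>) \<in> borel_measurable PT"
    and w: "\<And>\<epsilon>. 0 \<le> w \<epsilon>" "\<And>n. (\<Sum>\<epsilon> | length \<epsilon> = n. w \<epsilon>) = 1" and C: "0 \<le> C"
    and int: "\<And>m \<epsilon>. m \<le> length \<epsilon> \<Longrightarrow> integrable PT (\<lambda>Q. (h Q \<epsilon> - h Q (take m \<epsilon>))\<^sup>2)"
    and bound: "\<And>m \<epsilon>. m \<le> length \<epsilon> \<Longrightarrow>
      expectation (\<lambda>Q. (h Q \<epsilon> - h Q (take m \<epsilon>))\<^sup>2) \<le> C * (\<Sum>i\<in>{m..<length \<epsilon>}. v i)"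
  shows "AE Q in PT. summable (\<lambda>k. \<Sum>\<epsilon> | length \<epsilon> = 4 ^ Suc k. \<bar>h Q \<epsilon> - h Q (take (4 ^ k) \<epsilon>)\<bar> * w \<epsilon>)"
proof -
  define V where "V = (\<Sum>l. real (Suc l) * v l)"
  have V0: "0 \<le> V" unfolding V_def using v_summable v_nonneg by (intro suminf_nonneg) auto
  have tail: "(\<Sum>i\<in>{m..<n}. v i) \<le> V / m" if "0 < m" for m n
  proof -
    have "m * (\<Sum>i\<in>{m..<n}. v i) = (\<Sum>i\<in>{m..<n}. m * v i)" by (simp add: sum_distrib_left)
    also have "\<dots> \<le> (\<Sum>i\<in>{m..<n}. real (Suc i) * v i)" using v_nonneg by (intro sum_mono mult_right_mono) auto
    also have "\<dots> \<le> V" unfolding V_def using v_summable v_nonneg by (intro sum_le_suminf) auto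
    finally show ?thesis using that by (simp add: field_simps)
  qed
  define D where "D k Q = (\<Sum>\<epsilon> | length \<epsilon> = 4 ^ Suc k. \<bar>h Q \<epsilon> - h Q (take (4 ^ k) \<epsilon>)\<bar> * w \<epsilon>)" for k Q
  have di: "integrable PT (\<lambda>Q. h Q \<epsilon> - h Q (take m \<epsilon>))" if "m \<le> length \<epsilon>" for m \<epsilon>
    by (rule integrable_if_square_integrable[OF _ int[OF that]]) measurable
  have Di: "integrable PT (D k)" for k
    unfolding D_def using di by (intro Bochner_Integration.integrable_sum integrable_mult_left integrable_abs) auto
  have D0: "0 \<le> D k Q" for k Q unfolding D_def using w by (intro sum_nonneg) auto
  have DE: "expectation (D k) \<le> (1 + C * V) * (1 / 2) ^ k" for k
  proof -
    have "expectation (D k) = (\<Sum>\<epsilon> | length \<epsilon> = 4 ^ Suc k. expectation (\<lambda>Q. \<bar>h Q \<epsilon> - h Q (take (4 ^ k) \<epsilon>)\<bar>) * w \<epsilon>)"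
      unfolding D_def using di by (subst Bochner_Integration.integral_sum) auto
    also have "\<dots> \<le> (\<Sum>\<epsilon> | length \<epsilon> = 4 ^ Suc k. ((1 + C * V) * (1 / 2) ^ k) * w \<epsilon>)"
    proof (intro sum_mono mult_right_mono w)
      fix \<epsilon> :: "bool list" assume "\<epsilon> \<in> {\<epsilon>. length \<epsilon> = 4 ^ Suc k}"
      then have l: "4 ^ k \<le> length \<epsilon>" by simp
      have "C * (\<Sum>i\<in>{4 ^ k..<length \<epsilon>}. v i) \<le> C * (V / real (4 ^ k))"
        using C by (intro mult_left_mono tail) auto
      then have "expectation (\<lambda>Q. \<bar>h Q \<epsilon> - h Q (take (4 ^ k) \<epsilon>)\<bar>) \<le> (1 / 2) ^ k + C * (V / real (4 ^ k)) / (1 / 2) ^ k"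
        using bound[OF l] by (intro integral_abs_le_sq di int l prob_space_axioms) auto
      also have "real (4 ^ k) = 2 ^ k * 2 ^ k" by (simp add: power_mult_distrib[symmetric])
      also have "(1 / 2) ^ k + C * (V / (2 ^ k * 2 ^ k)) / (1 / 2) ^ k = (1 + C * V) * (1 / 2) ^ k"
        by (simp add: power_one_over field_simps)
      finally show "expectation (\<lambda>Q. \<bar>h Q \<epsilon> - h Q (take (4 ^ k) \<epsilon>)\<bar>) \<le> (1 + C * V) * (1 / 2) ^ k" .
    qed
    also have "\<dots> = (1 + C * V) * (1 / 2) ^ k" using w(2) by (simp add: sum_distrib_left[symmetric])
    finally show ?thesis .
  qed
  have "summable (\<lambda>k. (1 + C * V) * (1 / 2) ^ k)" by (intro summable_mult summable_geometric) simp
  then have "summable (\<lambda>k. expectation (\<lambda>Q. \<bar>D k Q\<bar>))"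
    using DE D0 by (rule_tac summable_comparison_test'[where g="\<lambda>k. (1 + C * V) * (1 / 2) ^ k"]) auto
  from AE_summable_if_summable_integral_norm[OF Di this] have "AE Q in PT. summable (\<lambda>k. D k Q)"
    using D0 by simp
  then show ?thesis unfolding D_def .
qed

section \<open>Second moments of increments along one path\<close>

lemma inj_take: "n \<le> length \<epsilon> \<Longrightarrow> inj_on (\<lambda>i. take i \<epsilon>) {m..<n}"
  by (auto simp: inj_on_def dest!: arg_cong[of "take _ \<epsilon>" _ length])

lemma path_prod:
  fixes W :: "nat \<Rightarrow> real \<Rightarrow> real"
  assumes "n \<le> length \<epsilon>" "\<And>i. W i \<in> borel_measurable borel"
    and "\<And>i. i < n \<Longrightarrow> integrable PT (\<lambda>Q. W i (branch (\<epsilon> ! i) (take i \<epsilon>) Q))"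
  shows "integrable PT (\<lambda>Q. \<Prod>i<n. W i (branch (\<epsilon> ! i) (take i \<epsilon>) Q))"
    and "expectation (\<lambda>Q. \<Prod>i<n. W i (branch (\<epsilon> ! i) (take i \<epsilon>) Q))
      = (\<Prod>i<n. expectation (\<lambda>Q. W i (branch (\<epsilon> ! i) (take i \<epsilon>) Q)))"
proof -
  \<comment> \<open>Nodes of one path have different lengths, so functions attached to levels can be
    indexed by nodes, as \<open>indep_nodes\<close> requires.\<close>
  define Z where "Z \<eta> y = W (length \<eta>) (branch_val (\<epsilon> ! length \<eta>) y)" for \<eta> :: "bool list" and y
  let ?I = "(\<lambda>i. take i \<epsilon>) ` {0..<n}"
  have Z: "Z (take i \<epsilon>) (split_prob B (take i \<epsilon>) Q) = W i (branch (\<epsilon> ! i) (take i \<epsilon>) Q)" if "i < n" for i Q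
    using that assms(1) by (simp add: Z_def branch_val min_def)
  have re: "(\<Prod>\<eta>\<in>?I. F \<eta>) = (\<Prod>i<n. F (take i \<epsilon>))" for F :: "bool list \<Rightarrow> real"
    using inj_take[OF assms(1), of 0] by (simp add: prod.reindex atLeast0LessThan)
  have [measurable]: "Z \<eta> \<in> borel_measurable borel" for \<eta>
    unfolding Z_def using assms(2) by measurable
  have ind: "indep_vars (\<lambda>_. borel) (\<lambda>\<eta> Q. Z \<eta> (split_prob B \<eta> Q)) ?I"
    by (rule indep_nodes) measurable
  have int: "integrable PT (\<lambda>Q. Z \<eta> (split_prob B \<eta> Q))" if "\<eta> \<in> ?I" for \<eta>
    using that assms(3) by (auto simp: Z)
  have eq: "(\<Prod>\<eta>\<in>?I. Z \<eta> (split_prob B \<eta> Q)) = (\<Prod>i<n. W i (branch (\<epsilon> ! i) (take i \<epsilon>) Q))" for Q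
    unfolding re by (intro prod.cong) (auto simp: Z)
  have eq': "(\<Prod>\<eta>\<in>?I. expectation (\<lambda>Q. Z \<eta> (split_prob B \<eta> Q))) = (\<Prod>i<n. expectation (\<lambda>Q. W i (branch (\<epsilon> ! i) (take i \<epsilon>) Q)))"
    unfolding re by (intro prod.cong) (auto simp: Z)
  show "integrable PT (\<lambda>Q. \<Prod>i<n. W i (branch (\<epsilon> ! i) (take i \<epsilon>) Q))"
    using indep_vars_integrable[OF _ ind int] by (simp add: eq)
  show "expectation (\<lambda>Q. \<Prod>i<n. W i (branch (\<epsilon> ! i) (take i \<epsilon>) Q))
      = (\<Prod>i<n. expectation (\<lambda>Q. W i (branch (\<epsilon> ! i) (take i \<epsilon>) Q)))"
    using indep_vars_lebesgue_integral[OF _ ind int] by (simp add: eq eq')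
qed

text \<open>With a the product of the doubled branches before level m and b the product from m on,
  the square is a^2 b^2 - 2 a^2 b + a^2; \<open>WA\<close>, \<open>WB\<close> and \<open>WC\<close>
  are the factors of these terms, each a product over independent nodes. With unequal parameters the
  ratios are no martingale, so the cross term is bounded: first moments of the factors are at least
  1 - v i, second moments at most 1 + v i.\<close>

lemma ratio_diff_square:
  assumes m: "m \<le> length \<epsilon>"
  shows "integrable PT (\<lambda>Q. (ratio Q \<epsilon> - ratio Q (take m \<epsilon>))\<^sup>2)"
    and "expectation (\<lambda>Q. (ratio Q \<epsilon> - ratio Q (take m \<epsilon>))\<^sup>2) \<le> 3 * exp (2 * suminf v) * (\<Sum>i\<in>{m..<length \<epsilon>}. v i)"
proof -
  define n where "n = length \<epsilon>"
  define R where "R i = branch (\<epsilon> ! i) (take i \<epsilon>)" for i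
  define WA WB WC :: "nat \<Rightarrow> real \<Rightarrow> real" where
    "WA i y = 4 * y\<^sup>2" and "WB i y = (if i < m then 4 * y\<^sup>2 else 2 * y)" and "WC i y = (if i < m then 4 * y\<^sup>2 else 1)"
    for i y
  have [measurable]: "WA i \<in> borel_measurable borel" "WB i \<in> borel_measurable borel" "WC i \<in> borel_measurable borel" for i
    unfolding WA_def WB_def WC_def by measurable
  have Wint: "integrable PT (\<lambda>Q. WA i (branch (\<epsilon> ! i) (take i \<epsilon>) Q))"
    "integrable PT (\<lambda>Q. WB i (branch (\<epsilon> ! i) (take i \<epsilon>) Q))"
    "integrable PT (\<lambda>Q. WC i (branch (\<epsilon> ! i) (take i \<epsilon>) Q))" for i
    using branch_facts by (cases "i < m"; simp add: WA_def WB_def WC_def)+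
  note pp = path_prod[OF order_refl, of WA \<epsilon>, OF _ Wint(1)] path_prod[OF order_refl, of WB \<epsilon>, OF _ Wint(2)]
    path_prod[OF order_refl, of WC \<epsilon>, OF _ Wint(3)]
  define F where "F Q = (\<Prod>i<n. WA i (R i Q)) - 2 * (\<Prod>i<n. WB i (R i Q)) + (\<Prod>i<n. WC i (R i Q))" for Q
  have split: "(\<Prod>i<n. h i) = (\<Prod>i<m. h i) * (\<Prod>i\<in>{m..<n}. h i)" for h :: "nat \<Rightarrow> real"
    using m prod.atLeastLessThan_concat[of 0 m n h] by (simp add: n_def atLeast0LessThan)
  have ae: "AE Q in PT. (ratio Q \<epsilon> - ratio Q (take m \<epsilon>))\<^sup>2 = F Q"
    using AE_regular
  proof eventually_elim
    case (elim Q)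
    define a where "a = (\<Prod>i<m. 2 * R i Q)"
    define b where "b = (\<Prod>i\<in>{m..<n}. 2 * R i Q)"
    have e: "ratio Q \<epsilon> = ratio Q (take k \<epsilon>) * (\<Prod>i\<in>{k..<n}. 2 * R i Q)" if "k \<le> n" for k
      using ratio_take[of Q k \<epsilon>] elim that by (simp add: R_def n_def)
    have "ratio Q \<epsilon> = a * b"
      using e[of 0] elim ratio_Nil[of Q] split[of "\<lambda>i. 2 * R i Q"] by (simp add: a_def b_def atLeast0LessThan)
    moreover have "ratio Q (take m \<epsilon>) = a"
    proof -
      have "ratio Q (take m \<epsilon>) * b = ratio Q \<epsilon>" using e[of m] m by (simp only: n_def b_def)
      also have "\<dots> = a * b" by fact
      finally have "ratio Q (take m \<epsilon>) * b = a * b" .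
      moreover have "0 < b" unfolding b_def using elim by (intro prod_pos) (auto simp: R_def)
      ultimately show ?thesis by (metis mult_right_cancel less_irrefl)
    qed
    moreover have "F Q = a\<^sup>2 * b\<^sup>2 - 2 * (a\<^sup>2 * b) + a\<^sup>2"
    proof -
      have A: "(\<Prod>i<m. 4 * (R i Q)\<^sup>2) = a\<^sup>2" "(\<Prod>i\<in>{m..<n}. 4 * (R i Q)\<^sup>2) = b\<^sup>2"
        unfolding a_def b_def prod_power_distrib by (simp_all add: power_mult_distrib)
      have "(\<Prod>i<m. WA i (R i Q)) = a\<^sup>2" "(\<Prod>i<m. WB i (R i Q)) = a\<^sup>2" "(\<Prod>i<m. WC i (R i Q)) = a\<^sup>2"
        "(\<Prod>i\<in>{m..<n}. WA i (R i Q)) = b\<^sup>2" "(\<Prod>i\<in>{m..<n}. WC i (R i Q)) = 1"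
        by (simp_all add: WA_def WB_def WC_def A)
      moreover have "(\<Prod>i\<in>{m..<n}. WB i (R i Q)) = b" by (simp add: WB_def b_def)
      ultimately show ?thesis by (simp add: F_def split)
    qed
    ultimately show ?case by (simp add: power2_eq_square algebra_simps)
  qed
  have Fint: "integrable PT F"
    unfolding F_def using pp by (auto simp: R_def n_def)
  show "integrable PT (\<lambda>Q. (ratio Q \<epsilon> - ratio Q (take m \<epsilon>))\<^sup>2)"
    using Fint ae by (subst integrable_cong_AE[where g=F]) auto
  define q r where "q i = expectation (\<lambda>Q. 4 * (R i Q)\<^sup>2)" and "r i = expectation (\<lambda>Q. 2 * R i Q)" for i
  have nn: "AE Q in PT. 0 \<le> R i Q" for i
    using AE_regular by eventually_elim (auto simp: R_def intro: less_imp_le)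
  have q0: "0 \<le> q i" for i unfolding q_def by (intro integral_nonneg_AE) auto
  have r0: "0 \<le> r i" for i unfolding r_def using nn[of i] by (intro integral_nonneg_AE) auto
  have q1: "q i \<le> 1 + v i" if "i < n" for i
    using branch_dev(2)[of "\<epsilon> ! i" "take i \<epsilon>"] that by (simp add: q_def R_def n_def)
  have r1: "1 - v i \<le> r i" if "i < n" for i
    using branch_dev(1)[of "\<epsilon> ! i" "take i \<epsilon>"] that by (simp add: r_def R_def n_def)
  define t where "t = (\<Sum>i\<in>{m..<n}. v i)"
  have t0: "0 \<le> t" unfolding t_def by (intro sum_nonneg v_nonneg)
  have sumle: "sum v A \<le> suminf v" if "finite A" for A
    using that summable_v v_nonneg by (intro sum_le_suminf) auto
  have tV: "t \<le> suminf v" unfolding t_def by (rule sumle) simp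
  have "expectation (\<lambda>Q. (ratio Q \<epsilon> - ratio Q (take m \<epsilon>))\<^sup>2) = expectation F"
    using ae Fint by (intro integral_cong_AE) auto
  also have "\<dots> = (\<Prod>i<n. expectation (\<lambda>Q. WA i (R i Q))) - 2 * (\<Prod>i<n. expectation (\<lambda>Q. WB i (R i Q)))
      + (\<Prod>i<n. expectation (\<lambda>Q. WC i (R i Q)))"
    unfolding F_def using pp by (simp add: R_def n_def)
  also have "\<dots> = (\<Prod>i<m. q i) * ((\<Prod>i\<in>{m..<n}. q i) - 2 * (\<Prod>i\<in>{m..<n}. r i) + 1)"
  proof -
    have "(\<Prod>i<m. expectation (\<lambda>Q. WA i (R i Q))) = (\<Prod>i<m. q i)" "(\<Prod>i<m. expectation (\<lambda>Q. WB i (R i Q))) = (\<Prod>i<m. q i)"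
      "(\<Prod>i<m. expectation (\<lambda>Q. WC i (R i Q))) = (\<Prod>i<m. q i)"
      "(\<Prod>i\<in>{m..<n}. expectation (\<lambda>Q. WA i (R i Q))) = (\<Prod>i\<in>{m..<n}. q i)"
      "(\<Prod>i\<in>{m..<n}. expectation (\<lambda>Q. WB i (R i Q))) = (\<Prod>i\<in>{m..<n}. r i)"
      "(\<Prod>i\<in>{m..<n}. expectation (\<lambda>Q. WC i (R i Q))) = 1"
      by (simp_all add: WA_def WB_def WC_def q_def r_def prob_space)
    then show ?thesis by (simp add: split algebra_simps)
  qed
  also have "\<dots> \<le> exp (suminf v) * (3 * t * exp (suminf v))"
  proof -
    have "(\<Prod>i<m. q i) \<le> exp (\<Sum>i<m. v i)"
      using q0 q1 m by (intro prod_le_exp_sum) (auto simp: n_def)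
    also have "\<dots> \<le> exp (suminf v)" using sumle[of "{..<m}"] by simp
    finally have a: "(\<Prod>i<m. q i) \<le> exp (suminf v)" .
    have 1: "(\<Prod>i\<in>{m..<n}. q i) \<le> exp t"
      unfolding t_def using q0 q1 by (intro prod_le_exp_sum) auto
    have 2: "1 - t \<le> (\<Prod>i\<in>{m..<n}. r i)"
      unfolding t_def using r0 r1 v_nonneg by (intro prod_ge_one_minus_sum) auto
    \<comment> \<open>The quantity to bound is at most exp t - 2 (1 - t) + 1 = (exp t - 1) + 2 t,
      and exp t - 1 \<le> t exp t; hence the factor 3.\<close>
    have "1 - t \<le> exp (- t)" using exp_ge_add_one_self[of "- t"] by simp
    then have "exp t * (1 - t) \<le> exp t * exp (- t)" by (intro mult_left_mono) auto
    then have 3: "exp t - 1 \<le> t * exp t" by (simp add: exp_minus algebra_simps)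
    have "t * exp t \<le> t * exp (suminf v)" using t0 tV by (intro mult_left_mono) auto
    moreover have "t * 1 \<le> t * exp (suminf v)" using t0 tV by (intro mult_left_mono) auto
    ultimately have b: "(\<Prod>i\<in>{m..<n}. q i) - 2 * (\<Prod>i\<in>{m..<n}. r i) + 1 \<le> 3 * t * exp (suminf v)"
      using 1 2 3 by linarith
    have "(\<Prod>i<m. q i) * ((\<Prod>i\<in>{m..<n}. q i) - 2 * (\<Prod>i\<in>{m..<n}. r i) + 1) \<le> (\<Prod>i<m. q i) * (3 * t * exp (suminf v))"
      using b q0 by (intro mult_left_mono prod_nonneg) auto
    also have "\<dots> \<le> exp (suminf v) * (3 * t * exp (suminf v))"
      using a t0 by (intro mult_right_mono) auto
    finally show ?thesis .
  qed
  also have "\<dots> = 3 * exp (2 * suminf v) * t"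
  proof -
    have "exp (2 * suminf v) = exp (suminf v) * exp (suminf v)" by (simp flip: exp_add)
    then show ?thesis by simp
  qed
  finally show "expectation (\<lambda>Q. (ratio Q \<epsilon> - ratio Q (take m \<epsilon>))\<^sup>2)
      \<le> 3 * exp (2 * suminf v) * (\<Sum>i\<in>{m..<length \<epsilon>}. v i)" by (simp add: t_def n_def)
qed

text \<open>A sum of independent variables: its second moment is variance plus squared mean, at most
  t + t^2 with t the sum of v over the block, and t \<le> \<open>suminf v\<close> linearises the
  square.\<close>

lemma ln_ratio_diff_square:
  assumes m: "m \<le> length \<epsilon>"
  shows "integrable PT (\<lambda>Q. (ln (ratio Q \<epsilon>) - ln (ratio Q (take m \<epsilon>)))\<^sup>2)"
    and "expectation (\<lambda>Q. (ln (ratio Q \<epsilon>) - ln (ratio Q (take m \<epsilon>)))\<^sup>2) \<le> (1 + suminf v) * (\<Sum>i\<in>{m..<length \<epsilon>}. v i)"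
proof -
  define n where "n = length \<epsilon>"
  define t where "t = (\<Sum>i\<in>{m..<n}. v i)"
  define Z where "Z \<eta> y = ln (2 * branch_val (\<epsilon> ! length \<eta>) y)" for \<eta> :: "bool list" and y
  define I where "I = (\<lambda>i. take i \<epsilon>) ` {m..<n}"
  define U where "U \<eta> Q = Z \<eta> (split_prob B \<eta> Q)" for \<eta> Q
  have U: "U \<eta> Q = ln (2 * branch (\<epsilon> ! length \<eta>) \<eta> Q)" for \<eta> Q
    by (simp add: U_def Z_def branch_val)
  have Ui: "integrable PT (U \<eta>)" and Ud: "\<bar>expectation (U \<eta>)\<bar> \<le> v (length \<eta>)" for \<eta>
    using branch_facts(3) branch_dev(3) by (simp_all add: U[abs_def])
  have re: "(\<Sum>\<eta>\<in>I. F \<eta>) = (\<Sum>i\<in>{m..<n}. F (take i \<epsilon>))" for F :: "bool list \<Rightarrow> real"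
    unfolding I_def using inj_take[of n \<epsilon> m] by (simp add: sum.reindex n_def)
  have [measurable]: "Z \<eta> \<in> borel_measurable borel" for \<eta> unfolding Z_def by measurable
  have [measurable]: "U \<eta> \<in> borel_measurable PT" for \<eta> unfolding U_def by measurable
  have "indep_vars (\<lambda>_. borel) U I" unfolding U_def by (rule indep_nodes) measurable
  moreover have sqi: "integrable PT (\<lambda>Q. (U \<eta> Q)\<^sup>2)" for \<eta> unfolding U by (rule branch_facts)
  moreover have "finite I" by (simp add: I_def)
  ultimately have S: "integrable PT (\<lambda>Q. (\<Sum>\<eta>\<in>I. U \<eta> Q)\<^sup>2)"
    "expectation (\<lambda>Q. (\<Sum>\<eta>\<in>I. U \<eta> Q)\<^sup>2) - (expectation (\<lambda>Q. \<Sum>\<eta>\<in>I. U \<eta> Q))\<^sup>2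
       = (\<Sum>\<eta>\<in>I. expectation (\<lambda>Q. (U \<eta> Q)\<^sup>2) - (expectation (U \<eta>))\<^sup>2)"
    using indep_vars_sum_square[of I U] by blast+
  have ae: "AE Q in PT. (ln (ratio Q \<epsilon>) - ln (ratio Q (take m \<epsilon>)))\<^sup>2 = (\<Sum>\<eta>\<in>I. U \<eta> Q)\<^sup>2"
    using AE_regular
  proof eventually_elim
    case (elim Q)
    have "ln (ratio Q \<epsilon>) = ln (ratio Q (take m \<epsilon>)) + ln (\<Prod>i\<in>{m..<n}. 2 * branch (\<epsilon> ! i) (take i \<epsilon>) Q)"
      using ratio_take[of Q m \<epsilon>] elim m ratio_pos[of Q "take m \<epsilon>"]
      by (subst (1) ratio_take[of Q m \<epsilon>]) (auto simp: n_def intro!: ln_mult_pos prod_pos)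
    also have "ln (\<Prod>i\<in>{m..<n}. 2 * branch (\<epsilon> ! i) (take i \<epsilon>) Q) = (\<Sum>i\<in>{m..<n}. ln (2 * branch (\<epsilon> ! i) (take i \<epsilon>) Q))"
    proof (rule ln_prod)
      fix i
      have "0 < branch (\<epsilon> ! i) (take i \<epsilon>) Q" using elim by blast
      then show "2 * branch (\<epsilon> ! i) (take i \<epsilon>) Q \<noteq> 0" by simp
    qed simp
    also have "\<dots> = (\<Sum>\<eta>\<in>I. U \<eta> Q)" unfolding re U by (intro sum.cong) (auto simp: n_def min_def)
    finally show ?case by simp
  qed
  show "integrable PT (\<lambda>Q. (ln (ratio Q \<epsilon>) - ln (ratio Q (take m \<epsilon>)))\<^sup>2)"
    using S(1) ae by (subst integrable_cong_AE[where g="\<lambda>Q. (\<Sum>\<eta>\<in>I. U \<eta> Q)\<^sup>2"]) auto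
  have Ii: "length \<eta> \<in> {m..<n}" "\<eta> = take (length \<eta>) \<epsilon>" if "\<eta> \<in> I" for \<eta>
    using that by (auto simp: I_def n_def min_def)
  have t0: "0 \<le> t" unfolding t_def by (intro sum_nonneg v_nonneg)
  have tV: "t \<le> suminf v" unfolding t_def using summable_v v_nonneg by (intro sum_le_suminf) auto
  have vI: "(\<Sum>\<eta>\<in>I. v (length \<eta>)) = t" unfolding re t_def by (intro sum.cong) (auto simp: n_def min_def)
  have "\<bar>expectation (\<lambda>Q. \<Sum>\<eta>\<in>I. U \<eta> Q)\<bar> = \<bar>\<Sum>\<eta>\<in>I. expectation (U \<eta>)\<bar>"
    using Ui by (subst Bochner_Integration.integral_sum) auto
  also have "\<dots> \<le> (\<Sum>\<eta>\<in>I. v (length \<eta>))"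
    using Ud by (intro order_trans[OF sum_abs sum_mono]) auto
  finally have "\<bar>expectation (\<lambda>Q. \<Sum>\<eta>\<in>I. U \<eta> Q)\<bar> \<le> t" by (simp add: vI)
  then have "(expectation (\<lambda>Q. \<Sum>\<eta>\<in>I. U \<eta> Q))\<^sup>2 \<le> t\<^sup>2" by (rule power2_le_iff_abs_le[THEN iffD2, rotated]) (rule t0)
  moreover have "(\<Sum>\<eta>\<in>I. expectation (\<lambda>Q. (U \<eta> Q)\<^sup>2) - (expectation (U \<eta>))\<^sup>2) \<le> (\<Sum>\<eta>\<in>I. v (length \<eta>))"
    using branch_dev(4) by (intro sum_mono) (auto simp: U intro: order_trans[OF diff_mono[OF _ zero_le_power2]])
  moreover have "t\<^sup>2 \<le> suminf v * t" using t0 tV by (simp add: power2_eq_square mult_right_mono)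
  ultimately have "expectation (\<lambda>Q. (\<Sum>\<eta>\<in>I. U \<eta> Q)\<^sup>2) \<le> (1 + suminf v) * t"
    using S(2) vI by (simp add: algebra_simps)
  moreover have "expectation (\<lambda>Q. (ln (ratio Q \<epsilon>) - ln (ratio Q (take m \<epsilon>)))\<^sup>2) = expectation (\<lambda>Q. (\<Sum>\<eta>\<in>I. U \<eta> Q)\<^sup>2)"
    using ae by (intro integral_cong_AE) auto
  ultimately show "expectation (\<lambda>Q. (ln (ratio Q \<epsilon>) - ln (ratio Q (take m \<epsilon>)))\<^sup>2) \<le> (1 + suminf v) * (\<Sum>i\<in>{m..<length \<epsilon>}. v i)"
    by (simp add: t_def n_def)
qed

end

subsection \<open>The divergence as a series over levels\<close>

definition (in dyadic_tree) level_term :: "('a \<Rightarrow> real) \<Rightarrow> nat \<Rightarrow> 'a measure \<Rightarrow> real" where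
  "level_term f l Q = (\<Sum>\<epsilon> | length \<epsilon> = l.
       measure (density_measure \<X> f) (B (\<epsilon> @ [False])) * ln (2 * split_prob B \<epsilon> Q)
     + measure (density_measure \<X> f) (B (\<epsilon> @ [True])) * ln (2 * (1 - split_prob B \<epsilon> Q)))"

context bounded_polya_tree
begin

lemma sum_measure_level:
  assumes "prob_space \<mu>" "sets \<mu> = sets BX"
  shows "(\<Sum>\<epsilon> | length \<epsilon> = n. measure \<mu> (B \<epsilon>)) = 1"
  using integral_cell(2)[OF prob_space.axioms(1)[OF assms(1)] assms(2), of "\<lambda>_. 1" n] prob_space.prob_space[OF assms(1)]
  by (simp add: assms)

text \<open>The log ratio of a child is that of its parent plus the log of the doubled branch, and
  the masses of the children add up to that of the parent. So the P_X-mean of the log ratio at level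
  n unfolds into a partial sum of the series.\<close>

lemma sum_level_term:
  assumes f: "prob_density_on \<X> f"
    and Q: "prob_space Q" "sets Q = sets BX" "\<forall>\<epsilon>. 0 < measure Q (B \<epsilon>)" "\<forall>b \<epsilon>. 0 < branch b \<epsilon> Q"
  shows "(\<Sum>\<epsilon> | length \<epsilon> = n. ln (ratio Q \<epsilon>) * measure (density_measure \<X> f) (B \<epsilon>)) = (\<Sum>l<n. level_term f l Q)"
proof (induction n)
  case 0
  then show ?case using ratio_Nil[OF Q(1,2)] by simp
next
  case (Suc n)
  let ?P = "measure (density_measure \<X> f)"
  have ln: "ln (ratio Q (\<epsilon> @ [b])) = ln (ratio Q \<epsilon>) + ln (2 * branch b \<epsilon> Q)" for \<epsilon> b
  proof -
    have "0 < branch b \<epsilon> Q" using Q(4) by blast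
    then show ?thesis
      unfolding ratio_snoc[OF Q(1-3)] using ratio_pos[OF Q(3)] by (intro ln_mult_pos) auto
  qed
  have "(\<Sum>\<epsilon> | length \<epsilon> = Suc n. ln (ratio Q \<epsilon>) * ?P (B \<epsilon>))
      = (\<Sum>\<epsilon> | length \<epsilon> = n. ln (ratio Q \<epsilon>) * ?P (B \<epsilon>) + (?P (B (\<epsilon> @ [False])) * ln (2 * split_prob B \<epsilon> Q)
        + ?P (B (\<epsilon> @ [True])) * ln (2 * (1 - split_prob B \<epsilon> Q))))"
    unfolding sum_length_Suc
  proof (intro sum.cong refl)
    fix \<epsilon>
    have "?P (B \<epsilon>) = ?P (B (\<epsilon> @ [False])) + ?P (B (\<epsilon> @ [True]))"
      using density_measure[OF f] by (intro measure_B_split) (auto simp: prob_space.axioms(1))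
    then show "ln (ratio Q (\<epsilon> @ [False])) * ?P (B (\<epsilon> @ [False])) + ln (ratio Q (\<epsilon> @ [True])) * ?P (B (\<epsilon> @ [True]))
        = ln (ratio Q \<epsilon>) * ?P (B \<epsilon>) + (?P (B (\<epsilon> @ [False])) * ln (2 * split_prob B \<epsilon> Q)
        + ?P (B (\<epsilon> @ [True])) * ln (2 * (1 - split_prob B \<epsilon> Q)))"
      unfolding ln by (simp add: branch_def algebra_simps)
  qed
  then show ?case using Suc.IH by (simp add: sum.distrib level_term_def)
qed

text \<open>Free of any entropy condition, as it must serve to derive one; hence partial sums along
  4^k only. Where f is nonzero t is the logarithm of the random density, elsewhere its values are
  immaterial.\<close>

lemma AE_log_density:
  assumes f: "prob_density_on \<X> f"
  shows "AE Q in PT. \<exists>t. integrable LX (\<lambda>x. f x * t x) \<and>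
    (\<lambda>k. \<Sum>l<4 ^ k. level_term f l Q) \<longlonglongrightarrow> (\<integral>x. f x * t x \<partial>LX) \<and>
    (AE x in LX. f x \<noteq> 0 \<longrightarrow> random_density \<X> Q x = exp (t x))"
proof -
  let ?P = "density_measure \<X> f"
  note P = density_measure[OF f]
  have V0: "0 \<le> suminf v" using summable_v v_nonneg by (intro suminf_nonneg)
  have "AE Q in PT. summable (\<lambda>k. \<Sum>\<epsilon> | length \<epsilon> = 4 ^ Suc k. \<bar>ratio Q \<epsilon> - ratio Q (take (4 ^ k) \<epsilon>)\<bar> * measure LX (B \<epsilon>))"
    by (rule AE_summable_increments[where C="3 * exp (2 * suminf v)"])
       (auto intro: ratio_diff_square sum_measure_level[OF prob_space_LX sets_LX])
  moreover have "AE Q in PT. summable (\<lambda>k. \<Sum>\<epsilon> | length \<epsilon> = 4 ^ Suc k. \<bar>ln (ratio Q \<epsilon>) - ln (ratio Q (take (4 ^ k) \<epsilon>))\<bar> * measure ?P (B \<epsilon>))"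
    by (rule AE_summable_increments[where C="1 + suminf v"])
       (use V0 in \<open>auto intro: ln_ratio_diff_square sum_measure_level[OF P]\<close>)
  ultimately show ?thesis using AE_regular
  proof eventually_elim
    case (elim Q)
    have n: "mono (\<lambda>k. 4 ^ k :: nat)" "filterlim (\<lambda>k. 4 ^ k :: nat) at_top sequentially"
      by (auto simp: mono_def power_increasing intro!: filterlim_subseq strict_monoI power_strict_increasing)
    have Qpos: "0 < measure Q (B \<epsilon>)" for \<epsilon> using elim by blast
    have Q: "prob_space Q" "sets Q = sets BX" using elim by auto
    obtain t where "integrable LX (\<lambda>x. f x * t x)"
      "(\<lambda>k. \<Sum>\<epsilon> | length \<epsilon> = 4 ^ k. ln (ratio Q \<epsilon>) * measure ?P (B \<epsilon>)) \<longlonglongrightarrow> (\<integral>x. f x * t x \<partial>LX)"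
      "AE x in LX. f x \<noteq> 0 \<longrightarrow> random_density \<X> Q x = exp (t x)"
      using log_density_limit[OF f Q Qpos n elim(1)[unfolded measure_LX_B] elim(2)] by blast
    moreover have "(\<Sum>\<epsilon> | length \<epsilon> = 4 ^ k. ln (ratio Q \<epsilon>) * measure ?P (B \<epsilon>)) = (\<Sum>l<4 ^ k. level_term f l Q)" for k
      using elim by (intro sum_level_term[OF f Q]) auto
    ultimately show ?case by auto
  qed
qed

section \<open>First absolute moments of the level terms and the full series\<close>

lemma level_term_integrable:
  shows "integrable PT (level_term f l)"
    and "expectation (level_term f l) = (\<Sum>\<epsilon> | length \<epsilon> = l.
       measure (density_measure \<X> f) (B (\<epsilon> @ [False])) * (ln 2 + beta_ln_mean (\<alpha> (\<epsilon> @ [False])) (\<alpha> (\<epsilon> @ [True])))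
     + measure (density_measure \<X> f) (B (\<epsilon> @ [True])) * (ln 2 + beta_ln_mean (\<alpha> (\<epsilon> @ [True])) (\<alpha> (\<epsilon> @ [False]))))"
  using branch_facts(3)[of False] branch_facts(3)[of True] branch_mean_ln[of False] branch_mean_ln[of True]
  unfolding level_term_def by (simp_all add: branch_def Bochner_Integration.integral_sum)

lemma level_term_mean_le:
  assumes f: "prob_density_on \<X> f"
  shows "\<bar>expectation (level_term f l)\<bar> \<le> v l"
proof -
  define P where "P = measure (density_measure \<X> f)"
  have P0: "0 \<le> P A" for A by (simp add: P_def)
  have "\<bar>expectation (level_term f l)\<bar> \<le> (\<Sum>\<epsilon> | length \<epsilon> = l. P (B \<epsilon>) * v l)"
    unfolding level_term_integrable(2) P_def[symmetric]
  proof (intro order_trans[OF sum_abs sum_mono])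
    fix \<epsilon> :: "bool list" assume l: "\<epsilon> \<in> {\<epsilon>. length \<epsilon> = l}"
    have "P (B \<epsilon>) = P (B (\<epsilon> @ [False])) + P (B (\<epsilon> @ [True]))"
      unfolding P_def using density_measure[OF f] by (intro measure_B_split) (auto simp: prob_space.axioms(1))
    moreover have "\<bar>ln 2 + beta_ln_mean (\<alpha> (\<epsilon> @ [False])) (\<alpha> (\<epsilon> @ [True]))\<bar> \<le> v l"
      "\<bar>ln 2 + beta_ln_mean (\<alpha> (\<epsilon> @ [True])) (\<alpha> (\<epsilon> @ [False]))\<bar> \<le> v l"
      using branch_dev(3)[of False \<epsilon>, unfolded branch_mean_ln] branch_dev(3)[of True \<epsilon>, unfolded branch_mean_ln] l
      by simp_all
    ultimately show "\<bar>P (B (\<epsilon> @ [False])) * (ln 2 + beta_ln_mean (\<alpha> (\<epsilon> @ [False])) (\<alpha> (\<epsilon> @ [True])))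
       + P (B (\<epsilon> @ [True])) * (ln 2 + beta_ln_mean (\<alpha> (\<epsilon> @ [True])) (\<alpha> (\<epsilon> @ [False])))\<bar> \<le> P (B \<epsilon>) * v l"
      using P0 unfolding distrib_right
      by (simp only: distrib_right, intro order_trans[OF abs_triangle_ineq add_mono])
         (auto simp: abs_mult intro!: mult_left_mono)
  qed
  also have "\<dots> = v l"
    using sum_measure_level[OF density_measure[OF f]] by (simp add: P_def sum_distrib_right[symmetric])
  finally show ?thesis .
qed

text \<open>The mean costs v l; the rest is fluctuation. Nodes of one level are independent and each
  contributes at most P(B \<epsilon>)^2 v l to the variance. One factor P(B \<epsilon>) is at most C
  / (l + 1), the other ones sum to 1, so the variance is at most C v l / (l + 1).\<close>

lemma level_term_bound:
  assumes f: "prob_density_on \<X> f" and C: "0 \<le> C" "\<And>\<epsilon>. measure (density_measure \<X> f) (B \<epsilon>) \<le> C / real (Suc (length \<epsilon>))"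
  shows "expectation (\<lambda>Q. \<bar>level_term f l Q\<bar>) \<le> v l + (1 / real (Suc l) ^ 2 + C * (real (Suc l) * v l))"
proof -
  define P where "P = measure (density_measure \<X> f)"
  have P0: "0 \<le> P A" for A by (simp add: P_def)
  have Psplit: "P (B \<epsilon>) = P (B (\<epsilon> @ [False])) + P (B (\<epsilon> @ [True]))" for \<epsilon>
    unfolding P_def using density_measure[OF f] by (intro measure_B_split) (auto simp: prob_space.axioms(1))
  have Psum: "(\<Sum>\<epsilon> | length \<epsilon> = l. P (B \<epsilon>)) = 1"
    unfolding P_def by (rule sum_measure_level[OF density_measure[OF f]])
  define W where "W \<epsilon> y = P (B (\<epsilon> @ [False])) * ln (2 * y) + P (B (\<epsilon> @ [True])) * ln (2 * (1 - y))" for \<epsilon> y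
  define Z where "Z \<epsilon> Q = W \<epsilon> (split_prob B \<epsilon> Q)" for \<epsilon> Q
  have [measurable]: "W \<epsilon> \<in> borel_measurable borel" for \<epsilon> unfolding W_def by measurable
  have [measurable]: "Z \<epsilon> \<in> borel_measurable PT" for \<epsilon> unfolding Z_def by measurable
  have lt: "level_term f l Q = (\<Sum>\<epsilon> | length \<epsilon> = l. Z \<epsilon> Q)" for Q
    by (simp add: level_term_def Z_def W_def P_def)
  have Zb: "Z \<epsilon> Q = P (B (\<epsilon> @ [False])) * ln (2 * branch False \<epsilon> Q) + P (B (\<epsilon> @ [True])) * ln (2 * branch True \<epsilon> Q)" for \<epsilon> Q
    by (simp add: Z_def W_def branch_def)
  define G where "G \<epsilon> Q = P (B \<epsilon>) * (P (B (\<epsilon> @ [False])) * (ln (2 * branch False \<epsilon> Q))\<^sup>2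
      + P (B (\<epsilon> @ [True])) * (ln (2 * branch True \<epsilon> Q))\<^sup>2)" for \<epsilon> Q
  have Gi: "integrable PT (G \<epsilon>)" for \<epsilon> unfolding G_def using branch_facts(4) by auto
  \<comment> \<open>Cauchy-Schwarz with the masses p and q of the children as weights; the gap is p
    q (x - y)^2.\<close>
  have ZG: "(Z \<epsilon> Q)\<^sup>2 \<le> G \<epsilon> Q" for \<epsilon> Q
  proof -
    define p q x y where "p = P (B (\<epsilon> @ [False]))" "q = P (B (\<epsilon> @ [True]))"
      "x = ln (2 * branch False \<epsilon> Q)" "y = ln (2 * branch True \<epsilon> Q)"
    have "0 \<le> p * q * (x - y)\<^sup>2" using P0 by (simp add: p_q_x_y_def)
    also have "p * q * (x - y)\<^sup>2 = (p + q) * (p * x\<^sup>2 + q * y\<^sup>2) - (p * x + q * y)\<^sup>2"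
      by (simp add: power2_eq_square algebra_simps)
    finally show ?thesis unfolding Zb G_def Psplit[of \<epsilon>] by (simp add: p_q_x_y_def)
  qed
  have Zsq: "integrable PT (\<lambda>Q. (Z \<epsilon> Q)\<^sup>2)" for \<epsilon>
    by (rule Bochner_Integration.integrable_bound[OF Gi[of \<epsilon>]])
       (use ZG in \<open>auto intro!: AE_I2 intro: order_trans[OF _ abs_ge_self]\<close>)
  have EZsq: "expectation (\<lambda>Q. (Z \<epsilon> Q)\<^sup>2) \<le> (P (B \<epsilon>))\<^sup>2 * v l" if "length \<epsilon> = l" for \<epsilon>
  proof -
    have "expectation (\<lambda>Q. (Z \<epsilon> Q)\<^sup>2) \<le> expectation (G \<epsilon>)" by (intro integral_mono Zsq Gi ZG)
    also have "\<dots> = P (B \<epsilon>) * (P (B (\<epsilon> @ [False])) * expectation (\<lambda>Q. (ln (2 * branch False \<epsilon> Q))\<^sup>2)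
        + P (B (\<epsilon> @ [True])) * expectation (\<lambda>Q. (ln (2 * branch True \<epsilon> Q))\<^sup>2))"
      unfolding G_def using branch_facts(4) by simp
    also have "\<dots> \<le> P (B \<epsilon>) * (P (B (\<epsilon> @ [False])) * v l + P (B (\<epsilon> @ [True])) * v l)"
      using branch_dev(4)[of _ \<epsilon>] that P0 by (intro mult_left_mono add_mono) auto
    also have "\<dots> = (P (B \<epsilon>))\<^sup>2 * v l" using Psplit[of \<epsilon>] by (simp add: power2_eq_square algebra_simps)
    finally show ?thesis .
  qed
  have "indep_vars (\<lambda>_. borel) Z {\<epsilon>. length \<epsilon> = l}" unfolding Z_def by (rule indep_nodes) measurable
  from indep_vars_sum_square[OF _ this Zsq]
  have S: "integrable PT (\<lambda>Q. (level_term f l Q)\<^sup>2)"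
    "expectation (\<lambda>Q. (level_term f l Q)\<^sup>2) - (expectation (level_term f l))\<^sup>2
      = (\<Sum>\<epsilon> | length \<epsilon> = l. expectation (\<lambda>Q. (Z \<epsilon> Q)\<^sup>2) - (expectation (Z \<epsilon>))\<^sup>2)"
    unfolding lt by auto
  define \<mu> where "\<mu> = expectation (level_term f l)"
  have li: "integrable PT (level_term f l)" by (rule level_term_integrable)
  have \<mu>: "\<bar>\<mu>\<bar> \<le> v l" unfolding \<mu>_def by (rule level_term_mean_le[OF f])
  have "expectation (\<lambda>Q. (level_term f l Q - \<mu>)\<^sup>2) = expectation (\<lambda>Q. (level_term f l Q)\<^sup>2) - \<mu>\<^sup>2"
    using variance_eq[OF li S(1)] by (simp add: \<mu>_def)
  also have "\<dots> \<le> (\<Sum>\<epsilon> | length \<epsilon> = l. (C / real (Suc l) * v l) * P (B \<epsilon>))"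
    unfolding \<mu>_def S(2)
  proof (intro sum_mono)
    fix \<epsilon> :: "bool list" assume "\<epsilon> \<in> {\<epsilon>. length \<epsilon> = l}"
    then have l: "length \<epsilon> = l" by simp
    have "expectation (\<lambda>Q. (Z \<epsilon> Q)\<^sup>2) - (expectation (Z \<epsilon>))\<^sup>2 \<le> expectation (\<lambda>Q. (Z \<epsilon> Q)\<^sup>2)"
      by simp
    also have "\<dots> \<le> P (B \<epsilon>) * (v l * P (B \<epsilon>))"
      using EZsq[OF l] by (simp add: power2_eq_square[of "P (B \<epsilon>)"] mult_ac)
    also have "\<dots> \<le> C / real (Suc l) * (v l * P (B \<epsilon>))"
      using C(2)[of \<epsilon>] v_nonneg P0 l by (intro mult_right_mono mult_nonneg_nonneg) (auto simp: P_def)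
    finally show "expectation (\<lambda>Q. (Z \<epsilon> Q)\<^sup>2) - (expectation (Z \<epsilon>))\<^sup>2 \<le> (C / real (Suc l) * v l) * P (B \<epsilon>)"
      by (simp add: mult.assoc)
  qed
  also have "\<dots> = C / real (Suc l) * v l" unfolding sum_distrib_left[symmetric] Psum by simp
  finally have var: "expectation (\<lambda>Q. (level_term f l Q - \<mu>)\<^sup>2) \<le> C / real (Suc l) * v l" .
  have [measurable]: "level_term f l \<in> borel_measurable PT" using li by auto
  have sqi: "integrable PT (\<lambda>Q. (level_term f l Q - \<mu>)\<^sup>2)"
    unfolding power2_diff using S(1) li by auto
  \<comment> \<open>Here t = 1 / (l + 1)^2, which is summable; against a variance of C v l / (l + 1)
    it leaves C (l + 1) v l, the quantity assumed summable.\<close>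
  have dev: "expectation (\<lambda>Q. \<bar>level_term f l Q - \<mu>\<bar>) \<le> 1 / real (Suc l) ^ 2 + (C / real (Suc l) * v l) / (1 / real (Suc l) ^ 2)"
    using li sqi var by (intro integral_abs_le_sq prob_space_axioms) auto
  have "expectation (\<lambda>Q. \<bar>level_term f l Q\<bar>) \<le> expectation (\<lambda>Q. v l + \<bar>level_term f l Q - \<mu>\<bar>)"
  proof (intro integral_mono)
    fix Q show "\<bar>level_term f l Q\<bar> \<le> v l + \<bar>level_term f l Q - \<mu>\<bar>" using \<mu> by linarith
  qed (use li in auto)
  also have "\<dots> = v l + expectation (\<lambda>Q. \<bar>level_term f l Q - \<mu>\<bar>)"
    using li by (subst Bochner_Integration.integral_add) (auto simp: prob_space)
  also have "\<dots> \<le> v l + (1 / real (Suc l) ^ 2 + C * (real (Suc l) * v l))"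
    using dev by (simp add: power2_eq_square mult_ac)
  finally show ?thesis .
qed

lemma summable_expectation_level_term:
  assumes f: "prob_density_on \<X> f" and int: "integrable LX (\<lambda>x. f x * ln (f x))"
  shows "summable (\<lambda>l. expectation (\<lambda>Q. \<bar>level_term f l Q\<bar>))"
proof -
  obtain C where C: "0 \<le> C" "\<And>\<epsilon>. measure (density_measure \<X> f) (B \<epsilon>) \<le> C / real (Suc (length \<epsilon>))"
    using measure_B_le[OF f int] by blast
  have "summable (\<lambda>l. 1 / real (Suc l) ^ 2)"
    using inverse_power_summable[of 2, where 'a=real] by (subst summable_Suc_iff[of "\<lambda>n. 1 / real n ^ 2"]) (simp add: inverse_eq_divide)
  then have "summable (\<lambda>l. v l + (1 / real (Suc l) ^ 2 + C * (real (Suc l) * v l)))"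
    by (intro summable_add summable_v summable_mult v_summable)
  then show ?thesis
    by (rule summable_comparison_test') (use level_term_bound[OF f C] in auto)
qed

text \<open>Absolute convergence of the series and convergence of the partial sums along 4^k to the
  integral of f t have separate sources. Together they identify the sum.\<close>

lemma kl_div_formula:
  assumes f: "prob_density_on \<X> f" and int: "integrable LX (\<lambda>x. f x * ln (f x))"
  shows "AE Q in PT. summable (\<lambda>l. \<bar>level_term f l Q\<bar>) \<and>
    kl_div \<X> f (random_density \<X> Q) = ereal ((\<integral>x. f x * ln (f x) \<partial>LX) - (\<Sum>l. level_term f l Q))"
  using AE_log_density[OF f]
    AE_summable_if_summable_integral_norm[OF level_term_integrable(1) summable_expectation_level_term[OF f int]]
proof eventually_elim
  case (elim Q)
  then obtain t where t: "integrable LX (\<lambda>x. f x * t x)"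
    "(\<lambda>k. \<Sum>l<4 ^ k. level_term f l Q) \<longlonglongrightarrow> (\<integral>x. f x * t x \<partial>LX)"
    "AE x in LX. f x \<noteq> 0 \<longrightarrow> random_density \<X> Q x = exp (t x)" by blast
  have "(\<lambda>n. \<Sum>l<n. level_term f l Q) \<longlonglongrightarrow> (\<Sum>l. level_term f l Q)"
    using elim(2) by (intro summable_LIMSEQ) (rule summable_rabs_cancel)
  moreover have "filterlim (\<lambda>k. 4 ^ k :: nat) at_top sequentially"
    by (intro filterlim_subseq strict_monoI power_strict_increasing) auto
  ultimately have "(\<lambda>k. \<Sum>l<4 ^ k. level_term f l Q) \<longlonglongrightarrow> (\<Sum>l. level_term f l Q)"
    by (rule filterlim_compose)
  then have "(\<integral>x. f x * t x \<partial>LX) = (\<Sum>l. level_term f l Q)" using t(2) LIMSEQ_unique by blast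
  then show ?case
    using elim(2) kl_div_eq[OF f t(3)] t(1) int by (simp add: ereal_integral_ereal)
qed

text \<open>Meant for the posteriors. Summability of the mean absolute level terms permits taking
  expectations term by term.\<close>

lemma expected_kl_div:
  assumes f: "prob_density_on \<X> f" and int: "integrable LX (\<lambda>x. f x * ln (f x))"
  shows "ereal_integral PT (\<lambda>Q. kl_div \<X> f (random_density \<X> Q))
      = ereal ((\<integral>x. f x * ln (f x) \<partial>LX) - (\<Sum>l. expectation (level_term f l)))"
proof -
  have ae: "AE Q in PT. summable (\<lambda>l. norm (level_term f l Q))"
    using kl_div_formula[OF f int] by eventually_elim simp
  have sm: "summable (\<lambda>l. expectation (\<lambda>Q. norm (level_term f l Q)))"
    using summable_expectation_level_term[OF f int] by simp
  have i: "integrable PT (\<lambda>Q. \<Sum>l. level_term f l Q)"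
    by (rule integrable_suminf[OF level_term_integrable(1) ae sm])
  have "ereal_integral PT (\<lambda>Q. kl_div \<X> f (random_density \<X> Q))
      = ereal_integral PT (\<lambda>Q. ereal ((\<integral>x. f x * ln (f x) \<partial>LX) - (\<Sum>l. level_term f l Q)))"
    using kl_div_formula[OF f int] by (intro ereal_integral_cong_AE) (auto elim: eventually_mono)
  also have "\<dots> = ereal (expectation (\<lambda>Q. (\<integral>x. f x * ln (f x) \<partial>LX) - (\<Sum>l. level_term f l Q)))"
    using i by (intro ereal_integral_ereal) auto
  also have "expectation (\<lambda>Q. (\<integral>x. f x * ln (f x) \<partial>LX) - (\<Sum>l. level_term f l Q))
      = (\<integral>x. f x * ln (f x) \<partial>LX) - (\<Sum>l. expectation (level_term f l))"
    using i integral_suminf[OF level_term_integrable(1) ae sm] by (simp add: prob_space)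
  finally show "ereal_integral PT (\<lambda>Q. kl_div \<X> f (random_density \<X> Q))
      = ereal ((\<integral>x. f x * ln (f x) \<partial>LX) - (\<Sum>l. expectation (level_term f l)))" .
qed

end

subsection \<open>The posterior expectation\<close>

text \<open>The mean of p ln (2 Y) + q ln (2 (1 - Y)) for Y beta distributed with parameters a and
  b; 1 - Y has them exchanged.\<close>

definition node_gain :: "real \<Rightarrow> real \<Rightarrow> real \<Rightarrow> real \<Rightarrow> real" where
  "node_gain p q a b = p * (ln 2 + beta_ln_mean a b) + q * (ln 2 + beta_ln_mean b a)"

lemma node_gain_Suc:
  assumes "0 < a" "0 < b"
  shows "node_gain p q (a + 1) b = node_gain p q a b + (p / a - (p + q) / (a + b))"
    and "node_gain p q a (b + 1) = node_gain p q a b + (q / b - (p + q) / (a + b))"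
  unfolding node_gain_def beta_ln_mean_Suc_left[OF assms] beta_ln_mean_Suc_right[OF assms]
    beta_ln_mean_Suc_left[OF assms(2,1)] beta_ln_mean_Suc_right[OF assms(2,1)] add.commute[of b a]
  by (simp_all add: ring_distribs add_divide_distrib)

text \<open>If the next point falls left with probability p and right with probability q, this is
  the mean change of \<open>node_gain\<close>. It equals an explicit square over a positive number,
  zero exactly when b p = a q.\<close>

lemma node_gain_drift_nonneg:
  fixes a b p q :: real
  assumes "0 < a" "0 < b"
  shows "0 \<le> p * (p / a - (p + q) / (a + b)) + q * (q / b - (p + q) / (a + b))"
proof -
  have "p * (p / a - (p + q) / (a + b)) + q * (q / b - (p + q) / (a + b)) = (b * p - a * q)\<^sup>2 / (a * b * (a + b))"
  proof -
    have "a + b \<noteq> 0" "a \<noteq> 0" "b \<noteq> 0" using assms by auto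
    then show ?thesis by (simp add: divide_simps power2_eq_square) (simp add: algebra_simps)
  qed
  also have "0 \<le> \<dots>" using assms by simp
  finally show ?thesis .
qed

lemma posterior_param_cong:
  "(\<And>i. i < n \<Longrightarrow> x i = y i) \<Longrightarrow> posterior_param B \<alpha> n x \<epsilon> = posterior_param B \<alpha> n y \<epsilon>"
  by (simp add: posterior_param_def)

lemma posterior_param_Suc:
  "posterior_param B \<alpha> (Suc n) x \<epsilon> = posterior_param B \<alpha> n x \<epsilon> + indicator (B \<epsilon>) (x n)"
  by (simp add: posterior_param_def)

text \<open>The increments are integers between 0 and n. So the finite grid in
  \<open>level_dev\<close> covers every posterior after n observations.\<close>

lemma posterior_param_nat:
  obtains k where "k \<le> n" "posterior_param B \<alpha> n x \<epsilon> = \<alpha> \<epsilon> + real k"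
proof
  have eq: "(\<Sum>i<n. indicator (B \<epsilon>) (x i) :: real) = real (card {i. i < n \<and> x i \<in> B \<epsilon>})"
    by (simp add: indicator_def sum.If_cases Collect_conj_eq[symmetric] lessThan_def Int_def)
  show "card {i. i < n \<and> x i \<in> B \<epsilon>} \<le> n"
    using card_mono[of "{..<n}" "{i. i < n \<and> x i \<in> B \<epsilon>}"] by auto
  show "posterior_param B \<alpha> n x \<epsilon> = \<alpha> \<epsilon> + real (card {i. i < n \<and> x i \<in> B \<epsilon>})"
    by (simp add: posterior_param_def eq)
qed

lemma posterior_param_ge: "\<alpha> \<epsilon> \<le> posterior_param B \<alpha> n x \<epsilon>"
  by (rule posterior_param_nat[of n B \<alpha> x \<epsilon>]) simp

text \<open>Counts take countably many values, so every function of them is measurable. This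
  replaces an argument that \<open>beta_ln_mean\<close> is measurable in its parameters.\<close>

lemma measurable_posterior_param_comp:
  fixes \<phi> :: "real \<Rightarrow> real \<Rightarrow> real"
  assumes B: "\<And>\<epsilon>. B \<epsilon> \<in> sets borel" and Y: "\<And>i. i < n \<Longrightarrow> (\<lambda>\<omega>. Y \<omega> i) \<in> borel_measurable N"
  shows "(\<lambda>\<omega>. \<phi> (posterior_param B \<alpha> n (Y \<omega>) \<epsilon>) (posterior_param B \<alpha> n (Y \<omega>) \<eta>)) \<in> borel_measurable N"
proof -
  \<comment> \<open>The count as a natural number, to map into a countable discrete space; the sum
    is an integer, so the floor loses nothing.\<close>
  define c where "c \<epsilon> \<omega> = nat \<lfloor>\<Sum>i<n. indicator (B \<epsilon>) (Y \<omega> i) :: real\<rfloor>" for \<epsilon> \<omega>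
  have ind: "(\<lambda>\<omega>. indicator (B \<epsilon>) (Y \<omega> i) :: real) \<in> borel_measurable N" if "i < n" for \<epsilon> i
    using measurable_compose[OF Y[OF that] borel_measurable_indicator[OF B[of \<epsilon>]]] .
  have [measurable]: "(\<lambda>\<omega>. \<Sum>i<n. indicator (B \<epsilon>) (Y \<omega> i) :: real) \<in> borel_measurable N" for \<epsilon>
    using ind by (intro borel_measurable_sum) auto
  have c[measurable]: "c \<epsilon> \<in> N \<rightarrow>\<^sub>M count_space UNIV" for \<epsilon>
    unfolding c_def by measurable
  have eq: "posterior_param B \<alpha> n (Y \<omega>) \<epsilon> = \<alpha> \<epsilon> + real (c \<epsilon> \<omega>)" for \<epsilon> \<omega>
    by (rule posterior_param_nat[of n B \<alpha> "Y \<omega>" \<epsilon>]) (simp add: c_def posterior_param_def)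
  have "(\<lambda>\<omega>. \<phi> (\<alpha> \<epsilon> + real i) (\<alpha> \<eta> + real (c \<eta> \<omega>))) \<in> borel_measurable N" for i
    by (rule measurable_compose_countable[OF _ c, of "\<lambda>j _. \<phi> (\<alpha> \<epsilon> + real i) (\<alpha> \<eta> + real j)"]) simp
  then have "(\<lambda>\<omega>. \<phi> (\<alpha> \<epsilon> + real (c \<epsilon> \<omega>)) (\<alpha> \<eta> + real (c \<eta> \<omega>))) \<in> borel_measurable N"
    by (rule measurable_compose_countable[OF _ c, of "\<lambda>i \<omega>. \<phi> (\<alpha> \<epsilon> + real i) (\<alpha> \<eta> + real (c \<eta> \<omega>))"])
  then show ?thesis by (simp add: eq)
qed

section \<open>Natural filtration and a criterion for the supermartingale inequality\<close>

lemma natural_filtration_component: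
  assumes "i < n"
  shows "X i \<in> borel_measurable (natural_filtration M X n)"
proof -
  have "(\<lambda>\<omega>. \<lambda>i\<in>{..<n}. X i \<omega>) \<in> natural_filtration M X n \<rightarrow>\<^sub>M (\<Pi>\<^sub>M i\<in>{..<n}. borel)"
    unfolding natural_filtration_def by (rule measurable_vimage_algebra1) (auto simp: space_PiM)
  from measurable_compose[OF this measurable_component_singleton[of i]] assms show ?thesis by simp
qed

lemma space_natural_filtration: "space (natural_filtration M X n) = space M"
  by (simp add: natural_filtration_def)

lemma sets_natural_filtration_le:
  assumes "space N = space M" "\<And>i. i < n \<Longrightarrow> X i \<in> borel_measurable N"
  shows "sets (natural_filtration M X n) \<subseteq> sets N"
  unfolding natural_filtration_def using assms by (intro sets_image_in_sets measurable_restrict) auto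

lemma filtration_natural_filtration: "filtration (space M) (natural_filtration M X)"
proof
  fix i j :: nat assume "i \<le> j"
  then show "sets (natural_filtration M X i) \<subseteq> sets (natural_filtration M X j)"
    by (intro sets_natural_filtration_le natural_filtration_component) (auto simp: space_natural_filtration)
qed (simp add: space_natural_filtration)

lemma (in prob_space) natural_filtration_indep:
  fixes X :: "nat \<Rightarrow> 'a \<Rightarrow> 'b::topological_space" and u :: "(nat \<Rightarrow> 'b) \<Rightarrow> real"
  assumes ind: "indep_vars (\<lambda>_. borel) X UNIV" and E: "E \<in> sets borel"
    and u: "u \<in> borel_measurable (\<Pi>\<^sub>M i\<in>{..<n}. borel)"
    and int: "integrable M (\<lambda>\<omega>. u (\<lambda>i\<in>{..<n}. X i \<omega>))"
  shows "integrable M (\<lambda>\<omega>. u (\<lambda>i\<in>{..<n}. X i \<omega>) * indicator E (X n \<omega>))"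
    and "(\<integral>\<omega>. u (\<lambda>i\<in>{..<n}. X i \<omega>) * indicator E (X n \<omega>) \<partial>M)
      = (\<integral>\<omega>. u (\<lambda>i\<in>{..<n}. X i \<omega>) \<partial>M) * (\<integral>\<omega>. indicator E (X n \<omega>) \<partial>M)"
proof -
  have Xn: "X n \<in> borel_measurable M" using ind by (simp add: indep_vars_def)
  have "indep_var (\<Pi>\<^sub>M i\<in>{..<n}. borel) (\<lambda>\<omega>. \<lambda>i\<in>{..<n}. X i \<omega>) (\<Pi>\<^sub>M i\<in>{n}. borel) (\<lambda>\<omega>. \<lambda>i\<in>{n}. X i \<omega>)"
    using ind by (rule indep_var_restrict) auto
  moreover have "(\<lambda>g. indicator E (g n) :: real) \<in> borel_measurable (\<Pi>\<^sub>M i\<in>{n}. borel)"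
    using E by (intro measurable_compose[OF measurable_component_singleton[of n] borel_measurable_indicator]) auto
  ultimately have "indep_var borel (u \<circ> (\<lambda>\<omega>. \<lambda>i\<in>{..<n}. X i \<omega>)) borel ((\<lambda>g. indicator E (g n) :: real) \<circ> (\<lambda>\<omega>. \<lambda>i\<in>{n}. X i \<omega>))"
    using u by (intro indep_var_compose)
  then have iv: "indep_var borel (\<lambda>\<omega>. u (\<lambda>i\<in>{..<n}. X i \<omega>)) borel (\<lambda>\<omega>. indicator E (X n \<omega>) :: real)"
    by (simp add: comp_def)
  have i2: "integrable M (\<lambda>\<omega>. indicator E (X n \<omega>) :: real)"
    using measurable_compose[OF Xn borel_measurable_indicator[OF E]]
    by (intro integrable_const_bound[where B=1]) auto
  show "integrable M (\<lambda>\<omega>. u (\<lambda>i\<in>{..<n}. X i \<omega>) * indicator E (X n \<omega>))"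
    by (rule indep_var_integrable[OF iv int i2])
  show "(\<integral>\<omega>. u (\<lambda>i\<in>{..<n}. X i \<omega>) * indicator E (X n \<omega>) \<partial>M)
      = (\<integral>\<omega>. u (\<lambda>i\<in>{..<n}. X i \<omega>) \<partial>M) * (\<integral>\<omega>. indicator E (X n \<omega>) \<partial>M)"
    by (rule indep_var_lebesgue_integral[OF iv int i2])
qed

text \<open>Test the hypothesis on the F-measurable set where the conditional expectation exceeds Z:
  there a positive difference has integral at most 0, so the set is null.\<close>

lemma (in prob_space) supermartingale_step:
  assumes F: "subalgebra M F" and Z: "Z \<in> borel_measurable F" "integrable M Z" "integrable M Z'"
    and le: "\<And>A. A \<in> sets F \<Longrightarrow> (\<integral>\<omega>. indicator A \<omega> * Z' \<omega> \<partial>M) \<le> (\<integral>\<omega>. indicator A \<omega> * (Z \<omega> :: real) \<partial>M)"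
  shows "AE \<omega> in M. real_cond_exp M F Z' \<omega> \<le> Z \<omega>"
proof -
  interpret S: finite_measure_subalgebra M F
    using F by unfold_locales
  define g where "g = real_cond_exp M F Z'"
  have [measurable]: "g \<in> borel_measurable F" "Z \<in> borel_measurable F" using Z by (auto simp: g_def)
  have gi: "integrable M g" unfolding g_def using Z by (intro S.real_cond_exp_int)
  define A where "A = {\<omega> \<in> space F. Z \<omega> < g \<omega>}"
  have AF: "A \<in> sets F" unfolding A_def by measurable
  then have AM: "A \<in> sets M" using F by (auto simp: subalgebra_def)
  have sp: "space F = space M" using F by (simp add: subalgebra_def)
  have i: "integrable M (\<lambda>\<omega>. indicator A \<omega> * (g \<omega> - Z \<omega>))"
    using integrable_mult_indicator[OF AM Bochner_Integration.integrable_diff[OF gi Z(2)]] by simp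
  have iA: "integrable M (\<lambda>\<omega>. indicator A \<omega> * g \<omega>)" "integrable M (\<lambda>\<omega>. indicator A \<omega> * Z \<omega>)"
    using integrable_mult_indicator[OF AM gi] integrable_mult_indicator[OF AM Z(2)] by simp_all
  have "(\<integral>\<omega>. indicator A \<omega> * g \<omega> \<partial>M) = (\<integral>\<omega>. indicator A \<omega> * Z' \<omega> \<partial>M)"
    using S.real_cond_exp_intA[OF Z(3) AF] by (simp add: g_def set_lebesgue_integral_def)
  then have "(\<integral>\<omega>. indicator A \<omega> * g \<omega> \<partial>M) \<le> (\<integral>\<omega>. indicator A \<omega> * Z \<omega> \<partial>M)" using le[OF AF] by simp
  then have "(\<integral>\<omega>. indicator A \<omega> * (g \<omega> - Z \<omega>) \<partial>M) \<le> 0"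
    using iA by (simp add: right_diff_distrib)
  moreover have nn: "0 \<le> indicator A \<omega> * (g \<omega> - Z \<omega>)" for \<omega>
    by (auto simp: A_def indicator_def)
  ultimately have "(\<integral>\<omega>. indicator A \<omega> * (g \<omega> - Z \<omega>) \<partial>M) = 0"
    by (intro antisym integral_nonneg_AE) auto
  then have "AE \<omega> in M. indicator A \<omega> * (g \<omega> - Z \<omega>) = 0"
    using integral_nonneg_eq_0_iff_AE[OF i] nn by auto
  then show ?thesis
    using AE_space by eventually_elim (auto simp: A_def g_def[symmetric] sp indicator_def split: if_splits)
qed

text \<open>I and J indicate that the new observation falls in the left or in the right child. The
  three cases, neither included, are merged into one formula linear in I and J, so that means can be
  taken.\<close>

lemma node_gain_step:
  assumes "0 < a" "0 < b" "I \<in> {0, 1}" "J \<in> {0, 1}" "I * J = 0"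
  shows "node_gain p q (a + I) (b + J)
    = node_gain p q a b + ((p / a - (p + q) / (a + b)) * I + (q / b - (p + q) / (a + b)) * J)"
  using assms node_gain_Suc[OF assms(1,2)] by auto

context dyadic_tree
begin

lemma bounded_polya_treeI:
  assumes "polya_tree \<X> B \<beta> PT" "\<And>l. 0 < a l" "summable (\<lambda>l. real l / a l)"
    and \<beta>: "\<And>\<epsilon>. \<exists>k\<le>n. \<beta> \<epsilon> = a (length \<epsilon>) + real k"
  shows "bounded_polya_tree \<X> B PT \<beta> (\<lambda>l. level_dev n (a (Suc l)))"
proof (intro bounded_polya_tree.intro dyadic_tree_axioms bounded_polya_tree_axioms.intro)
  show "polya_tree \<X> B \<beta> PT" by fact
  show "0 < \<beta> \<epsilon>" for \<epsilon> using \<beta>[of \<epsilon>] assms(2)[of "length \<epsilon>"] by auto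
  show "summable (\<lambda>l. real (Suc l) * level_dev n (a (Suc l)))"
    by (rule summable_level_dev[OF assms(2,3)])
  show "beta_dev (\<beta> (\<epsilon> @ [b])) (\<beta> (\<epsilon> @ [\<not> b])) \<le> level_dev n (a (Suc (length \<epsilon>)))" for \<epsilon> b
    using \<beta>[of "\<epsilon> @ [b]"] \<beta>[of "\<epsilon> @ [\<not> b]"] level_dev_ge[OF assms(2)] by force
qed

text \<open>The posterior mean of \<open>level_term\<close>, written from the observations alone;
  measurability, bounds and drift in the outcome are proved for this expression.\<close>

definition level_gain :: "(bool list \<Rightarrow> real) \<Rightarrow> ('a \<Rightarrow> real) \<Rightarrow> nat \<Rightarrow> (nat \<Rightarrow> 'a) \<Rightarrow> nat \<Rightarrow> real" where
  "level_gain \<alpha> f n x l = (\<Sum>\<epsilon> | length \<epsilon> = l.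
     node_gain (measure (density_measure \<X> f) (B (\<epsilon> @ [False]))) (measure (density_measure \<X> f) (B (\<epsilon> @ [True])))
       (posterior_param B \<alpha> n x (\<epsilon> @ [False])) (posterior_param B \<alpha> n x (\<epsilon> @ [True])))"

lemma level_gain_measurable:
  assumes "\<And>i. i < n \<Longrightarrow> (\<lambda>\<omega>. Y \<omega> i) \<in> borel_measurable N"
  shows "(\<lambda>\<omega>. level_gain \<alpha> f n (Y \<omega>) l) \<in> borel_measurable N"
  unfolding level_gain_def
  by (intro borel_measurable_sum measurable_posterior_param_comp[where \<phi>="node_gain _ _"] B_borel assms)

text \<open>Given the first n observations, the next one hits a child with probability its P_X-mass.
  So on A each indicator in the one-step formula may be replaced by that mass, and the integrand
  becomes pointwise a sum of the drifts of \<open>node_gain_drift_nonneg\<close>.\<close>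

lemma level_gain_submartingale:
  fixes M :: "'w measure" and X :: "nat \<Rightarrow> 'w \<Rightarrow> 'a"
  assumes M: "prob_space M" and ind: "prob_space.indep_vars M (\<lambda>_. borel) X UNIV"
    and X: "distributed M LX (X n) (\<lambda>x. ennreal (f x))" and f: "prob_density_on \<X> f"
    and \<alpha>: "\<And>\<epsilon>. 0 < \<alpha> \<epsilon>" and A: "A \<in> sets (natural_filtration M X n)"
    and int: "\<And>n. integrable M (\<lambda>\<omega>. level_gain \<alpha> f n (\<lambda>i. X i \<omega>) l)"
  shows "(\<integral>\<omega>. indicator A \<omega> * level_gain \<alpha> f n (\<lambda>i. X i \<omega>) l \<partial>M)
    \<le> (\<integral>\<omega>. indicator A \<omega> * level_gain \<alpha> f (Suc n) (\<lambda>i. X i \<omega>) l \<partial>M)"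
proof -
  interpret M: prob_space M by fact
  define P where "P = measure (density_measure \<X> f)"
  interpret P: prob_space "density_measure \<X> f" by (rule density_measure[OF f])
  have P: "0 \<le> P E" "P E \<le> 1" for E by (simp_all add: P_def)
  have Psplit: "P (B (\<epsilon> @ [False])) + P (B (\<epsilon> @ [True])) \<le> 1" for \<epsilon>
    using measure_B_split[OF P.finite_measure_axioms density_measure(2)[OF f], of \<epsilon>] P(2)[of "B \<epsilon>"] by (simp add: P_def)
  define \<beta> where "\<beta> \<epsilon> \<omega> = posterior_param B \<alpha> n (\<lambda>i. X i \<omega>) \<epsilon>" for \<epsilon> \<omega>
  have \<beta>: "\<alpha> \<epsilon> \<le> \<beta> \<epsilon> \<omega>" "0 < \<beta> \<epsilon> \<omega>" for \<epsilon> \<omega>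
    using posterior_param_ge[of \<alpha> \<epsilon> B n "\<lambda>i. X i \<omega>"] \<alpha>[of \<epsilon>] by (simp_all add: \<beta>_def)
  define \<phi> where "\<phi> p q a b = p / a - (p + q) / (a + b)" for p q a b :: real
  define d where "d b \<epsilon> \<omega> = \<phi> (P (B (\<epsilon> @ [b]))) (P (B (\<epsilon> @ [\<not> b]))) (\<beta> (\<epsilon> @ [b]) \<omega>) (\<beta> (\<epsilon> @ [\<not> b]) \<omega>)" for b \<epsilon> \<omega>
  define V where "V \<omega> = (\<lambda>i\<in>{..<n}. X i \<omega>)" for \<omega>
  define I where "I b \<epsilon> \<omega> = (indicator (B (\<epsilon> @ [b])) (X n \<omega>) :: real)" for b \<epsilon> \<omega>
  obtain A' where A': "A' \<in> sets (\<Pi>\<^sub>M i\<in>{..<n}. borel)" "A = V -` A' \<inter> space M"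
    using A unfolding natural_filtration_def V_def
    by (subst (asm) sets_vimage_algebra2) (auto simp: space_PiM)
  have AM: "A \<in> sets M"
    using A sets_natural_filtration_le[of M M n X] ind by (auto simp: M.indep_vars_def)
  have step: "level_gain \<alpha> f (Suc n) (\<lambda>i. X i \<omega>) l
      = level_gain \<alpha> f n (\<lambda>i. X i \<omega>) l + (\<Sum>\<epsilon> | length \<epsilon> = l. d False \<epsilon> \<omega> * I False \<epsilon> \<omega> + d True \<epsilon> \<omega> * I True \<epsilon> \<omega>)" for \<omega>
    unfolding level_gain_def sum.distrib[symmetric]
  proof (intro sum.cong refl)
    fix \<epsilon>
    have "I False \<epsilon> \<omega> * I True \<epsilon> \<omega> = 0" using B_Int[of \<epsilon>] by (auto simp: I_def indicator_def)
    then show "node_gain (measure (density_measure \<X> f) (B (\<epsilon> @ [False]))) (measure (density_measure \<X> f) (B (\<epsilon> @ [True])))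
         (posterior_param B \<alpha> (Suc n) (\<lambda>i. X i \<omega>) (\<epsilon> @ [False])) (posterior_param B \<alpha> (Suc n) (\<lambda>i. X i \<omega>) (\<epsilon> @ [True]))
      = node_gain (measure (density_measure \<X> f) (B (\<epsilon> @ [False]))) (measure (density_measure \<X> f) (B (\<epsilon> @ [True])))
         (posterior_param B \<alpha> n (\<lambda>i. X i \<omega>) (\<epsilon> @ [False])) (posterior_param B \<alpha> n (\<lambda>i. X i \<omega>) (\<epsilon> @ [True]))
        + (d False \<epsilon> \<omega> * I False \<epsilon> \<omega> + d True \<epsilon> \<omega> * I True \<epsilon> \<omega>)"
      using node_gain_step[OF \<beta>(2) \<beta>(2), of "I False \<epsilon> \<omega>" "I True \<epsilon> \<omega>"]
      unfolding posterior_param_Suc P_def[symmetric] \<beta>_def[symmetric] I_def[symmetric] d_def \<phi>_def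
      by (simp add: I_def indicator_def add.commute)
  qed
  have EI: "(\<integral>\<omega>. indicator (B \<eta>) (X n \<omega>) \<partial>M) = P (B \<eta>)" for \<eta>
  proof -
    have Xm: "X n \<in> M \<rightarrow>\<^sub>M LX" using X by (rule distributed_measurable)
    have Bs: "B \<eta> \<in> sets LX" using B_sets sets_LX by simp
    have "(\<integral>\<omega>. indicator (B \<eta>) (X n \<omega>) \<partial>M) = (\<integral>x. indicat_real (B \<eta>) x \<partial>distr M LX (X n))"
      using Bs Xm by (subst integral_distr) auto
    also have "distr M LX (X n) = density_measure \<X> f"
      unfolding density_measure_def by (rule distributed_distr_eq_density[OF X])
    finally show ?thesis using Bs by (simp add: P_def density_measure_def)
  qed
  have d_int: "integrable M (\<lambda>\<omega>. indicator A \<omega> * d b \<epsilon> \<omega>)"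
    and dI_int: "integrable M (\<lambda>\<omega>. indicator A \<omega> * d b \<epsilon> \<omega> * I b \<epsilon> \<omega>)"
    and dI_eq: "(\<integral>\<omega>. indicator A \<omega> * d b \<epsilon> \<omega> * I b \<epsilon> \<omega> \<partial>M) = (\<integral>\<omega>. indicator A \<omega> * d b \<epsilon> \<omega> \<partial>M) * P (B (\<epsilon> @ [b]))"
    for b \<epsilon>
  proof -
    \<comment> \<open>The event A and the coefficient \<open>d\<close> as one function of the first
      n observations, the form to which \<open>natural_filtration_indep\<close> applies.\<close>
    define u where "u x = indicator A' x * \<phi> (P (B (\<epsilon> @ [b]))) (P (B (\<epsilon> @ [\<not> b])))
        (posterior_param B \<alpha> n x (\<epsilon> @ [b])) (posterior_param B \<alpha> n x (\<epsilon> @ [\<not> b]))" for x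
    have um[measurable]: "u \<in> borel_measurable (\<Pi>\<^sub>M i\<in>{..<n}. borel)"
      unfolding u_def using A'(1)
      by (intro borel_measurable_times borel_measurable_indicator
          measurable_posterior_param_comp[where \<phi>="\<phi> _ _" and Y="\<lambda>x. x"] B_borel measurable_component_singleton) auto
    have pc: "posterior_param B \<alpha> n (V \<omega>) \<eta> = \<beta> \<eta> \<omega>" for \<omega> \<eta>
      unfolding \<beta>_def by (rule posterior_param_cong) (simp add: V_def)
    have uV: "u (V \<omega>) = indicator A \<omega> * d b \<epsilon> \<omega>" if "\<omega> \<in> space M" for \<omega>
      unfolding u_def pc d_def using that A'(2) by (simp add: indicator_def)
    have Vm: "V \<in> M \<rightarrow>\<^sub>M (\<Pi>\<^sub>M i\<in>{..<n}. borel)"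
      unfolding V_def using ind by (intro measurable_restrict) (auto simp: M.indep_vars_def)
    \<comment> \<open>Posterior parameters never fall below the prior ones, so both quotients in
      \<open>\<phi>\<close> lie between 0 and the inverse prior parameter.\<close>
    have bound: "\<bar>d b \<epsilon> \<omega>\<bar> \<le> 2 / \<alpha> (\<epsilon> @ [b])" for \<omega>
    proof -
      have s: "P (B (\<epsilon> @ [b])) + P (B (\<epsilon> @ [\<not> b])) \<le> 1" using Psplit[of \<epsilon>] by (cases b) auto
      have "P (B (\<epsilon> @ [b])) / \<beta> (\<epsilon> @ [b]) \<omega> \<le> 1 / \<alpha> (\<epsilon> @ [b])"
        using P \<beta> \<alpha> by (intro frac_le) auto
      moreover have "(P (B (\<epsilon> @ [b])) + P (B (\<epsilon> @ [\<not> b]))) / (\<beta> (\<epsilon> @ [b]) \<omega> + \<beta> (\<epsilon> @ [\<not> b]) \<omega>) \<le> 1 / \<alpha> (\<epsilon> @ [b])"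
        using P \<beta>(1)[of "\<epsilon> @ [b]" \<omega>] \<beta>(2)[of "\<epsilon> @ [\<not> b]" \<omega>] \<alpha> s by (intro frac_le) auto
      moreover have "0 \<le> P (B (\<epsilon> @ [b])) / \<beta> (\<epsilon> @ [b]) \<omega>"
        "0 \<le> (P (B (\<epsilon> @ [b])) + P (B (\<epsilon> @ [\<not> b]))) / (\<beta> (\<epsilon> @ [b]) \<omega> + \<beta> (\<epsilon> @ [\<not> b]) \<omega>)"
        using P \<beta>(2) by (simp_all add: less_imp_le add_nonneg_nonneg)
      ultimately show ?thesis unfolding d_def \<phi>_def by (simp add: abs_le_iff)
    qed
    have ui: "integrable M (\<lambda>\<omega>. u (V \<omega>))"
    proof (rule M.integrable_const_bound)
      show "AE \<omega> in M. norm (u (V \<omega>)) \<le> 2 / \<alpha> (\<epsilon> @ [b])"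
      proof (rule AE_I2)
        fix \<omega> assume \<omega>: "\<omega> \<in> space M"
        have "0 \<le> 2 / \<alpha> (\<epsilon> @ [b])" using \<alpha>[of "\<epsilon> @ [b]"] by simp
        then show "norm (u (V \<omega>)) \<le> 2 / \<alpha> (\<epsilon> @ [b])"
          using bound[of \<omega>] unfolding uV[OF \<omega>] by (auto simp: indicator_def)
      qed
      show "(\<lambda>\<omega>. u (V \<omega>)) \<in> borel_measurable M" using Vm um by (rule measurable_compose)
    qed
    show "integrable M (\<lambda>\<omega>. indicator A \<omega> * d b \<epsilon> \<omega>)"
      using ui by (rule Bochner_Integration.integrable_cong[OF refl, THEN iffD1, rotated]) (simp add: uV)
    note nfi = M.natural_filtration_indep[OF ind B_borel[of "\<epsilon> @ [b]"] um ui[unfolded V_def], folded V_def]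
    show "integrable M (\<lambda>\<omega>. indicator A \<omega> * d b \<epsilon> \<omega> * I b \<epsilon> \<omega>)"
      using nfi(1) by (rule Bochner_Integration.integrable_cong[OF refl, THEN iffD1, rotated]) (simp add: uV I_def)
    have "(\<integral>\<omega>. indicator A \<omega> * d b \<epsilon> \<omega> * I b \<epsilon> \<omega> \<partial>M) = (\<integral>\<omega>. u (V \<omega>) * indicator (B (\<epsilon> @ [b])) (X n \<omega>) \<partial>M)"
      by (intro Bochner_Integration.integral_cong) (auto simp: uV I_def)
    also have "\<dots> = (\<integral>\<omega>. u (V \<omega>) \<partial>M) * P (B (\<epsilon> @ [b]))" unfolding nfi(2) EI ..
    also have "(\<integral>\<omega>. u (V \<omega>) \<partial>M) = (\<integral>\<omega>. indicator A \<omega> * d b \<epsilon> \<omega> \<partial>M)"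
      by (intro Bochner_Integration.integral_cong) (auto simp: uV)
    finally show "(\<integral>\<omega>. indicator A \<omega> * d b \<epsilon> \<omega> * I b \<epsilon> \<omega> \<partial>M) = (\<integral>\<omega>. indicator A \<omega> * d b \<epsilon> \<omega> \<partial>M) * P (B (\<epsilon> @ [b]))" .
  qed
  define T where "T \<epsilon> \<omega> = indicator A \<omega> * d False \<epsilon> \<omega> * I False \<epsilon> \<omega> + indicator A \<omega> * d True \<epsilon> \<omega> * I True \<epsilon> \<omega>" for \<epsilon> \<omega>
  have Ti: "integrable M (T \<epsilon>)" for \<epsilon> unfolding T_def using dI_int by simp
  have T: "0 \<le> (\<integral>\<omega>. T \<epsilon> \<omega> \<partial>M)" for \<epsilon>
  proof -
    have "(\<integral>\<omega>. T \<epsilon> \<omega> \<partial>M) = (\<integral>\<omega>. indicator A \<omega> * d False \<epsilon> \<omega> \<partial>M) * P (B (\<epsilon> @ [False]))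
        + (\<integral>\<omega>. indicator A \<omega> * d True \<epsilon> \<omega> \<partial>M) * P (B (\<epsilon> @ [True]))"
      unfolding T_def using dI_int by (simp add: dI_eq)
    also have "\<dots> = (\<integral>\<omega>. indicator A \<omega> * (P (B (\<epsilon> @ [False])) * d False \<epsilon> \<omega> + P (B (\<epsilon> @ [True])) * d True \<epsilon> \<omega>) \<partial>M)"
    proof -
      have "(\<integral>\<omega>. indicator A \<omega> * (P (B (\<epsilon> @ [False])) * d False \<epsilon> \<omega> + P (B (\<epsilon> @ [True])) * d True \<epsilon> \<omega>) \<partial>M)
          = (\<integral>\<omega>. (indicator A \<omega> * d False \<epsilon> \<omega>) * P (B (\<epsilon> @ [False])) + (indicator A \<omega> * d True \<epsilon> \<omega>) * P (B (\<epsilon> @ [True])) \<partial>M)"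
        by (intro Bochner_Integration.integral_cong) (auto simp: algebra_simps)
      then show ?thesis using d_int by simp
    qed
    also have "0 \<le> \<dots>"
    proof (intro integral_nonneg_AE AE_I2 mult_nonneg_nonneg)
      fix \<omega>
      show "0 \<le> P (B (\<epsilon> @ [False])) * d False \<epsilon> \<omega> + P (B (\<epsilon> @ [True])) * d True \<epsilon> \<omega>"
        using node_gain_drift_nonneg[OF \<beta>(2) \<beta>(2), of "P (B (\<epsilon> @ [False]))" "\<epsilon> @ [False]" \<omega> "P (B (\<epsilon> @ [True]))" "\<epsilon> @ [True]" \<omega>]
        by (simp add: d_def \<phi>_def add.commute)
    qed simp
    finally show ?thesis .
  qed
  have gi: "integrable M (\<lambda>\<omega>. indicator A \<omega> * level_gain \<alpha> f n (\<lambda>i. X i \<omega>) l)"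
    using integrable_mult_indicator[OF AM int] by simp
  have "(\<integral>\<omega>. indicator A \<omega> * level_gain \<alpha> f (Suc n) (\<lambda>i. X i \<omega>) l \<partial>M)
      = (\<integral>\<omega>. indicator A \<omega> * level_gain \<alpha> f n (\<lambda>i. X i \<omega>) l + (\<Sum>\<epsilon> | length \<epsilon> = l. T \<epsilon> \<omega>) \<partial>M)"
    unfolding step by (intro Bochner_Integration.integral_cong) (auto simp: T_def sum_distrib_left algebra_simps)
  also have "\<dots> = (\<integral>\<omega>. indicator A \<omega> * level_gain \<alpha> f n (\<lambda>i. X i \<omega>) l \<partial>M) + (\<Sum>\<epsilon> | length \<epsilon> = l. \<integral>\<omega>. T \<epsilon> \<omega> \<partial>M)"
    using gi Ti by (subst Bochner_Integration.integral_add) (auto simp: Bochner_Integration.integral_sum)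
  finally show ?thesis using T by (simp add: sum_nonneg)
qed

text \<open>For every outcome Z is J minus the series of the level gains, and the terms of the
  series are bounded by \<open>w n\<close>, which does not depend on the outcome. This gives
  measurability, boundedness and termwise integration over events, and reduces the inequality to
  single levels, where the gains increase in mean.\<close>

lemma supermartingale_posterior:
  fixes M :: "'w measure" and X :: "nat \<Rightarrow> 'w \<Rightarrow> 'a" and \<Pi>post :: "nat \<Rightarrow> 'w \<Rightarrow> 'a measure measure"
  assumes \<alpha>: "\<And>\<epsilon>. \<alpha> \<epsilon> = a (length \<epsilon>)" and a: "\<And>l. 0 < a l" "summable (\<lambda>l. real l / a l)"
    and f: "prob_density_on \<X> f" and fint: "integrable LX (\<lambda>x. f x * ln (f x))"
    and M: "prob_space M" and ind: "prob_space.indep_vars M (\<lambda>_. BX) X UNIV"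
    and X: "\<And>i. distributed M LX (X i) (\<lambda>x. ennreal (f x))"
    and post: "\<And>n \<omega>. \<omega> \<in> space M \<Longrightarrow> polya_tree \<X> B (posterior_param B \<alpha> n (\<lambda>i. X i \<omega>)) (\<Pi>post n \<omega>)"
  defines "Z \<equiv> \<lambda>n \<omega>. ereal_integral (\<Pi>post n \<omega>) (\<lambda>Q. kl_div \<X> f (random_density \<X> Q))"
  shows "\<And>n \<omega>. \<omega> \<in> space M \<Longrightarrow> \<bar>Z n \<omega>\<bar> \<noteq> \<infinity>"
    and "supermartingale M (natural_filtration M X) (\<lambda>n \<omega>. real_of_ereal (Z n \<omega>))"
proof -
  interpret M: prob_space M by fact
  define J where "J = (\<integral>x. f x * ln (f x) \<partial>LX)"
  define w where "w n l = level_dev n (a (Suc l))" for n l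
  define G where "G n l \<omega> = level_gain \<alpha> f n (\<lambda>i. X i \<omega>) l" for n l \<omega>
  have bpt: "bounded_polya_tree \<X> B (\<Pi>post n \<omega>) (posterior_param B \<alpha> n (\<lambda>i. X i \<omega>)) (w n)" if "\<omega> \<in> space M" for n \<omega>
    unfolding w_def
  proof (rule bounded_polya_treeI[OF post[OF that] a])
    show "\<exists>k\<le>n. posterior_param B \<alpha> n (\<lambda>i. X i \<omega>) \<epsilon> = a (length \<epsilon>) + real k" for \<epsilon>
      by (rule posterior_param_nat[of n B \<alpha> "\<lambda>i. X i \<omega>" \<epsilon>]) (auto simp: \<alpha>)
  qed
  have mean: "integral\<^sup>L (\<Pi>post n \<omega>) (level_term f l) = G n l \<omega>" if "\<omega> \<in> space M" for n l \<omega>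
    using bounded_polya_tree.level_term_integrable(2)[OF bpt[OF that]]
    by (simp add: G_def level_gain_def node_gain_def)
  have Gb: "\<bar>G n l \<omega>\<bar> \<le> w n l" if "\<omega> \<in> space M" for n l \<omega>
    using bounded_polya_tree.level_term_mean_le[OF bpt[OF that] f] mean[OF that] by simp
  have Zeq: "Z n \<omega> = ereal (J - (\<Sum>l. G n l \<omega>))" if "\<omega> \<in> space M" for n \<omega>
    unfolding Z_def J_def using bounded_polya_tree.expected_kl_div[OF bpt[OF that] f fint] mean[OF that] by simp
  then show "\<And>n \<omega>. \<omega> \<in> space M \<Longrightarrow> \<bar>Z n \<omega>\<bar> \<noteq> \<infinity>" by simp
  have wsum: "summable (w n)" for n
    unfolding w_def
    by (rule summable_comparison_test'[OF summable_level_dev[OF a, of n]])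
       (use level_dev_nonneg[OF a(1)] in \<open>simp add: algebra_simps\<close>)
  have Xborel: "M.indep_vars (\<lambda>_. borel) X UNIV"
    using M.indep_vars_compose2[OF ind, of "\<lambda>_ x. x" "\<lambda>_. borel"] by (simp add: measurable_restrict_space1)
  have Xm: "X i \<in> borel_measurable M" for i using Xborel by (simp add: M.indep_vars_def)
  have sub: "subalgebra M (natural_filtration M X n)" for n
    using sets_natural_filtration_le[of M M n X] Xm by (simp add: subalgebra_def space_natural_filtration)
  have GF: "G n l \<in> borel_measurable (natural_filtration M X n)" for n l
    unfolding G_def by (intro level_gain_measurable natural_filtration_component)
  have GM: "G n l \<in> borel_measurable M" for n l
    using measurable_from_subalg[OF sub GF] .
  have Gi: "integrable M (G n l)" for n l
    using Gb GM by (intro M.integrable_const_bound[where B="w n l"]) auto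
  have GS: "\<bar>\<Sum>l. G n l \<omega>\<bar> \<le> suminf (w n)" "summable (\<lambda>l. \<bar>G n l \<omega>\<bar>)" if "\<omega> \<in> space M" for n \<omega>
  proof -
    show sm: "summable (\<lambda>l. \<bar>G n l \<omega>\<bar>)"
      using Gb[OF that] by (intro summable_comparison_test'[OF wsum[of n]]) auto
    have "\<bar>\<Sum>l. G n l \<omega>\<bar> \<le> (\<Sum>l. \<bar>G n l \<omega>\<bar>)" by (rule summable_rabs[OF sm])
    also have "\<dots> \<le> suminf (w n)" by (rule suminf_le[OF Gb[OF that] sm wsum])
    finally show "\<bar>\<Sum>l. G n l \<omega>\<bar> \<le> suminf (w n)" .
  qed
  have rZ: "real_of_ereal (Z n \<omega>) = J - (\<Sum>l. G n l \<omega>)" if "\<omega> \<in> space M" for n \<omega>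
    using Zeq[OF that] by simp
  have ZF: "(\<lambda>\<omega>. real_of_ereal (Z n \<omega>)) \<in> borel_measurable (natural_filtration M X n)" for n
  proof -
    have "(\<lambda>\<omega>. J - (\<Sum>l. G n l \<omega>)) \<in> borel_measurable (natural_filtration M X n)"
      using GF by measurable
    then show ?thesis
      by (subst measurable_cong[where g="\<lambda>\<omega>. J - (\<Sum>l. G n l \<omega>)"]) (auto simp: space_natural_filtration rZ)
  qed
  have Zi: "integrable M (\<lambda>\<omega>. real_of_ereal (Z n \<omega>))" for n
  proof (rule M.integrable_const_bound)
    show "(\<lambda>\<omega>. real_of_ereal (Z n \<omega>)) \<in> borel_measurable M"
      using measurable_from_subalg[OF sub ZF] .
    show "AE \<omega> in M. norm (real_of_ereal (Z n \<omega>)) \<le> \<bar>J\<bar> + suminf (w n)"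
      using GS(1)[of _ n] by (intro AE_I2) (force simp: rZ)
  qed
  have int_eq: "(\<integral>\<omega>. indicator A \<omega> * real_of_ereal (Z n \<omega>) \<partial>M)
      = (\<integral>\<omega>. indicator A \<omega> * J \<partial>M) - (\<Sum>l. \<integral>\<omega>. indicator A \<omega> * G n l \<omega> \<partial>M)"
    and int_sum: "summable (\<lambda>l. \<integral>\<omega>. indicator A \<omega> * G n l \<omega> \<partial>M)" if A: "A \<in> sets M" for A n
  proof -
    have i: "integrable M (\<lambda>\<omega>. indicator A \<omega> * G n l \<omega>)" for l
      using integrable_mult_indicator[OF A Gi] by simp
    have ae: "AE \<omega> in M. summable (\<lambda>l. norm (indicator A \<omega> * G n l \<omega>))"
      using GS(2)[of _ n] by (intro AE_I2) (auto simp: indicator_def)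
    have sm: "summable (\<lambda>l. \<integral>\<omega>. norm (indicator A \<omega> * G n l \<omega>) \<partial>M)"
    proof (rule summable_comparison_test'[OF wsum[of n]])
      fix l
      have "(\<integral>\<omega>. norm (indicator A \<omega> * G n l \<omega>) \<partial>M) \<le> (\<integral>\<omega>. w n l \<partial>M)"
        using i Gb order_trans[OF abs_ge_zero Gb] by (intro integral_mono_AE AE_I2) (auto simp: indicator_def)
      then show "norm (\<integral>\<omega>. norm (indicator A \<omega> * G n l \<omega>) \<partial>M) \<le> w n l" by (simp add: M.prob_space)
    qed
    show "summable (\<lambda>l. \<integral>\<omega>. indicator A \<omega> * G n l \<omega> \<partial>M)" by (rule summable_integral[OF i ae sm])
    have "(\<integral>\<omega>. indicator A \<omega> * real_of_ereal (Z n \<omega>) \<partial>M)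
        = (\<integral>\<omega>. indicator A \<omega> * J - (\<Sum>l. indicator A \<omega> * G n l \<omega>) \<partial>M)"
      by (intro Bochner_Integration.integral_cong) (auto simp: rZ indicator_def)
    also have "\<dots> = (\<integral>\<omega>. indicator A \<omega> * J \<partial>M) - (\<integral>\<omega>. (\<Sum>l. indicator A \<omega> * G n l \<omega>) \<partial>M)"
      using A integrable_suminf[OF i ae sm]
      by (intro Bochner_Integration.integral_diff integrable_mult_left integrable_real_indicator) (auto simp: less_top[symmetric])
    also have "(\<integral>\<omega>. (\<Sum>l. indicator A \<omega> * G n l \<omega>) \<partial>M) = (\<Sum>l. \<integral>\<omega>. indicator A \<omega> * G n l \<omega> \<partial>M)"
      by (rule integral_suminf[OF i ae sm])
    finally show "(\<integral>\<omega>. indicator A \<omega> * real_of_ereal (Z n \<omega>) \<partial>M)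
      = (\<integral>\<omega>. indicator A \<omega> * J \<partial>M) - (\<Sum>l. \<integral>\<omega>. indicator A \<omega> * G n l \<omega> \<partial>M)" .
  qed
  have step: "AE \<omega> in M. real_cond_exp M (natural_filtration M X n) (\<lambda>\<omega>. real_of_ereal (Z (Suc n) \<omega>)) \<omega> \<le> real_of_ereal (Z n \<omega>)" for n
  proof (rule M.supermartingale_step[OF sub ZF Zi Zi])
    fix A assume A: "A \<in> sets (natural_filtration M X n)"
    then have AM: "A \<in> sets M" using sub[of n] by (auto simp: subalgebra_def)
    have "(\<Sum>l. \<integral>\<omega>. indicator A \<omega> * G n l \<omega> \<partial>M) \<le> (\<Sum>l. \<integral>\<omega>. indicator A \<omega> * G (Suc n) l \<omega> \<partial>M)"
    proof (rule suminf_le[OF _ int_sum[OF AM] int_sum[OF AM]])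
      fix l
      show "(\<integral>\<omega>. indicator A \<omega> * G n l \<omega> \<partial>M) \<le> (\<integral>\<omega>. indicator A \<omega> * G (Suc n) l \<omega> \<partial>M)"
        unfolding G_def using Gi[unfolded G_def] a \<alpha>
        by (intro level_gain_submartingale[OF M Xborel X f _ A]) auto
    qed
    then show "(\<integral>\<omega>. indicator A \<omega> * real_of_ereal (Z (Suc n) \<omega>) \<partial>M) \<le> (\<integral>\<omega>. indicator A \<omega> * real_of_ereal (Z n \<omega>) \<partial>M)"
      unfolding int_eq[OF AM] by simp
  qed
  show "supermartingale M (natural_filtration M X) (\<lambda>n \<omega>. real_of_ereal (Z n \<omega>))"
    unfolding supermartingale_def using filtration_natural_filtration sub ZF Zi step by blast
qed

end

theorem theorem3:
  fixes \<X> :: "'a::euclidean_space set"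
    and B :: "bool list \<Rightarrow> 'a set"
    and \<alpha> :: "bool list \<Rightarrow> real"
    and a :: "nat \<Rightarrow> real"
    and \<Pi>\<^sub>0 :: "'a measure measure"
    and f\<^sub>0 :: "'a \<Rightarrow> real"
  assumes "compact \<X>"
    and "partition_tree \<X> B"
    and "\<And>\<epsilon>. 0 < \<alpha> \<epsilon>"
    and "polya_tree \<X> B \<alpha> \<Pi>\<^sub>0"
    and "\<And>\<epsilon>. \<alpha> \<epsilon> = a (length \<epsilon>)"
    and "summable (\<lambda>l. real l / a l)"
    and "\<And>\<epsilon>. emeasure lborel (B \<epsilon>) = ennreal ((1 / 2) ^ length \<epsilon>)"
    and "prob_density_on \<X> f\<^sub>0"
    and "\<exists>\<delta>>0. measure \<Pi>\<^sub>0 {Q \<in> space \<Pi>\<^sub>0. kl_div \<X> f\<^sub>0 (random_density \<X> Q) \<le> ereal \<delta>} > 0"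
  shows "(AE Q in \<Pi>\<^sub>0. \<exists>S.
            (\<lambda>l. \<Sum>\<epsilon> | length \<epsilon> = l.
                measure (density_measure \<X> f\<^sub>0) (B (\<epsilon> @ [False])) * ln (2 * split_prob B \<epsilon> Q)
              + measure (density_measure \<X> f\<^sub>0) (B (\<epsilon> @ [True])) * ln (2 * (1 - split_prob B \<epsilon> Q)))
              sums S \<and>
            kl_div \<X> f\<^sub>0 (random_density \<X> Q) = - diff_entropy \<X> f\<^sub>0 - ereal S)
       \<and> (\<forall>(M :: 'w measure) (X :: nat \<Rightarrow> 'w \<Rightarrow> 'a) (\<Pi>post :: nat \<Rightarrow> 'w \<Rightarrow> 'a measure measure).
            prob_space M \<longrightarrow>
            prob_space.indep_vars M (\<lambda>_. restrict_space borel \<X>) X UNIV \<longrightarrow>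
            (\<forall>i. distributed M (restrict_space lborel \<X>) (X i) (\<lambda>x. ennreal (f\<^sub>0 x))) \<longrightarrow>
            (\<forall>n. \<forall>\<omega>\<in>space M.
                polya_tree \<X> B (posterior_param B \<alpha> n (\<lambda>i. X i \<omega>)) (\<Pi>post n \<omega>)) \<longrightarrow>
            (\<forall>n. AE \<omega> in M.
                \<bar>ereal_integral (\<Pi>post n \<omega>) (\<lambda>Q. kl_div \<X> f\<^sub>0 (random_density \<X> Q))\<bar> \<noteq> \<infinity>) \<and>
            supermartingale M (natural_filtration M X)
              (\<lambda>n \<omega>. real_of_ereal
                 (ereal_integral (\<Pi>post n \<omega>) (\<lambda>Q. kl_div \<X> f\<^sub>0 (random_density \<X> Q)))))"
proof -
  have X_borel: "\<X> \<in> sets borel" using assms(1) by (simp add: compact_imp_closed)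
  interpret dyadic_tree \<X> B using assms(2) X_borel assms(7) by unfold_locales auto
  have a_pos: "0 < a l" for l using assms(3)[of "replicate l True"] assms(5)[of "replicate l True"] by simp
  \<comment> \<open>The case of 0 observations.\<close>
  interpret prior: bounded_polya_tree \<X> B \<Pi>\<^sub>0 \<alpha> "\<lambda>l. level_dev 0 (a (Suc l))"
    by (rule bounded_polya_treeI[OF assms(4) a_pos assms(6)]) (simp add: assms(5))
  note f = assms(8)
  obtain \<delta> where "0 < measure \<Pi>\<^sub>0 {Q \<in> space \<Pi>\<^sub>0. kl_div \<X> f\<^sub>0 (random_density \<X> Q) \<le> ereal \<delta>}"
    using assms(9) by blast
  then have "\<not> (AE Q in \<Pi>\<^sub>0. Q \<notin> {Q \<in> space \<Pi>\<^sub>0. kl_div \<X> f\<^sub>0 (random_density \<X> Q) \<le> ereal \<delta>})"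
    (is "\<not> (AE Q in \<Pi>\<^sub>0. Q \<notin> ?A)")
  proof -
    assume pos: "0 < measure \<Pi>\<^sub>0 ?A"
    \<comment> \<open>\<open>measure\<close> is 0 on sets outside the \<sigma>-algebra, so
      positivity of the measure already makes the set an event.\<close>
    then have "?A \<in> prior.events" using measure_notin_sets[of ?A \<Pi>\<^sub>0] by (metis less_irrefl)
    from prior.prob_eq_0[OF this] pos show ?thesis by simp
  qed
  \<comment> \<open>One Q with finite divergence at which the almost sure representation also holds
    is enough: integrability of the entropy integrand does not involve Q.\<close>
  then obtain Q t where "kl_div \<X> f\<^sub>0 (random_density \<X> Q) \<le> ereal \<delta>"
    "integrable LX (\<lambda>x. f\<^sub>0 x * t x)" "AE x in LX. f\<^sub>0 x \<noteq> 0 \<longrightarrow> random_density \<X> Q x = exp (t x)"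
  proof -
    assume frq: "\<not> (AE Q in \<Pi>\<^sub>0. Q \<notin> {Q \<in> space \<Pi>\<^sub>0. kl_div \<X> f\<^sub>0 (random_density \<X> Q) \<le> ereal \<delta>})"
    have "\<exists>Q t. kl_div \<X> f\<^sub>0 (random_density \<X> Q) \<le> ereal \<delta> \<and>
      integrable LX (\<lambda>x. f\<^sub>0 x * t x) \<and> (AE x in LX. f\<^sub>0 x \<noteq> 0 \<longrightarrow> random_density \<X> Q x = exp (t x))"
    proof (rule ccontr)
      assume none: "\<not> ?thesis"
      have "AE Q in \<Pi>\<^sub>0. Q \<notin> {Q \<in> space \<Pi>\<^sub>0. kl_div \<X> f\<^sub>0 (random_density \<X> Q) \<le> ereal \<delta>}"
        using prior.AE_log_density[OF f] by eventually_elim (use none in blast)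
      with frq show False by contradiction
    qed
    then show ?thesis using that by blast
  qed
  then have fint: "integrable LX (\<lambda>x. f\<^sub>0 x * ln (f\<^sub>0 x))"
    using kl_div_finite_imp_integrable[OF f] by blast
  have H: "- diff_entropy \<X> f\<^sub>0 = ereal (\<integral>x. f\<^sub>0 x * ln (f\<^sub>0 x) \<partial>LX)"
    unfolding diff_entropy_def using ereal_integral_ereal[OF fint] by simp
  show ?thesis
  proof (intro conjI allI impI)
    show "AE Q in \<Pi>\<^sub>0. \<exists>S.
            (\<lambda>l. \<Sum>\<epsilon> | length \<epsilon> = l.
                measure (density_measure \<X> f\<^sub>0) (B (\<epsilon> @ [False])) * ln (2 * split_prob B \<epsilon> Q)
              + measure (density_measure \<X> f\<^sub>0) (B (\<epsilon> @ [True])) * ln (2 * (1 - split_prob B \<epsilon> Q)))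
              sums S \<and>
            kl_div \<X> f\<^sub>0 (random_density \<X> Q) = - diff_entropy \<X> f\<^sub>0 - ereal S"
      using prior.kl_div_formula[OF f fint]
    proof eventually_elim
      case (elim Q)
      then have "(\<lambda>l. level_term f\<^sub>0 l Q) sums (\<Sum>l. level_term f\<^sub>0 l Q)"
        by (intro summable_sums) (auto intro: summable_rabs_cancel)
      with elim show ?case unfolding level_term_def H by auto
    qed
    fix M :: "'w measure" and X :: "nat \<Rightarrow> 'w \<Rightarrow> 'a" and \<Pi>post :: "nat \<Rightarrow> 'w \<Rightarrow> 'a measure measure"
    assume M: "prob_space M" and X: "prob_space.indep_vars M (\<lambda>_. BX) X UNIV"
      "\<forall>i. distributed M LX (X i) (\<lambda>x. ennreal (f\<^sub>0 x))"
      and post: "\<forall>n. \<forall>\<omega>\<in>space M. polya_tree \<X> B (posterior_param B \<alpha> n (\<lambda>i. X i \<omega>)) (\<Pi>post n \<omega>)"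
    note sp = supermartingale_posterior[OF assms(5) a_pos assms(6) f fint M X(1) X(2)[rule_format] post[rule_format]]
    show "AE \<omega> in M. \<bar>ereal_integral (\<Pi>post n \<omega>) (\<lambda>Q. kl_div \<X> f\<^sub>0 (random_density \<X> Q))\<bar> \<noteq> \<infinity>" for n
      using sp(1) by (intro AE_I2) auto
    show "supermartingale M (natural_filtration M X)
              (\<lambda>n \<omega>. real_of_ereal
                 (ereal_integral (\<Pi>post n \<omega>) (\<lambda>Q. kl_div \<X> f\<^sub>0 (random_density \<X> Q))))"
      by (rule sp(2))
  qed
qed

end
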